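(* Assume there are $\rho>1$ and $0<\delta\le1$ and a constant $C$ such that $\mathbb{E}(|Y_1|^{2+\delta})<\infty$ and $\alpha_Y(k)\le Ck^{-\rho(2+\delta)(1+\delta)/\delta^2}$ for all $k\in\mathbb{N}$. Moreover, let $$s>\Big(1+\tfrac{\delta^2}{\rho(2+\delta)(1+\delta)}\Big)\Big/\Big(2+\tfrac{\delta^2}{\rho(2+\delta)(1+\delta)}\Big)\quad\text{for } \ell_n=n^s .$$ Then, under the hypothesis that $\mu$ is constant (there is $\mu_H\in\mathbb{R}$ with $\mu(x)=\mu_H$ for almost all $x\in[0,1]$), $$\frac{\sqrt{\ell_n}}{\kappa_Y}U(n)\longrightarrow \int_0^1\int_0^1\sqrt{\sigma^2(x)+\sigma^2(y)}\,\mathrm{d}x\,\mathrm{d}y\cdot\sqrt{\frac{2}{\pi}}\quad\text{in }L^1\text{ as }n\to\infty .$$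
   Context: $(Y_i)_{i\in\mathbb{N}}$ is a strictly stationary real-valued process with $\mathbb{E}(Y_1)=0$, $\mathrm{Var}(Y_1)=1$. For $\sigma$-fields $\mathcal{A},\mathcal{B}$ let $\alpha(\mathcal{A},\mathcal{B})=\sup\{|\mathbb{P}(A)\mathbb{P}(B)-\mathbb{P}(A\cap B)|:A\in\mathcal{A},B\in\mathcal{B}\}$ and $\alpha_Y(k)=\sup_{m\in\mathbb{N}}\alpha(\sigma(Y_1,\dots,Y_m),\sigma(Y_{k+m},Y_{k+m+1},\dots))$; $(Y_i)$ is $\alpha$-mixing, i.e. $\alpha_Y(k)\to0$. The long run variance $\kappa_Y^2=\mathrm{Var}(Y_1)+2\sum_{k=1}^\infty\mathrm{Cov}(Y_1,Y_{k+1})$ (finite under the moment and mixing assumptions made) satisfies $\kappa_Y^2>0$. Observations: $X_i=X_{i,n}=\mu(i/n)+\sigma(i/n)Y_i$, $i=1,\dots,n$, where $\mu:[0,1]\to\mathbb{R}$ is càdlàg and $\sigma:[0,1]\to(0,\infty)$ is càdlàg and piecewise Lipschitz-continuous (the sum of a Lipschitz-continuous function and a piecewise constant function with a fixed finite number of jumps), with $\sigma(x)\ge\sigma_0$ for all $x\in[0,1]$ and some $\sigma_0>0$. Blocks: $\ell_n=n^s$, $b_n=n^{1-s}$ with $s\in(0.5,1)$; both are assumed to be integers. Local means $\hat\mu_j=\hat\mu_{j,n}=\frac1{\ell_n}\sum_{i=(j-1)\ell_n+1}^{j\ell_n}X_i$, $1\le j\le b_n$, and $$U(n)=\frac{1}{b_n(b_n-1)}\sum_{1\le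 j\ne k\le b_n}|\hat\mu_j-\hat\mu_k| .$$ *)

theory Defs
  imports "HOL-Probability.Probability"
begin

text \<open>
  A process \<open>(Y\<^sub>i)\<close>, \<open>i = 1, 2, \<dots>\<close>, is a function \<open>Y :: nat \<Rightarrow> 'a \<Rightarrow> real\<close>;
  the value \<open>Y 0\<close> is never used.  Functions on the unit interval are total functions on the
  reals of which only the values on \<open>{0..1}\<close> are used.
\<close>

definition strictly_stationary :: "'a measure \<Rightarrow> (nat \<Rightarrow> 'a \<Rightarrow> real) \<Rightarrow> bool" where
  "strictly_stationary M Y \<longleftrightarrow>
     (\<forall>i\<ge>1. Y i \<in> borel_measurable M) \<and>
     (\<forall>J h. finite J \<and> J \<subseteq> {1..} \<longrightarrow>
        distr M (Pi\<^sub>M J (\<lambda>_. borel)) (\<lambda>\<omega>. \<lambda>i\<in>J. Y (i + h) \<omega>) =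
        distr M (Pi\<^sub>M J (\<lambda>_. borel)) (\<lambda>\<omega>. \<lambda>i\<in>J. Y i \<omega>))"

definition generated_events :: "'a measure \<Rightarrow> (nat \<Rightarrow> 'a \<Rightarrow> real) \<Rightarrow> nat set \<Rightarrow> 'a set set" where
  "generated_events M Y I =
     sigma_sets (space M) (\<Union>i\<in>I. {Y i -` B \<inter> space M | B. B \<in> sets borel})"

text \<open>The suprema below are over nonempty sets of reals in \<open>[0, 1]\<close> when \<open>M\<close> is a
  probability space, so the conditionally complete \<open>SUP\<close> on the reals is the intended one.\<close>

definition alpha_coeff :: "'a measure \<Rightarrow> 'a set set \<Rightarrow> 'a set set \<Rightarrow> real" where
  "alpha_coeff M \<A> \<B> =
     (SUP (A, B) \<in> \<A> \<times> \<B>. \<bar>measure M A * measure M B - measure M (A \<inter> B)\<bar>)"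

definition alpha_mixing_coeff :: "'a measure \<Rightarrow> (nat \<Rightarrow> 'a \<Rightarrow> real) \<Rightarrow> nat \<Rightarrow> real" where
  "alpha_mixing_coeff M Y k =
     (SUP m \<in> {1..}. alpha_coeff M (generated_events M Y {1..m}) (generated_events M Y {k + m..}))"

definition alpha_mixing :: "'a measure \<Rightarrow> (nat \<Rightarrow> 'a \<Rightarrow> real) \<Rightarrow> bool" where
  "alpha_mixing M Y \<longleftrightarrow> alpha_mixing_coeff M Y \<longlonglongrightarrow> 0"

definition cov :: "'a measure \<Rightarrow> ('a \<Rightarrow> real) \<Rightarrow> ('a \<Rightarrow> real) \<Rightarrow> real" where
  "cov M X Z =
     (\<integral>\<omega>. (X \<omega> - (\<integral>\<omega>'. X \<omega>' \<partial>M)) * (Z \<omega> - (\<integral>\<omega>'. Z \<omega>' \<partial>M)) \<partial>M)"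

definition long_run_variance :: "'a measure \<Rightarrow> (nat \<Rightarrow> 'a \<Rightarrow> real) \<Rightarrow> real" where
  "long_run_variance M Y =
     prob_space.variance M (Y 1) + 2 * (\<Sum>k. cov M (Y 1) (Y (Suc k + 1)))"

definition cadlag01 :: "(real \<Rightarrow> real) \<Rightarrow> bool" where
  "cadlag01 f \<longleftrightarrow>
     (\<forall>x\<in>{0..<1}. (f \<longlongrightarrow> f x) (at_right x)) \<and>
     (\<forall>x\<in>{0<..1}. \<exists>l. (f \<longlongrightarrow> l) (at_left x))"

text \<open>\<open>D\<close> is the finite set of possible jump locations; the value of \<open>f\<close> at a jump location is
  not restricted here.\<close>

definition piecewise_constant01 :: "(real \<Rightarrow> real) \<Rightarrow> bool" where
  "piecewise_constant01 f \<longleftrightarrow>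
     (\<exists>D. finite D \<and> D \<subseteq> {0..1} \<and>
        (\<forall>x\<in>{0..1}. \<forall>y\<in>{0..1}. x \<le> y \<and> {x..y} \<inter> D = {} \<longrightarrow> f x = f y))"

definition piecewise_lipschitz01 :: "(real \<Rightarrow> real) \<Rightarrow> bool" where
  "piecewise_lipschitz01 f \<longleftrightarrow>
     (\<exists>g h L. L-lipschitz_on {0..1} g \<and> piecewise_constant01 h \<and>
        (\<forall>x\<in>{0..1}. f x = g x + h x))"

definition obs :: "(real \<Rightarrow> real) \<Rightarrow> (real \<Rightarrow> real) \<Rightarrow> (nat \<Rightarrow> 'a \<Rightarrow> real) \<Rightarrow> nat \<Rightarrow> nat \<Rightarrow> 'a \<Rightarrow> real"
  where "obs \<mu> \<sigma> Y n i \<omega> = \<mu> (real i / real n) + \<sigma> (real i / real n) * Y i \<omega>"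

text \<open>The floors play a role only off the set of admissible \<open>n\<close>, those for which \<open>n\<^sup>s\<close> and
  \<open>n\<^sup>1\<^sup>-\<^sup>s\<close> are both integers; limits are taken along admissible \<open>n\<close> only.\<close>

definition block_length :: "real \<Rightarrow> nat \<Rightarrow> nat" where
  "block_length s n = nat \<lfloor>real n powr s\<rfloor>"

definition block_count :: "real \<Rightarrow> nat \<Rightarrow> nat" where
  "block_count s n = nat \<lfloor>real n powr (1 - s)\<rfloor>"

definition admissible :: "real \<Rightarrow> nat set" where
  "admissible s = {n. real n powr s \<in> \<nat> \<and> real n powr (1 - s) \<in> \<nat>}"

definition admissible_at_top :: "real \<Rightarrow> nat filter" where
  "admissible_at_top s = inf at_top (principal (admissible s))"

lemma admissible_block_sizes:
  assumes "n \<in> admissible s"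
  shows "real (block_length s n) = real n powr s"
    and "real (block_count s n) = real n powr (1 - s)"
proof -
  obtain k m where "real n powr s = real k" "real n powr (1 - s) = real m"
    using assms unfolding admissible_def by (auto elim!: Nats_cases)
  then show "real (block_length s n) = real n powr s"
    and "real (block_count s n) = real n powr (1 - s)"
    by (simp_all only: block_length_def block_count_def floor_of_nat nat_int)
qed

definition local_mean ::
  "(real \<Rightarrow> real) \<Rightarrow> (real \<Rightarrow> real) \<Rightarrow> (nat \<Rightarrow> 'a \<Rightarrow> real) \<Rightarrow> real \<Rightarrow> nat \<Rightarrow> nat \<Rightarrow> 'a \<Rightarrow> real" where
  "local_mean \<mu> \<sigma> Y s n j \<omega> =
     (\<Sum>i = (j - 1) * block_length s n + 1..j * block_length s n. obs \<mu> \<sigma> Y n i \<omega>)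
       / real (block_length s n)"

definition U_stat ::
  "(real \<Rightarrow> real) \<Rightarrow> (real \<Rightarrow> real) \<Rightarrow> (nat \<Rightarrow> 'a \<Rightarrow> real) \<Rightarrow> real \<Rightarrow> nat \<Rightarrow> 'a \<Rightarrow> real" where
  "U_stat \<mu> \<sigma> Y s n \<omega> =
     (\<Sum>j\<in>{1..block_count s n}. \<Sum>k\<in>{1..block_count s n} - {j}.
        \<bar>local_mean \<mu> \<sigma> Y s n j \<omega> - local_mean \<mu> \<sigma> Y s n k \<omega>\<bar>)
       / (real (block_count s n) * (real (block_count s n) - 1))"

text \<open>Integrability is required explicitly because the Bochner integral of a
  non-integrable function is \<open>0\<close>.\<close>

definition tendsto_L1 ::
  "'a measure \<Rightarrow> ('b \<Rightarrow> 'a \<Rightarrow> real) \<Rightarrow> ('a \<Rightarrow> real) \<Rightarrow> 'b filter \<Rightarrow> bool" where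
  "tendsto_L1 M Z Z' F \<longleftrightarrow>
     (\<forall>\<^sub>F n in F. integrable M (Z n)) \<and> integrable M Z' \<and>
     ((\<lambda>n. \<integral>\<omega>. \<bar>Z n \<omega> - Z' \<omega>\<bar> \<partial>M) \<longlongrightarrow> 0) F"

end

theory Submission
  imports Defs "HOL-Real_Asymp.Real_Asymp"
begin

text \<open>
  Write \<open>Z\<^sub>j\<close> for the weighted block sum over block \<open>j\<close> divided by the square root of the block
  length \<open>l\<close>; up to \<open>\<mu>\<close>, the scaled statistic is the mean of \<open>\<bar>Z\<^sub>j - Z\<^sub>k\<bar>\<close>.  Since \<open>\<bar>x\<bar>\<close> is a
  constant multiple of \<open>\<integral> (1 - cos (t x)) / t\<^sup>2 dt\<close>, this double mean equals, up to the same constant,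
  \<open>\<integral> (1 - \<bar>\<phi>\<^sub>b(t)\<bar>\<^sup>2) / t\<^sup>2 dt\<close> with \<open>\<phi>\<^sub>b\<close> the empirical characteristic function of
  \<open>Z\<^sub>1, \<dots>, Z\<^sub>b\<close>.  So it suffices to understand averages over single blocks: mixing makes their variance
  vanish, and the central limit theorem together with the continuity of \<open>\<sigma>\<close> off its jumps gives
  \<open>\<phi>\<^sub>b(t) \<rightarrow> \<integral> exp (- t\<^sup>2 \<kappa>\<^sup>2 \<sigma>(x)\<^sup>2 / 2) dx\<close>.  Dominated convergence in \<open>t\<close> yields
  convergence in \<open>L\<^sup>1\<close>, and the limit is identified by running the kernel representation backwards for
  Gaussian variables.  The central limit theorem is proved by truncation and Bernstein's big and
  small blocks.
\<close>

section \<open>Covariance of bounded variables\<close>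

text \<open>The kernel is chosen so that pairs of blocks disappear. A variance bound for the double
  sum itself would compare four blocks at a time, with unbounded terms. By the addition formula
  \<open>cos (t * (x - y))\<close> splits into products of single-block terms, so only covariances
  of bounded functions of two blocks occur, although adjacent blocks have no gap between them. The
  price is the factor 1 / t^2: boundedness suffices at infinity, but near 0 a second moment that is
  uniform over blocks is required. This estimate, \<open>sum_bound\<close>, is the technical core.
  It carries the root of the second moment of f, so that it serves both as a variance bound (f the
  identity) and as negligibility of truncated tails (f the remainder). That root comes from taking
  square roots of covariance bounds, which is why covariances have to decay faster than k^-2. The
  mixing exponent yields the decay k^-(rho (1 + delta) / delta), and (1 + delta) / delta is at least
  2 because delta is at most 1.\<close>

lemma (in prob_space) integrable_bounded:
  fixes f :: "'a \<Rightarrow> 'b::{banach, second_countable_topology}"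
  assumes "f \<in> borel_measurable M" "\<And>w. w \<in> space M \<Longrightarrow> norm (f w) \<le> B"
  shows "integrable M f"
  using assms by (intro integrable_const_bound[of _ B]) auto

lemma (in prob_space) expectation_bounded:
  assumes "f \<in> borel_measurable M" "\<And>w. w \<in> space M \<Longrightarrow> \<bar>f w\<bar> \<le> B"
  shows "\<bar>\<integral>w. f w \<partial>M\<bar> \<le> (B::real)"
proof -
  have i: "integrable M f" using integrable_bounded[of f B] assms by simp
  have "\<bar>\<integral>w. f w \<partial>M\<bar> \<le> (\<integral>w. \<bar>f w\<bar> \<partial>M)" by simp
  also have "\<dots> \<le> (\<integral>w. B \<partial>M)" using i assms(2) by (intro integral_mono) auto
  finally show ?thesis by (simp add: prob_space)
qed

text \<open>With \<open>W = \<E>[U | G]\<close>, the event \<open>{W \<ge> 0}\<close> lies in \<open>G\<close> and splits \<open>\<E>\<bar>W\<bar>\<close> into two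
  integrals of \<open>U\<close> over events of \<open>G\<close>.\<close>

lemma (in prob_space) integral_mult_le_from_events:
  fixes X U :: "'a \<Rightarrow> real"
  assumes sub: "subalgebra M G" and U: "integrable M U"
    and X [measurable]: "X \<in> borel_measurable G"
    and Xb: "\<And>w. w \<in> space M \<Longrightarrow> \<bar>X w\<bar> \<le> x"
    and ev: "\<And>B. B \<in> sets G \<Longrightarrow> \<bar>\<integral>w. indicator B w * U w \<partial>M\<bar> \<le> e"
  shows "\<bar>\<integral>w. X w * U w \<partial>M\<bar> \<le> 2 * x * e"
proof -
  interpret sigma_finite_subalgebra M G
    using sub finite_measure_axioms
    by (intro finite_measure_subalgebra_is_sigma_finite)
      (auto simp: finite_measure_subalgebra_def finite_measure_subalgebra_axioms_def)
  define W where "W = real_cond_exp M G U"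
  have [measurable]: "U \<in> borel_measurable M" using U by auto
  have [measurable]: "X \<in> borel_measurable M" by (rule measurable_from_subalg[OF sub X])
  have WG [measurable]: "W \<in> borel_measurable G" by (auto simp: W_def)
  have Wi: "integrable M W" unfolding W_def using U by (rule real_cond_exp_int)
  have spG: "space G = space M" using sub by (simp add: subalgebra_def)
  have x0: "0 \<le> x" using Xb not_empty by (meson abs_ge_zero ex_in_conv order_trans)
  define B where "B = {w\<in>space G. W w \<ge> 0}"
  have BG: "B \<in> sets G" and BcG: "space G - B \<in> sets G" unfolding B_def by measurable
  have BM: "B \<in> sets M" "space G - B \<in> sets M" using BG BcG sub by (auto simp: subalgebra_def)
  have intev: "(\<integral>w. indicator D w * W w \<partial>M) = (\<integral>w. indicator D w * U w \<partial>M)"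
    if "D \<in> sets G" for D
  proof -
    have "D \<in> sets M" using that sub by (auto simp: subalgebra_def)
    then have "integrable M (\<lambda>w. indicator D w * U w)"
      using U by (intro integrable_mult_indicator[where 'b=real, simplified]) auto
    then show ?thesis unfolding W_def using that by (intro real_cond_exp_intg) auto
  qed
  have iD: "integrable M (\<lambda>w. indicator D w * W w)" if "D \<in> sets M" for D
    using that Wi by (intro integrable_mult_indicator[where 'b=real, simplified]) auto
  have "(\<integral>w. \<bar>W w\<bar> \<partial>M) = (\<integral>w. indicator B w * W w - indicator (space G - B) w * W w \<partial>M)"
    by (intro Bochner_Integration.integral_cong)
      (auto simp: B_def spG indicator_def)
  also have "\<dots> = (\<integral>w. indicator B w * U w \<partial>M) - (\<integral>w. indicator (space G - B) w * U w \<partial>M)"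
    using iD BM intev[OF BG] intev[OF BcG] by (subst Bochner_Integration.integral_diff) auto
  also have "\<dots> \<le> 2 * e" using ev[OF BG] ev[OF BcG] by linarith
  finally have W1: "(\<integral>w. \<bar>W w\<bar> \<partial>M) \<le> 2 * e" .
  have XU: "integrable M (\<lambda>w. X w * U w)"
  proof (rule Bochner_Integration.integrable_bound)
    show "integrable M (\<lambda>w. x * U w)" using U by auto
    show "AE w in M. norm (X w * U w) \<le> norm (x * U w)"
      using Xb x0 by (auto simp: abs_mult intro!: AE_I2 mult_right_mono)
  qed simp
  have "(\<integral>w. X w * U w \<partial>M) = (\<integral>w. X w * W w \<partial>M)" and XW: "integrable M (\<lambda>w. X w * W w)"
    unfolding W_def using real_cond_exp_intg[OF XU X] by auto
  then have "\<bar>\<integral>w. X w * U w \<partial>M\<bar> \<le> (\<integral>w. \<bar>X w * W w\<bar> \<partial>M)" by simp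
  also have "\<dots> \<le> (\<integral>w. x * \<bar>W w\<bar> \<partial>M)"
    using XW Wi Xb by (intro integral_mono integrable_abs) (auto simp: abs_mult intro!: mult_right_mono)
  also have "\<dots> = x * (\<integral>w. \<bar>W w\<bar> \<partial>M)" by simp
  also have "\<dots> \<le> x * (2 * e)" using W1 x0 by (rule mult_left_mono)
  finally show ?thesis by simp
qed

text \<open>Two passes through \<open>integral_mult_le_from_events\<close>: the first replaces Z by
  events of G while an event A of F is held fixed, the second replaces X by such events A. Each pass
  costs a factor 2, hence the 4.\<close>

lemma (in prob_space) bounded_covariance_le:
  fixes X Z :: "'a \<Rightarrow> real"
  assumes F: "subalgebra M F" and G: "subalgebra M G"
    and X: "X \<in> borel_measurable F" and Xb: "\<And>w. w \<in> space M \<Longrightarrow> \<bar>X w\<bar> \<le> x"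
    and Z: "Z \<in> borel_measurable G" and Zb: "\<And>w. w \<in> space M \<Longrightarrow> \<bar>Z w\<bar> \<le> z"
    and ev: "\<And>A B. A \<in> sets F \<Longrightarrow> B \<in> sets G \<Longrightarrow> \<bar>prob A * prob B - prob (A \<inter> B)\<bar> \<le> a"
  shows "\<bar>(\<integral>w. X w * Z w \<partial>M) - (\<integral>w. X w \<partial>M) * (\<integral>w. Z w \<partial>M)\<bar> \<le> 4 * x * z * (a::real)"
proof -
  have [measurable]: "X \<in> borel_measurable M" by (rule measurable_from_subalg[OF F X])
  have [measurable]: "Z \<in> borel_measurable M" by (rule measurable_from_subalg[OF G Z])
  have x0: "0 \<le> x" using Xb not_empty by (meson abs_ge_zero ex_in_conv order_trans)
  have z0: "0 \<le> z" using Zb not_empty by (meson abs_ge_zero ex_in_conv order_trans)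
  have iX: "integrable M X" using integrable_bounded[of X x] Xb by simp
  have iZ: "integrable M Z" using integrable_bounded[of Z z] Zb by simp
  have iXZ: "integrable M (\<lambda>w. X w * Z w)"
    using Xb Zb x0 z0 by (intro integrable_bounded[of _ "x * z"]) (auto simp: abs_mult intro!: mult_mono)
  have Aev: "\<bar>\<integral>w. indicator A w * (Z w - expectation Z) \<partial>M\<bar> \<le> 2 * z * a" if A: "A \<in> sets F" for A
  proof -
    have AM [measurable]: "A \<in> sets M" using A F by (auto simp: subalgebra_def)
    have iA: "integrable M (indicator A :: 'a \<Rightarrow> real)"
      by (rule integrable_bounded[of _ 1]) (auto simp: indicator_def)
    have iAZ: "integrable M (\<lambda>w. indicator A w * Z w)"
      using AM iZ by (intro integrable_mult_indicator[where 'b=real, simplified]) auto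
    have "\<bar>\<integral>w. Z w * (indicator A w - prob A) \<partial>M\<bar> \<le> 2 * z * a"
    proof (rule integral_mult_le_from_events[OF G _ Z Zb])
      show "integrable M (\<lambda>w. indicator A w - prob A)" using iA by simp
      fix B assume B: "B \<in> sets G"
      then have BM [measurable]: "B \<in> sets M" using G by (auto simp: subalgebra_def)
      have "(\<integral>w. indicator B w * (indicator A w - prob A) \<partial>M)
          = (\<integral>w. indicator (A \<inter> B) w - prob A * indicator B w \<partial>M)"
        by (intro Bochner_Integration.integral_cong) (auto simp: indicator_def)
      also have "\<dots> = prob (A \<inter> B) - prob A * prob B"
        by (subst Bochner_Integration.integral_diff) (auto simp: less_top[symmetric])
      finally show "\<bar>\<integral>w. indicator B w * (indicator A w - prob A) \<partial>M\<bar> \<le> a"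
        using ev[OF A B] by linarith
    qed
    \<comment> \<open>Both forms are the covariance of Z and the indicator of A. The centering moves
      from the indicator to Z, because the second pass needs one fixed integrable variable for all
      A.\<close>
    also have "(\<integral>w. Z w * (indicator A w - prob A) \<partial>M)
        = (\<integral>w. indicator A w * Z w - prob A * Z w \<partial>M)"
      by (intro Bochner_Integration.integral_cong) (auto simp: algebra_simps)
    also have "\<dots> = (\<integral>w. indicator A w * Z w \<partial>M) - prob A * expectation Z"
      using iAZ iZ by (subst Bochner_Integration.integral_diff) auto
    also have "\<dots> = (\<integral>w. indicator A w * Z w - expectation Z * indicator A w \<partial>M)"
      using iAZ iA by (subst Bochner_Integration.integral_diff) (auto simp: less_top[symmetric])
    also have "\<dots> = (\<integral>w. indicator A w * (Z w - expectation Z) \<partial>M)"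
      by (intro Bochner_Integration.integral_cong) (auto simp: algebra_simps)
    finally show ?thesis .
  qed
  have "\<bar>\<integral>w. X w * (Z w - expectation Z) \<partial>M\<bar> \<le> 2 * x * (2 * z * a)"
    by (rule integral_mult_le_from_events[OF F _ X Xb Aev]) (use iZ in auto)
  also have "(\<integral>w. X w * (Z w - expectation Z) \<partial>M) = (\<integral>w. X w * Z w - expectation Z * X w \<partial>M)"
    by (intro Bochner_Integration.integral_cong) (auto simp: algebra_simps)
  also have "\<dots> = (\<integral>w. X w * Z w \<partial>M) - expectation X * expectation Z"
    using iXZ iX by (subst Bochner_Integration.integral_diff) auto
  finally show ?thesis by (simp add: algebra_simps)
qed

text \<open>The constant 16 comes from splitting both factors into real and imaginary parts.\<close>

lemma (in prob_space) complex_bounded_covariance_le: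
  fixes X Z :: "'a \<Rightarrow> complex"
  assumes F: "subalgebra M F" and G: "subalgebra M G"
    and X: "X \<in> borel_measurable F" and Xb: "\<And>w. w \<in> space M \<Longrightarrow> norm (X w) \<le> 1"
    and Z: "Z \<in> borel_measurable G" and Zb: "\<And>w. w \<in> space M \<Longrightarrow> norm (Z w) \<le> 1"
    and ev: "\<And>A B. A \<in> sets F \<Longrightarrow> B \<in> sets G \<Longrightarrow> \<bar>prob A * prob B - prob (A \<inter> B)\<bar> \<le> a"
  shows "norm ((\<integral>w. X w * Z w \<partial>M) - (\<integral>w. X w \<partial>M) * (\<integral>w. Z w \<partial>M)) \<le> 16 * a"
proof -
  have XM [measurable]: "X \<in> borel_measurable M" by (rule measurable_from_subalg[OF F X])
  have ZM [measurable]: "Z \<in> borel_measurable M" by (rule measurable_from_subalg[OF G Z])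
  have iX: "integrable M X" using integrable_bounded[of X 1] Xb by simp
  have iZ: "integrable M Z" using integrable_bounded[of Z 1] Zb by simp
  have [measurable]: "X \<in> borel_measurable F" "Z \<in> borel_measurable G" using X Z by auto
  have b: "\<bar>Re (X w)\<bar> \<le> 1" "\<bar>Im (X w)\<bar> \<le> 1" "\<bar>Re (Z w)\<bar> \<le> 1" "\<bar>Im (Z w)\<bar> \<le> 1"
    if "w \<in> space M" for w
    using Xb[OF that] Zb[OF that]
    by (meson abs_Re_le_cmod abs_Im_le_cmod order_trans)+
  have i: "integrable M (\<lambda>w. f (X w) * g (Z w))"
    if "f \<in> {Re, Im}" "g \<in> {Re, Im}" for f g
  proof (rule integrable_bounded[of _ "1 * 1"])
    show "(\<lambda>w. f (X w) * g (Z w)) \<in> borel_measurable M" using that by auto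
    fix w assume w: "w \<in> space M"
    have "\<bar>f (X w)\<bar> \<le> 1" "\<bar>g (Z w)\<bar> \<le> 1" using that b[OF w] by auto
    then show "norm (f (X w) * g (Z w)) \<le> 1 * 1"
      unfolding norm_mult real_norm_def abs_mult by (rule mult_mono) auto
  qed
  define c where "c f g = (\<integral>w. f (X w) * g (Z w) \<partial>M) - (\<integral>w. f (X w) \<partial>M) * (\<integral>w. g (Z w) \<partial>M)"
    for f g :: "complex \<Rightarrow> real"
  have cb: "\<bar>c f g\<bar> \<le> 4 * a" if "f \<in> {Re, Im}" "g \<in> {Re, Im}" for f g
  proof -
    have "\<bar>c f g\<bar> \<le> 4 * 1 * 1 * a" unfolding c_def
      by (rule bounded_covariance_le[OF F G _ _ _ _ ev]) (use that b in auto)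
    then show ?thesis by simp
  qed
  have iXZ: "integrable M (\<lambda>w. X w * Z w)"
    using Xb Zb by (intro integrable_bounded[of _ 1]) (auto simp: norm_mult intro!: mult_le_one)
  let ?D = "(\<integral>w. X w * Z w \<partial>M) - (\<integral>w. X w \<partial>M) * (\<integral>w. Z w \<partial>M)"
  have 1: "Re ?D = c Re Re - c Im Im"
    using iX iZ iXZ i by (simp add: c_def integral_Re[symmetric] integral_Im[symmetric] del: integral_Re integral_Im)
  have 2: "Im ?D = c Re Im + c Im Re"
    using iX iZ iXZ i by (simp add: c_def integral_Re[symmetric] integral_Im[symmetric] del: integral_Re integral_Im)
  have "norm ?D \<le> \<bar>Re ?D\<bar> + \<bar>Im ?D\<bar>" by (rule cmod_le)
  also have "\<dots> \<le> 16 * a"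
    unfolding 1 2 using cb[of Re Re] cb[of Re Im] cb[of Im Re] cb[of Im Im] by auto
  finally show ?thesis .
qed

section \<open>The cosine kernel\<close>

text \<open>At \<open>t = 0\<close> the quotient is 0 by the convention for division, which keeps
  nonnegativity and the pointwise bounds valid there.\<close>

definition cos_kernel :: "real \<Rightarrow> real \<Rightarrow> real" where
  "cos_kernel x t = (1 - cos (t * x)) / t^2"

text \<open>Numerically this is pi. It multiplies the empirical side and the limit side alike and is
  divided out, so positivity is what the argument relies on.\<close>

definition cos_const :: real where
  "cos_const = (\<integral>t. cos_kernel 1 t \<partial>lborel)"

lemma cos_kernel_measurable [measurable]:
  "(\<lambda>p. cos_kernel (f p) (g p)) \<in> borel_measurable N"
  if [measurable]: "f \<in> borel_measurable N" "g \<in> borel_measurable N"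
  unfolding cos_kernel_def by measurable

lemma one_minus_cos_le: "1 - cos x \<le> (x::real)^2 / 2"
proof -
  have "1 - cos x = 2 * (sin (x/2))^2"
    using cos_double_sin[of "x/2"] by simp
  also have "(sin (x/2))^2 \<le> (x/2)^2" 
    using abs_sin_x_le_abs_x power_mono abs_ge_zero by (metis power2_abs)
  finally show ?thesis by (simp add: power2_eq_square)
qed

lemma integrable_inverse_one_plus_square: "integrable lborel (\<lambda>t::real. A / (1 + t^2))"
proof -
  have "integrable lborel (\<lambda>t::real. inverse (1 + t^2))"
    using integrable_inverse_1_plus_square by (simp add: set_integrable_def einterval_def)
  then have "integrable lborel (\<lambda>t::real. A * inverse (1 + t^2))" by (rule integrable_mult_right)
  then show ?thesis by (simp add: divide_inverse)
qed

text \<open>One majorant for both ranges: the quadratic bound controls the quotient near 0, the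
  constant bound at infinity, and \<open>g + g * t^2\<close> adds the two.\<close>

lemma kernel_dominated:
  fixes g v B :: real
  assumes "0 \<le> g" "g \<le> B" "g \<le> v * t^2" "0 \<le> v"
  shows "g / t^2 \<le> (v + B) / (1 + t^2)"
proof (cases "t = 0")
  case True then show ?thesis using assms by simp
next
  case False
  then have t: "0 < t^2" by simp
  have "g * (1 + t^2) = g + g * t^2" by (simp add: algebra_simps)
  also have "\<dots> \<le> v * t^2 + B * t^2" using assms t by (intro add_mono mult_right_mono) auto
  finally have "g * (1 + t^2) \<le> (v + B) * t^2" by (simp add: algebra_simps)
  then show ?thesis using t
    by (simp add: divide_simps add_pos_pos)
qed

lemma cos_kernel_nonneg: "0 \<le> cos_kernel x t"
  by (simp add: cos_kernel_def)

lemma cos_kernel_bound: "cos_kernel x t \<le> (x^2 / 2 + 2) / (1 + t^2)"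
  unfolding cos_kernel_def
proof (rule kernel_dominated)
  show "1 - cos (t * x) \<le> 2" using cos_ge_minus_one[of "t * x"] by linarith
  show "1 - cos (t * x) \<le> x^2 / 2 * t^2"
    using one_minus_cos_le[of "t * x"] by (simp add: power_mult_distrib mult.commute)
qed auto

lemma cos_kernel_integrable: "integrable lborel (cos_kernel x)"
  by (rule Bochner_Integration.integrable_bound[OF integrable_inverse_one_plus_square[of "x^2 / 2 + 2"]])
    (auto intro!: AE_I2 simp: cos_kernel_nonneg abs_of_nonneg cos_kernel_bound)

text \<open>Substituting \<open>x * t\<close> for t in \<open>cos_const\<close> gives the Jacobian
  \<open>\<bar>x\<bar>\<close> against a factor 1 / x^2 from the denominator of the kernel.\<close>

lemma integral_cos_kernel: "(\<integral>t. cos_kernel x t \<partial>lborel) = \<bar>x\<bar> * cos_const"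
proof (cases "x = 0")
  case True then show ?thesis by (simp add: cos_kernel_def)
next
  case False
  have "cos_const = \<bar>x\<bar> * (\<integral>t. cos_kernel 1 (0 + x * t) \<partial>lborel)"
    unfolding cos_const_def using lborel_integral_real_affine[OF False, of "cos_kernel 1" 0] by simp
  also have "(\<lambda>t. cos_kernel 1 (0 + x * t)) = (\<lambda>t. cos_kernel x t / x^2)"
    by (auto simp: cos_kernel_def power_mult_distrib mult.commute)
  also have "\<bar>x\<bar> * (\<integral>t. cos_kernel x t / x^2 \<partial>lborel) = (\<integral>t. cos_kernel x t \<partial>lborel) / \<bar>x\<bar>"
    using False by (simp add: power2_eq_square abs_if field_simps)
  finally show ?thesis using False by (simp add: field_simps)
qed

lemma cos_const_pos: "0 < cos_const"
proof -
  have nn: "0 \<le> cos_const" unfolding cos_const_def by (simp add: cos_kernel_nonneg)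
  have "cos_const \<noteq> 0"
  proof
    assume "cos_const = 0"
    then have "AE t in lborel. cos_kernel 1 t = 0"
      unfolding cos_const_def
      using integral_nonneg_eq_0_iff_AE[OF cos_kernel_integrable[of 1]] cos_kernel_nonneg by auto
    then have "AE t in lborel. t \<notin> {0<..<1::real}"
    proof eventually_elim
      case (elim t)
      show ?case
      proof
        assume t: "t \<in> {0<..<1}"
        then have "cos t < cos 0" using pi_gt3 by (intro cos_monotone_0_pi) auto
        then show False using elim t by (simp add: cos_kernel_def)
      qed
    qed
    then have "{0<..<1::real} \<in> null_sets lborel"
      by (subst AE_iff_null_sets) auto
    then show False by (simp add: null_sets_def)
  qed
  then show ?thesis using nn by simp
qed

text \<open>The representation of the absolute value is averaged over a centered normal of variance
  v and the integrals are exchanged. Integrating over x first gives the normal characteristic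
  function, over t first the absolute first moment; \<open>sqrt (2 / pi)\<close> is that moment for
  the standard normal.\<close>

lemma integral_gaussian_kernel:
  assumes "0 \<le> v"
  shows "integrable lborel (\<lambda>t. (1 - exp (- (v * t^2 / 2))) / t^2)"
    and "(\<integral>t. (1 - exp (- (v * t^2 / 2))) / t^2 \<partial>lborel) = cos_const * sqrt (2 / pi) * sqrt v"
proof -
  let ?N = std_normal_distribution
  interpret N: prob_space ?N by (rule prob_space_normal_density) simp
  interpret pair_sigma_finite ?N "lborel :: real measure" ..
  have N1: "measure ?N UNIV = 1" using N.prob_space by simp
  define w where "w = sqrt v"
  have w2: "w^2 = v" "0 \<le> w" using assms by (auto simp: w_def)
  have iabs: "integrable ?N (\<lambda>x. \<bar>x\<bar>)" "(\<integral>x. \<bar>x\<bar> \<partial>?N) = sqrt (2 / pi)"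
    using std_normal_moment_abs_odd[of 0]
    by (auto simp: integrable_density integral_density std_normal_density_def has_bochner_integral_iff)
  have fub: "integrable (?N \<Otimes>\<^sub>M lborel) (\<lambda>(x, t). cos_kernel (w * x) t)"
  proof (rule Fubini_integrable)
    have "(\<lambda>x. \<integral>t. norm (case (x, t) of (x, t) \<Rightarrow> cos_kernel (w * x) t) \<partial>lborel) = (\<lambda>x. w * cos_const * \<bar>x\<bar>)"
      using integral_cos_kernel w2 by (auto simp: cos_kernel_nonneg abs_mult)
    then show "integrable ?N (\<lambda>x. \<integral>t. norm (case (x, t) of (x, t) \<Rightarrow> cos_kernel (w * x) t) \<partial>lborel)"
      using iabs by simp
    show "AE x in ?N. integrable lborel (\<lambda>t. case (x, t) of (x, t) \<Rightarrow> cos_kernel (w * x) t)"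
      by (simp add: cos_kernel_integrable)
  qed simp
  have icos: "(\<integral>x. cos (a * x) \<partial>?N) = exp (- (a^2 / 2))" for a
  proof -
    have "integrable ?N (\<lambda>x. iexp (a * x))"
      by (rule N.integrable_const_bound[of _ 1]) auto
    then have "(\<integral>x. cos (a * x) \<partial>?N) = Re (char ?N a)"
      unfolding char_def by (simp flip: integral_Re add: Re_exp)
    then show ?thesis by (simp add: char_std_normal_distribution)
  qed
  have inner: "(\<integral>x. cos_kernel (w * x) t \<partial>?N) = (1 - exp (- (v * t^2 / 2))) / t^2" for t
  proof -
    have i: "integrable ?N (\<lambda>x. cos ((t * w) * x))"
      by (rule N.integrable_const_bound[of _ 1]) auto
    have "(\<integral>x. cos_kernel (w * x) t \<partial>?N) = (\<integral>x. 1 - cos ((t * w) * x) \<partial>?N) / t^2"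
      unfolding cos_kernel_def by (simp add: mult.assoc)
    also have "\<dots> = (1 - exp (- ((t * w)^2 / 2))) / t^2"
      using i by (subst Bochner_Integration.integral_diff) (auto simp: icos N1)
    finally show ?thesis by (simp add: power_mult_distrib w2 mult.commute)
  qed
  have "integrable lborel (\<lambda>t. \<integral>x. cos_kernel (w * x) t \<partial>?N)"
    using integrable_snd[OF fub] by simp
  then show "integrable lborel (\<lambda>t. (1 - exp (- (v * t^2 / 2))) / t^2)" by (simp add: inner)
  have "(\<integral>t. (\<integral>x. cos_kernel (w * x) t \<partial>?N) \<partial>lborel) = (\<integral>x. (\<integral>t. cos_kernel (w * x) t \<partial>lborel) \<partial>?N)"
    using Fubini_integral[OF fub] by simp
  also have "\<dots> = w * cos_const * sqrt (2 / pi)"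
    using w2 iabs by (simp add: integral_cos_kernel abs_mult)
  finally show "(\<integral>t. (1 - exp (- (v * t^2 / 2))) / t^2 \<partial>lborel) = cos_const * sqrt (2 / pi) * sqrt v"
    unfolding inner by (simp add: w_def mult_ac)
qed

section \<open>Functions on the unit interval\<close>

definition unit_lborel :: "real measure" where
  "unit_lborel = restrict_space lborel {0..1}"

lemma space_unit_lborel [simp]: "space unit_lborel = {0..1}"
  by (simp add: unit_lborel_def space_restrict_space)

lemma prob_space_unit_lborel: "prob_space unit_lborel"
  by (rule prob_spaceI) (simp add: unit_lborel_def emeasure_restrict_space space_restrict_space)

lemma integral_unit_lborel:
  fixes f :: "real \<Rightarrow> 'b::{banach, second_countable_topology}"
  shows "(\<integral>x. f x \<partial>unit_lborel) = (\<integral>x. indicator {0..1} x *\<^sub>R f x \<partial>lborel)"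
  unfolding unit_lborel_def by (subst integral_restrict_space) auto

lemma measurable_unit_lborel: "f \<in> borel_measurable borel \<Longrightarrow> f \<in> borel_measurable unit_lborel"
  unfolding unit_lborel_def by (intro measurable_restrict_space1) simp

lemma AE_unit_lborel_finite: "finite D \<Longrightarrow> AE x in unit_lborel. x \<notin> D"
proof -
  assume "finite D"
  then have "D \<in> null_sets lborel" by (rule finite_imp_null_set_lborel)
  then have "AE x in lborel. x \<notin> D" by (rule AE_not_in)
  then show ?thesis unfolding unit_lborel_def by (subst AE_restrict_space_iff) auto
qed

text \<open>Turns an average over blocks into an integral over the unit interval, so that a limit
  with a growing number of blocks becomes dominated convergence in x. The ceiling assigns the
  interval between (j - 1) / b and j / b, closed on the right, to block j.\<close>

lemma step_integral:
  fixes g :: "nat \<Rightarrow> 'b::{banach, second_countable_topology}"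
  assumes b: "1 \<le> b"
  shows "(\<lambda>x. g (nat \<lceil>real b * x\<rceil>)) \<in> borel_measurable borel"
    and "(\<integral>x. g (nat \<lceil>real b * x\<rceil>) \<partial>unit_lborel) = (1 / real b) *\<^sub>R (\<Sum>j\<in>{1..b}. g j)"
proof -
  have "(\<lambda>x::real. \<lceil>real b * x\<rceil>) \<in> measurable borel (count_space UNIV)" by measurable
  from measurable_compose[OF this, of "\<lambda>i. g (nat i)" borel]
  show m: "(\<lambda>x. g (nat \<lceil>real b * x\<rceil>)) \<in> borel_measurable borel" by simp
  define I where "I j = {(real j - 1) / real b<..real j / real b}" for j :: nat
  \<comment> \<open>At \<open>x = 0\<close> the ceiling yields index 0, which belongs to no block;
    this null point is excluded.\<close>
  have eq: "indicator {0..1} x *\<^sub>R g (nat \<lceil>real b * x\<rceil>) = (\<Sum>j\<in>{1..b}. indicator (I j) x *\<^sub>R g j)"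
    if "x \<noteq> 0" for x :: real
  proof -
    have iff: "x \<in> I j \<longleftrightarrow> 0 < x \<and> x \<le> 1 \<and> j = nat \<lceil>real b * x\<rceil>" if j: "j \<in> {1..b}" for j
    proof -
      have "x \<in> I j \<longleftrightarrow> real j - 1 < real b * x \<and> real b * x \<le> real j"
        using b by (auto simp: I_def field_simps)
      also have "\<dots> \<longleftrightarrow> \<lceil>real b * x\<rceil> = int j" by (simp add: ceiling_eq_iff)
      also have "\<dots> \<longleftrightarrow> 0 < x \<and> x \<le> 1 \<and> j = nat \<lceil>real b * x\<rceil>"
      proof
        assume c: "\<lceil>real b * x\<rceil> = int j"
        then have "real j - 1 < real b * x" "real b * x \<le> real j" by (simp_all add: ceiling_eq_iff)
        moreover have "1 \<le> real j" "real j \<le> real b" using j by auto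
        ultimately have "0 < real b * x" "real b * x \<le> real b * 1" by linarith+
        then show "0 < x \<and> x \<le> 1 \<and> j = nat \<lceil>real b * x\<rceil>"
          using b c by (simp add: zero_less_mult_iff)
      next
        assume a: "0 < x \<and> x \<le> 1 \<and> j = nat \<lceil>real b * x\<rceil>"
        then have "0 \<le> real b * x" by simp
        then have "-1 < real b * x" by linarith
        then have "0 \<le> \<lceil>real b * x\<rceil>" by simp
        with a show "\<lceil>real b * x\<rceil> = int j" by simp
      qed
      finally show ?thesis .
    qed
    show ?thesis
    proof (cases "0 < x \<and> x \<le> 1")
      case True
      then have "0 < real b * x" "real b * x \<le> real b" using b by (auto simp: mult_left_le)
      then have "nat \<lceil>real b * x\<rceil> \<in> {1..b}" by (simp add: ceiling_le_iff) linarith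
      moreover have "(\<Sum>j\<in>{1..b}. indicator (I j) x *\<^sub>R g j)
          = (\<Sum>j\<in>{1..b}. if j = nat \<lceil>real b * x\<rceil> then g j else 0)"
        using iff True by (intro sum.cong) (auto simp: indicator_def)
      ultimately show ?thesis using True by (simp add: sum.delta)
    next
      case False
      then have "(\<Sum>j\<in>{1..b}. indicator (I j) x *\<^sub>R g j) = 0"
        using iff by (intro sum.neutral) (auto simp: indicator_def)
      then show ?thesis using False that by (auto simp: indicator_def)
    qed
  qed
  have "(\<integral>x. g (nat \<lceil>real b * x\<rceil>) \<partial>unit_lborel) = (\<integral>x. indicator {0..1} x *\<^sub>R g (nat \<lceil>real b * x\<rceil>) \<partial>lborel)"
    by (rule integral_unit_lborel)
  also have "\<dots> = (\<integral>x. (\<Sum>j\<in>{1..b}. indicator (I j) x *\<^sub>R g j) \<partial>lborel)"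
  proof (rule integral_cong_AE)
    show "(\<lambda>x. indicator {0..1} x *\<^sub>R g (nat \<lceil>real b * x\<rceil>)) \<in> borel_measurable lborel"
      using m by measurable
    show "(\<lambda>x. \<Sum>j\<in>{1..b}. indicator (I j) x *\<^sub>R g j) \<in> borel_measurable lborel"
      unfolding I_def by measurable
    show "AE x in lborel. indicator {0..1} x *\<^sub>R g (nat \<lceil>real b * x\<rceil>) = (\<Sum>j\<in>{1..b}. indicator (I j) x *\<^sub>R g j)"
      using AE_lborel_singleton[of "0::real"] by eventually_elim (rule eq)
  qed
  also have "\<dots> = (\<Sum>j\<in>{1..b}. (\<integral>x. indicator (I j) x *\<^sub>R g j \<partial>lborel))"
    unfolding I_def by (intro Bochner_Integration.integral_sum integrable_scaleR_left)
      (auto simp: divide_right_mono)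
  also have "\<dots> = (\<Sum>j\<in>{1..b}. (1 / real b) *\<^sub>R g j)"
    unfolding I_def using b
    by (intro sum.cong refl) (simp add: divide_right_mono diff_divide_distrib)
  finally show "(\<integral>x. g (nat \<lceil>real b * x\<rceil>) \<partial>unit_lborel) = (1 / real b) *\<^sub>R (\<Sum>j\<in>{1..b}. g j)"
    by (simp add: scaleR_sum_right)
qed

text \<open>Characteristic function of a mixture of centered normals whose variance is
  \<open>\<kappa> * (\<sigma> x)^2\<close> at a uniform point x; it is real by symmetry. Here
  \<open>\<kappa>\<close> is a variance, not a standard deviation.\<close>

definition mixture_char :: "(real \<Rightarrow> real) \<Rightarrow> real \<Rightarrow> real \<Rightarrow> real" where
  "mixture_char \<sigma> \<kappa> t = (\<integral>x. exp (- (t^2 / 2 * (\<kappa> * (\<sigma> x)^2))) \<partial>unit_lborel)"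

context
  fixes \<sigma> :: "real \<Rightarrow> real" and \<kappa> S :: real
  assumes meas [measurable]: "\<sigma> \<in> borel_measurable unit_lborel"
    and \<kappa>: "0 \<le> \<kappa>" and bnd: "\<And>x. x \<in> {0..1} \<Longrightarrow> \<bar>\<sigma> x\<bar> \<le> S"
begin

interpretation U: prob_space unit_lborel by (rule prob_space_unit_lborel)

lemma exp_kernel_integrable: "integrable unit_lborel (\<lambda>x. exp (- (t^2 / 2 * (\<kappa> * (\<sigma> x)^2))))"
  using \<kappa> by (intro U.integrable_const_bound[of _ 1]) auto

lemma mixture_char_measurable: "mixture_char \<sigma> \<kappa> \<in> borel_measurable borel"
proof -
  have "(\<lambda>t. \<integral>x. exp (- (t^2 / 2 * (\<kappa> * (\<sigma> x)^2))) \<partial>unit_lborel) \<in> borel_measurable borel"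
    by (rule U.borel_measurable_lebesgue_integral) measurable
  then show ?thesis by (simp add: mixture_char_def[abs_def])
qed

text \<open>The last bound keeps the quotient by t^2 bounded near 0. It combines
  \<open>1 - m^2 \<le> 2 * (1 - m)\<close> for m in [0, 1] with
  \<open>1 - exp (- x) \<le> x\<close>; the 2 cancels the one half in the exponent.\<close>

lemma mixture_char_bounds:
  "0 \<le> mixture_char \<sigma> \<kappa> t" "mixture_char \<sigma> \<kappa> t \<le> 1" "1 - (mixture_char \<sigma> \<kappa> t)^2 \<le> \<kappa> * S^2 * t^2"
proof -
  show 0: "0 \<le> mixture_char \<sigma> \<kappa> t" by (simp add: mixture_char_def)
  have "mixture_char \<sigma> \<kappa> t \<le> (\<integral>x. 1 \<partial>unit_lborel)"
    unfolding mixture_char_def using \<kappa> by (intro integral_mono exp_kernel_integrable) auto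
  then show 1: "mixture_char \<sigma> \<kappa> t \<le> 1" using U.prob_space by simp
  have "(\<integral>x. 1 - t^2 / 2 * (\<kappa> * S^2) \<partial>unit_lborel) \<le> mixture_char \<sigma> \<kappa> t"
    unfolding mixture_char_def
  proof (intro integral_mono exp_kernel_integrable)
    fix x assume "x \<in> space unit_lborel"
    then have "(\<sigma> x)^2 \<le> S^2" using bnd[of x] by (simp add: abs_le_square_iff[symmetric])
    then have "t^2 / 2 * (\<kappa> * (\<sigma> x)^2) \<le> t^2 / 2 * (\<kappa> * S^2)" using \<kappa> by (intro mult_left_mono) auto
    then show "1 - t^2 / 2 * (\<kappa> * S^2) \<le> exp (- (t^2 / 2 * (\<kappa> * (\<sigma> x)^2)))"
      using exp_ge_add_one_self[of "- (t^2 / 2 * (\<kappa> * (\<sigma> x)^2))"] by linarith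
  qed simp
  then have 2: "1 - mixture_char \<sigma> \<kappa> t \<le> t^2 / 2 * (\<kappa> * S^2)" using U.prob_space by simp
  have "1 - (mixture_char \<sigma> \<kappa> t)^2 = (1 - mixture_char \<sigma> \<kappa> t) * (1 + mixture_char \<sigma> \<kappa> t)"
    by (simp add: power2_eq_square algebra_simps)
  also have "\<dots> \<le> (1 - mixture_char \<sigma> \<kappa> t) * 2" using 0 1 by (intro mult_left_mono) auto
  finally show "1 - (mixture_char \<sigma> \<kappa> t)^2 \<le> \<kappa> * S^2 * t^2" using 2 by (simp add: mult_ac)
qed

text \<open>Squaring the mixture amounts to drawing two independent uniform points, and the
  variances at these points add. For each pair the Gaussian kernel integral returns the root of the
  sum; this is the origin of the double integral.\<close>

lemma mixture_kernel_integral: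
  "integrable lborel (\<lambda>t. (1 - (mixture_char \<sigma> \<kappa> t)^2) / t^2)"
  "(\<integral>t. (1 - (mixture_char \<sigma> \<kappa> t)^2) / t^2 \<partial>lborel)
    = cos_const * sqrt (2 / pi) * sqrt \<kappa> * (LBINT y:{0..1}. (LBINT x:{0..1}. sqrt ((\<sigma> x)^2 + (\<sigma> y)^2)))"
proof -
  let ?Q = "unit_lborel \<Otimes>\<^sub>M unit_lborel"
  interpret UU: pair_prob_space unit_lborel unit_lborel ..
  interpret QL: pair_sigma_finite ?Q "lborel :: real measure" ..
  define w where "w p = \<kappa> * ((\<sigma> (fst p))^2 + (\<sigma> (snd p))^2)" for p
  have w [measurable]: "w \<in> borel_measurable ?Q" unfolding w_def by measurable
  have w0: "0 \<le> w p" for p using \<kappa> by (simp add: w_def)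
  have S0: "0 \<le> S" using bnd[of 0] by simp
  have ws: "\<bar>sqrt (w p)\<bar> \<le> sqrt (\<kappa> * (S^2 + S^2))" if "p \<in> space ?Q" for p
  proof -
    have "(\<sigma> x)^2 \<le> S^2" if "x \<in> {0..1}" for x
      using bnd[OF that] S0 by (simp add: abs_le_square_iff[symmetric])
    then have "w p \<le> \<kappa> * (S^2 + S^2)" using that \<kappa> unfolding w_def
      by (intro mult_left_mono add_mono) (auto simp: space_pair_measure)
    then show ?thesis using w0 by simp
  qed
  have iw: "integrable ?Q (\<lambda>p. sqrt (w p))"
    by (rule UU.P.integrable_const_bound[of _ "sqrt (\<kappa> * (S^2 + S^2))"]) (use ws in auto)
  define F where "F p t = (1 - exp (- (w p * t^2 / 2))) / t^2" for p t :: "_"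
  have F0: "0 \<le> F p t" for p t using w0 by (simp add: F_def)
  note gk = integral_gaussian_kernel[OF w0, folded F_def]
  have fub: "integrable (?Q \<Otimes>\<^sub>M lborel) (\<lambda>(p, t). F p t)"
  proof (rule QL.Fubini_integrable)
    show "(\<lambda>(p, t). F p t) \<in> borel_measurable (?Q \<Otimes>\<^sub>M lborel)" unfolding F_def by measurable
    show "integrable ?Q (\<lambda>p. \<integral>t. norm (case (p, t) of (p, t) \<Rightarrow> F p t) \<partial>lborel)"
      using F0 gk iw by (simp add: abs_of_nonneg)
    show "AE p in ?Q. integrable lborel (\<lambda>t. case (p, t) of (p, t) \<Rightarrow> F p t)" using gk by simp
  qed
  have inner: "(\<integral>p. F p t \<partial>?Q) = (1 - (mixture_char \<sigma> \<kappa> t)^2) / t^2" for t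
  proof -
    let ?f = "\<lambda>x. exp (- (t^2 / 2 * (\<kappa> * (\<sigma> x)^2)))"
    have i: "integrable ?Q (\<lambda>(x, y). ?f x * ?f y)"
      by (rule UU.P.integrable_const_bound[of _ 1]) (use \<kappa> in \<open>auto intro!: AE_I2 mult_le_one\<close>)
    have "(\<integral>p. (case p of (x, y) \<Rightarrow> ?f x * ?f y) \<partial>?Q) = (\<integral>x. (\<integral>y. ?f x * ?f y \<partial>unit_lborel) \<partial>unit_lborel)"
      using UU.integral_fst'[OF i] by simp
    also have "\<dots> = (mixture_char \<sigma> \<kappa> t)^2" by (simp add: mixture_char_def power2_eq_square)
    finally have e: "(\<integral>p. (case p of (x, y) \<Rightarrow> ?f x * ?f y) \<partial>?Q) = (mixture_char \<sigma> \<kappa> t)^2" .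
    have "(\<integral>p. F p t \<partial>?Q) = (\<integral>p. 1 - (case p of (x, y) \<Rightarrow> ?f x * ?f y) \<partial>?Q) / t^2"
      unfolding integral_divide_zero[symmetric]
      by (intro Bochner_Integration.integral_cong refl)
        (auto simp: F_def w_def exp_add[symmetric] algebra_simps add_divide_distrib)
    also have "\<dots> = (1 - (mixture_char \<sigma> \<kappa> t)^2) / t^2"
      using i e UU.P.prob_space by (subst Bochner_Integration.integral_diff) auto
    finally show ?thesis .
  qed
  show "integrable lborel (\<lambda>t. (1 - (mixture_char \<sigma> \<kappa> t)^2) / t^2)"
    using QL.integrable_snd[OF fub] by (simp add: inner)
  have "(\<integral>t. (1 - (mixture_char \<sigma> \<kappa> t)^2) / t^2 \<partial>lborel) = (\<integral>p. (\<integral>t. F p t \<partial>lborel) \<partial>?Q)"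
    using QL.Fubini_integral[OF fub] by (simp add: inner)
  also have "\<dots> = cos_const * sqrt (2 / pi) * (\<integral>p. sqrt (w p) \<partial>?Q)" by (simp add: gk)
  also have "(\<integral>p. sqrt (w p) \<partial>?Q) = (\<integral>y. (\<integral>x. sqrt (w (x, y)) \<partial>unit_lborel) \<partial>unit_lborel)"
    using UU.integral_snd[of "\<lambda>x y. sqrt (w (x, y))"] iw by (simp add: split_beta')
  also have "\<dots> = sqrt \<kappa> * (LBINT y:{0..1}. (LBINT x:{0..1}. sqrt ((\<sigma> x)^2 + (\<sigma> y)^2)))"
    by (simp add: w_def real_sqrt_mult set_lebesgue_integral_def integral_unit_lborel)
  finally show "(\<integral>t. (1 - (mixture_char \<sigma> \<kappa> t)^2) / t^2 \<partial>lborel)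
    = cos_const * sqrt (2 / pi) * sqrt \<kappa> * (LBINT y:{0..1}. (LBINT x:{0..1}. sqrt ((\<sigma> x)^2 + (\<sigma> y)^2)))"
    by (simp add: mult.assoc)
qed

end

section \<open>Regularity of the scale and of the trend\<close>

lemma piecewise_constant01_regular:
  assumes "piecewise_constant01 h"
  obtains D B where "finite D" "\<And>x. x \<in> {0..1} \<Longrightarrow> \<bar>h x\<bar> \<le> B"
    "\<And>x. x \<in> {0<..<1} - D \<Longrightarrow> isCont h x"
proof -
  obtain D where D: "finite D" and c: "\<And>x y. x \<in> {0..1} \<Longrightarrow> y \<in> {0..1} \<Longrightarrow> x \<le> y \<Longrightarrow> {x..y} \<inter> D = {} \<Longrightarrow> h x = h y"
    using assms by (auto simp: piecewise_constant01_def)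
  \<comment> \<open>Off D the set of jumps to the left of x determines the value at x, since two
    points with the same such set have no jump between them. So besides the values on D there are at
    most as many values as subsets of D.\<close>
  have fin: "finite (h ` {0..1})"
  proof -
    have "h ` {0..1} \<subseteq> h ` D \<union> (\<lambda>A. h (SOME x. x \<in> {0..1} \<and> x \<notin> D \<and> {d\<in>D. d < x} = A)) ` Pow D"
    proof
      fix v assume "v \<in> h ` {0..1}"
      then obtain x where x: "x \<in> {0..1}" "v = h x" by auto
      show "v \<in> h ` D \<union> (\<lambda>A. h (SOME x. x \<in> {0..1} \<and> x \<notin> D \<and> {d\<in>D. d < x} = A)) ` Pow D"
      proof (cases "x \<in> D")
        case False
        define A where "A = {d\<in>D. d < x}"
        define y where "y = (SOME x. x \<in> {0..1} \<and> x \<notin> D \<and> {d\<in>D. d < x} = A)"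
        have y: "y \<in> {0..1} \<and> y \<notin> D \<and> {d\<in>D. d < y} = A"
          unfolding y_def by (rule someI[of _ x]) (use x False in \<open>auto simp: A_def\<close>)
        have n: "{min x y..max x y} \<inter> D = {}"
        proof (rule ccontr)
          assume "{min x y..max x y} \<inter> D \<noteq> {}"
          then obtain d where d: "d \<in> D" "min x y \<le> d" "d \<le> max x y" by auto
          then have "d \<noteq> x" "d \<noteq> y" using False y by auto
          then have "(d < x) \<noteq> (d < y)" using d by (auto simp: min_def max_def split: if_splits)
          moreover have "(d < x) = (d < y)" using y d by (auto simp: A_def)
          ultimately show False by simp
        qed
        have "h (min x y) = h (max x y)" by (rule c) (use x y n in \<open>auto simp: min_def max_def\<close>)
        then have "h x = h y" by (auto simp: min_def max_def split: if_splits)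
        then show ?thesis using x by (auto simp: y_def A_def)
      qed (use x in auto)
    qed
    then show ?thesis by (rule finite_subset) (use D in auto)
  qed
  show ?thesis
  proof (rule that[OF D])
    show "\<bar>h x\<bar> \<le> Max (insert 0 (abs ` h ` {0..1}))" if "x \<in> {0..1}" for x
      using fin that by (intro Max_ge) auto
    fix x assume x: "x \<in> {0<..<1} - D"
    have "open ({0<..<1} - D)" using D by (intro open_Diff finite_imp_closed) auto
    then have "\<exists>e>0. \<forall>y. dist y x < e \<longrightarrow> y \<in> {0<..<1} - D"
      using x unfolding open_dist by blast
    then obtain e where e: "0 < e" "\<And>y. dist y x < e \<Longrightarrow> y \<in> {0<..<1} - D" by blast
    have "h y = h x" if "dist y x < e" for y
    proof -
      have n: "z \<notin> D" if "min x y \<le> z" "z \<le> max x y" for z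
      proof -
        have "dist z x \<le> dist y x" using that by (auto simp: dist_real_def min_def max_def split: if_splits)
        then show ?thesis using e(2)[of z] \<open>dist y x < e\<close> by auto
      qed
      have "h (min x y) = h (max x y)"
        by (rule c) (use x e(2)[OF that] n in \<open>auto simp: min_def max_def\<close>)
      then show ?thesis by (auto simp: min_def max_def split: if_splits)
    qed
    then have "\<forall>\<^sub>F y in nhds x. h y = h x"
      unfolding eventually_nhds_metric using e(1) by blast
    then show "isCont h x" using isCont_cong[of h "\<lambda>_. h x" x] by simp
  qed
qed

lemma piecewise_lipschitz01_regular:
  assumes "piecewise_lipschitz01 f"
  obtains D B where "finite D" "\<And>x. x \<in> {0..1} \<Longrightarrow> \<bar>f x\<bar> \<le> B"
    "\<And>x. x \<in> {0<..<1} - D \<Longrightarrow> isCont f x"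
proof -
  obtain g h L where L: "L-lipschitz_on {0..1} g" and h: "piecewise_constant01 h"
    and f: "\<And>x. x \<in> {0..1} \<Longrightarrow> f x = g x + h x"
    using assms by (auto simp: piecewise_lipschitz01_def)
  obtain D B where D: "finite D" "\<And>x. x \<in> {0..1} \<Longrightarrow> \<bar>h x\<bar> \<le> B"
    "\<And>x. x \<in> {0<..<1} - D \<Longrightarrow> isCont h x"
    using piecewise_constant01_regular[OF h] by blast
  have gc: "continuous_on {0..1} g" using L by (rule lipschitz_on_continuous_on)
  show ?thesis
  proof (rule that[OF D(1)])
    show "\<bar>f x\<bar> \<le> \<bar>g 0\<bar> + L + B" if "x \<in> {0..1}" for x
    proof -
      have "\<bar>g x - g 0\<bar> \<le> L * \<bar>x - 0\<bar>" using lipschitz_onD[OF L that, of 0] by (simp add: dist_real_def)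
      also have "\<dots> \<le> L * 1" using that lipschitz_on_nonneg[OF L] by (intro mult_left_mono) auto
      finally show ?thesis using D(2)[OF that] f[OF that] by linarith
    qed
    fix x assume x: "x \<in> {0<..<1} - D"
    have "isCont g x" using continuous_on_interior[OF gc] x by (simp add: interior_atLeastAtMost_real)
    then have "isCont (\<lambda>y. g y + h y) x" using D(3)[OF x] by (intro continuous_intros)
    moreover have "\<forall>\<^sub>F y in nhds x. g y + h y = f y"
    proof -
      have "\<forall>\<^sub>F y in nhds x. y \<in> {0<..<1::real}" using x by (intro eventually_nhds_in_open) auto
      then show ?thesis by eventually_elim (use f in auto)
    qed
    ultimately show "isCont f x" using isCont_cong[of "\<lambda>y. g y + h y" f x] by simp
  qed
qed

text \<open>On the open set off D continuity gives a Borel function after extension by 0; it differs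
  from f at finitely many points of the unit interval only.\<close>

lemma measurable_unit_lborel_isCont:
  fixes f :: "real \<Rightarrow> real"
  assumes D: "finite D" and c: "\<And>x. x \<in> {0<..<1} - D \<Longrightarrow> isCont f x"
  shows "f \<in> borel_measurable unit_lborel"
proof -
  have op: "open ({0<..<1} - D)" using D by (intro open_Diff finite_imp_closed) auto
  have "continuous_on ({0<..<1} - D) f" using c by (intro continuous_at_imp_continuous_on) auto
  then have "(\<lambda>x. indicator ({0<..<1} - D) x *\<^sub>R f x) \<in> borel_measurable borel"
    using op by (intro borel_measurable_continuous_on_indicator) auto
  then have 1: "(\<lambda>x. indicator ({0<..<1} - D) x *\<^sub>R f x) \<in> borel_measurable unit_lborel"
    by (rule measurable_unit_lborel)
  show ?thesis
    by (rule measurable_discrete_difference[OF 1, of "(D \<union> {0, 1}) \<inter> {0..1}"])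
      (use D in \<open>auto simp: countable_finite indicator_def unit_lborel_def sets_restrict_space\<close>)
qed

text \<open>By right continuity a value other than c would persist on an interval of positive
  length. The argument takes place to the right of x, which is why the point 1 is left out.\<close>

lemma cadlag01_AE_const:
  assumes f: "cadlag01 f" and ae: "AE x in lborel. x \<in> {0..1} \<longrightarrow> f x = c" and x: "x \<in> {0..<1}"
  shows "f x = c"
proof (rule ccontr)
  assume "f x \<noteq> c"
  have "(f \<longlongrightarrow> f x) (at_right x)" using f x by (auto simp: cadlag01_def)
  then have "\<forall>\<^sub>F y in at_right x. f y \<noteq> c" using \<open>f x \<noteq> c\<close> by (rule tendsto_imp_eventually_ne)
  moreover have "\<forall>\<^sub>F y in at_right x. y \<in> {x<..<1}" using x by (intro eventually_at_right_real) auto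
  ultimately have "\<forall>\<^sub>F y in at_right x. f y \<noteq> c \<and> y \<in> {x<..<1}" by eventually_elim auto
  then obtain b where b: "x < b" "\<And>y. x < y \<Longrightarrow> y < b \<Longrightarrow> f y \<noteq> c \<and> y \<in> {x<..<1}"
    by (auto simp: eventually_at_right_field)
  from ae have "AE y in lborel. y \<notin> {x<..<b}"
  proof eventually_elim
    case (elim y) then show ?case using b(2)[of y] x by auto
  qed
  then have "{x<..<b} \<in> null_sets lborel" by (subst AE_iff_null_sets) auto
  then show False using b(1) by (simp add: null_sets_def)
qed

section \<open>Mixing processes\<close>

lemma abs_mult_le_sum_squares: "\<bar>a * b\<bar> \<le> (a^2 + b^2) / 2" for a b :: real
proof -
  have "2 * \<bar>a\<bar> * \<bar>b\<bar> \<le> \<bar>a\<bar>^2 + \<bar>b\<bar>^2" by (rule sum_squares_bound)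
  then show ?thesis by (simp add: abs_mult)
qed


text \<open>\<open>\<theta>\<close> stands for the whole mixing exponent. By \<open>rate\<close>,
  the exponent of the covariance decay obtained from truncation exceeds 2, so that square roots of
  covariances are still summable.\<close>

locale mixing_process = prob_space M for M :: "'a measure" +
  fixes Y :: "nat \<Rightarrow> 'a \<Rightarrow> real" and \<theta> \<delta> C :: real
  assumes stationary: "strictly_stationary M Y"
    and mean_zero: "expectation (Y 1) = 0"
    and unit_variance: "variance (Y 1) = 1"
    and delta: "0 < \<delta>" "\<delta> \<le> 1"
    and moment: "integrable M (\<lambda>w. \<bar>Y 1 w\<bar> powr (2 + \<delta>))"
    and rate: "2 < \<theta> * \<delta> / (2 + \<delta>)"
    and mixing_rate: "\<And>k. k \<ge> 1 \<Longrightarrow> alpha_mixing_coeff M Y k \<le> C * real k powr (- \<theta>)"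
begin

section \<open>Generated sigma-fields and mixing coefficients\<close>

definition gen :: "nat set \<Rightarrow> 'a measure" where
  "gen I = sigma (space M) (\<Union>i\<in>I. {Y i -` B \<inter> space M | B. B \<in> sets borel})"

lemma sets_gen: "sets (gen I) = generated_events M Y I"
  unfolding gen_def generated_events_def by (intro sets_measure_of) auto

lemma space_gen [simp]: "space (gen I) = space M"
  unfolding gen_def by (intro space_measure_of) auto

lemma Y_measurable_gen: "i \<in> I \<Longrightarrow> Y i \<in> borel_measurable (gen I)"
  unfolding sets_gen[symmetric]
  by (rule measurableI) (auto simp: sets_gen generated_events_def intro!: sigma_sets.Basic)

lemma Y_measurable: "1 \<le> i \<Longrightarrow> Y i \<in> borel_measurable M"
  using stationary by (auto simp: strictly_stationary_def)

lemma subalgebra_gen: "I \<subseteq> {1..} \<Longrightarrow> subalgebra M (gen I)"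
  unfolding subalgebra_def sets_gen generated_events_def
  by (auto intro!: sets.sigma_sets_subset measurable_sets[OF Y_measurable])

text \<open>The bound 1 makes the sets under both suprema bounded above; only then does
  \<open>SUP\<close> on the reals dominate their members.\<close>

lemma alpha_coeff_bounds:
  assumes "A \<in> sets (gen I)" "B \<in> sets (gen J)" "I \<subseteq> {1..}" "J \<subseteq> {1..}"
  shows "\<bar>prob A * prob B - prob (A \<inter> B)\<bar> \<le> alpha_coeff M (generated_events M Y I) (generated_events M Y J)"
    and "alpha_coeff M (generated_events M Y I) (generated_events M Y J) \<le> 1"
proof -
  have le1: "\<bar>prob A * prob B - prob (A \<inter> B)\<bar> \<le> 1" for A B
  proof -
    have "prob A * prob B \<le> 1" by (intro mult_le_one) auto
    moreover have "0 \<le> prob A * prob B" "0 \<le> prob (A \<inter> B)" by auto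
    ultimately show ?thesis using prob_le_1[of "A \<inter> B"] by linarith
  qed
  show "\<bar>prob A * prob B - prob (A \<inter> B)\<bar> \<le> alpha_coeff M (generated_events M Y I) (generated_events M Y J)"
    unfolding alpha_coeff_def
    by (rule cSUP_upper2[where x = "(A, B)"]) (use assms le1 in \<open>auto simp: sets_gen intro!: bdd_aboveI2\<close>)
  show "alpha_coeff M (generated_events M Y I) (generated_events M Y J) \<le> 1"
    unfolding alpha_coeff_def
    by (rule cSUP_least) (use assms le1 in \<open>auto simp: sets_gen\<close>)
qed

lemma mixing_events:
  assumes "1 \<le> m" "A \<in> sets (gen {1..m})" "B \<in> sets (gen {k + m..})"
  shows "\<bar>prob A * prob B - prob (A \<inter> B)\<bar> \<le> alpha_mixing_coeff M Y k"
proof -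
  have "{} \<in> sets (gen I)" for I by simp
  then have le1: "alpha_coeff M (generated_events M Y {1..n}) (generated_events M Y {k + n..}) \<le> 1"
    if "1 \<le> n" for n
    using alpha_coeff_bounds(2)[of "{}" "{1..n}" "{}" "{k + n..}"] that by auto
  have "\<bar>prob A * prob B - prob (A \<inter> B)\<bar>
      \<le> alpha_coeff M (generated_events M Y {1..m}) (generated_events M Y {k + m..})"
    by (rule alpha_coeff_bounds(1)) (use assms in auto)
  also have "\<dots> \<le> alpha_mixing_coeff M Y k"
    unfolding alpha_mixing_coeff_def
    by (rule cSUP_upper) (use assms le1 in \<open>auto simp: bdd_above_def\<close>)
  finally show ?thesis .
qed

abbreviation \<alpha> :: "nat \<Rightarrow> real" where "\<alpha> \<equiv> alpha_mixing_coeff M Y"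

lemma alpha_nonneg: "0 \<le> \<alpha> k"
  using mixing_events[of 1 "{}" "{}" k] by simp

lemma C_nonneg: "0 \<le> C"
  using mixing_rate[of 1] alpha_nonneg[of 1] by simp

lemma covariance_le_alpha:
  fixes X Z :: "'a \<Rightarrow> real"
  assumes "1 \<le> m" "X \<in> borel_measurable (gen {1..m})" "Z \<in> borel_measurable (gen {k + m..})"
    and "\<And>w. w \<in> space M \<Longrightarrow> \<bar>X w\<bar> \<le> x" "\<And>w. w \<in> space M \<Longrightarrow> \<bar>Z w\<bar> \<le> z"
  shows "\<bar>(\<integral>w. X w * Z w \<partial>M) - (\<integral>w. X w \<partial>M) * (\<integral>w. Z w \<partial>M)\<bar>
    \<le> 4 * x * z * \<alpha> k"
  by (rule bounded_covariance_le[of "gen {1..m}" "gen {k + m..}"])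
    (use assms mixing_events[OF assms(1)] in \<open>auto intro!: subalgebra_gen\<close>)

lemma complex_covariance_le_alpha:
  fixes X Z :: "'a \<Rightarrow> complex"
  assumes "1 \<le> m" "X \<in> borel_measurable (gen {1..m})" "Z \<in> borel_measurable (gen {k + m..})"
    and "\<And>w. w \<in> space M \<Longrightarrow> norm (X w) \<le> 1" "\<And>w. w \<in> space M \<Longrightarrow> norm (Z w) \<le> 1"
  shows "norm ((\<integral>w. X w * Z w \<partial>M) - (\<integral>w. X w \<partial>M) * (\<integral>w. Z w \<partial>M))
    \<le> 16 * \<alpha> k"
  by (rule complex_bounded_covariance_le[of "gen {1..m}" "gen {k + m..}"])
    (use assms mixing_events[OF assms(1)] in \<open>auto intro!: subalgebra_gen\<close>)

section \<open>Stationarity and second moments\<close>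

lemma stationary_transfer:
  fixes F :: "(nat \<Rightarrow> real) \<Rightarrow> 'c :: {banach, second_countable_topology}"
  assumes J: "finite J" "J \<subseteq> {1..}"
    and F: "F \<in> borel_measurable (Pi\<^sub>M J (\<lambda>_. borel))"
  shows "(\<integral>w. F (\<lambda>i\<in>J. Y (i + h) w) \<partial>M) = (\<integral>w. F (\<lambda>i\<in>J. Y i w) \<partial>M)"
    and "integrable M (\<lambda>w. F (\<lambda>i\<in>J. Y (i + h) w)) \<longleftrightarrow> integrable M (\<lambda>w. F (\<lambda>i\<in>J. Y i w))"
proof -
  have m: "(\<lambda>w. \<lambda>i\<in>J. Y (i + k) w) \<in> measurable M (Pi\<^sub>M J (\<lambda>_. borel))" for k
    using J by (intro measurable_restrict Y_measurable) auto
  have eq: "distr M (Pi\<^sub>M J (\<lambda>_. borel)) (\<lambda>w. \<lambda>i\<in>J. Y (i + h) w) =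
        distr M (Pi\<^sub>M J (\<lambda>_. borel)) (\<lambda>w. \<lambda>i\<in>J. Y i w)"
    using stationary J unfolding strictly_stationary_def by blast
  have m0: "(\<lambda>w. \<lambda>i\<in>J. Y i w) \<in> measurable M (Pi\<^sub>M J (\<lambda>_. borel))" using m[of 0] by simp
  show "(\<integral>w. F (\<lambda>i\<in>J. Y (i + h) w) \<partial>M) = (\<integral>w. F (\<lambda>i\<in>J. Y i w) \<partial>M)"
    unfolding integral_distr[OF m F, symmetric] integral_distr[OF m0 F, symmetric] eq ..
  show "integrable M (\<lambda>w. F (\<lambda>i\<in>J. Y (i + h) w)) \<longleftrightarrow> integrable M (\<lambda>w. F (\<lambda>i\<in>J. Y i w))"
    unfolding integrable_distr_eq[OF m F, symmetric] integrable_distr_eq[OF m0 F, symmetric] eq ..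
qed

lemma stationary_single:
  fixes f :: "real \<Rightarrow> 'c :: {banach, second_countable_topology}"
  assumes "1 \<le> i" and [measurable]: "f \<in> borel_measurable borel"
  shows "(\<integral>w. f (Y i w) \<partial>M) = (\<integral>w. f (Y 1 w) \<partial>M)"
    and "integrable M (\<lambda>w. f (Y i w)) \<longleftrightarrow> integrable M (\<lambda>w. f (Y 1 w))"
  using stationary_transfer[of "{1}" "\<lambda>y. f (y 1)" "i - 1"] assms(1) by simp_all

lemma stationary_pair:
  fixes f :: "real \<Rightarrow> real \<Rightarrow> 'c :: {banach, second_countable_topology}"
  assumes "1 \<le> i" and [measurable]: "(\<lambda>(x, y). f x y) \<in> borel_measurable (borel \<Otimes>\<^sub>M borel)"
  shows "(\<integral>w. f (Y i w) (Y (i + k) w) \<partial>M) = (\<integral>w. f (Y 1 w) (Y (1 + k) w) \<partial>M)"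
proof -
  have "(\<lambda>y. (\<lambda>(x, y). f x y) (y 1, y (1 + k))) \<in> borel_measurable (Pi\<^sub>M {1, 1 + k} (\<lambda>_. borel))"
    by measurable
  then show ?thesis
    using stationary_transfer[of "{1, 1 + k}" "\<lambda>y. f (y 1) (y (1 + k))" "i - 1"] assms(1)
    by (simp add: add.commute)
qed

lemma stationary_block_sum:
  fixes f :: "real \<Rightarrow> real" and G :: "real \<Rightarrow> 'c :: {banach, second_countable_topology}"
  assumes [measurable]: "f \<in> borel_measurable borel" "G \<in> borel_measurable borel"
  shows "(\<integral>w. G (\<Sum>i\<in>{1..p}. f (Y (i + h) w)) \<partial>M) = (\<integral>w. G (\<Sum>i\<in>{1..p}. f (Y i w)) \<partial>M)"
proof -
  have eq: "(\<Sum>i\<in>{1..p}. f ((\<lambda>i\<in>{1..p}. Y (i + k) w) i)) = (\<Sum>i\<in>{1..p}. f (Y (i + k) w))" for k w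
    by (intro sum.cong) auto
  have "(\<integral>w. G (\<Sum>i\<in>{1..p}. f ((\<lambda>i\<in>{1..p}. Y (i + h) w) i)) \<partial>M)
      = (\<integral>w. G (\<Sum>i\<in>{1..p}. f ((\<lambda>i\<in>{1..p}. Y i w) i)) \<partial>M)"
    by (rule stationary_transfer) auto
  then show ?thesis unfolding eq using eq[of 0] by simp
qed

lemma square_integrable: "integrable M (\<lambda>w. (Y 1 w)^2)"
proof (rule Bochner_Integration.integrable_bound)
  show "integrable M (\<lambda>w. 1 + \<bar>Y 1 w\<bar> powr (2 + \<delta>))" using moment by simp
  have "y^2 \<le> 1 + \<bar>y\<bar> powr (2 + \<delta>)" for y :: real
  proof (cases "\<bar>y\<bar> \<le> 1")
    case True then have "y^2 \<le> 1" by (simp add: abs_square_le_1)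
    then show ?thesis by (simp add: add_increasing2)
  next
    case False
    then have "\<bar>y\<bar> powr 2 \<le> \<bar>y\<bar> powr (2 + \<delta>)" using delta by (intro powr_mono) auto
    then show ?thesis using False by simp
  qed
  then show "AE w in M. norm ((Y 1 w)^2) \<le> norm (1 + \<bar>Y 1 w\<bar> powr (2 + \<delta>))"
    by (auto intro!: AE_I2 simp: abs_of_nonneg add_nonneg_nonneg)
qed (use Y_measurable[of 1] in simp)

lemma second_moment: "(\<integral>w. (Y 1 w)^2 \<partial>M) = 1"
  using unit_variance mean_zero by simp

text \<open>The class of f with \<open>\<bar>f y\<bar> \<le> \<bar>y\<bar>\<close> contains the
  identity, the truncation and its remainder. The covariance estimates are stated for this class, so
  that one proof covers all three.\<close>

lemma square_integrable_f:
  assumes i: "1 \<le> i" and f [measurable]: "f \<in> borel_measurable borel" and fb: "\<And>y. \<bar>f y\<bar> \<le> \<bar>y\<bar>"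
  shows "integrable M (\<lambda>w. (f (Y i w))^2)" "(\<integral>w. (f (Y i w))^2 \<partial>M) \<le> 1"
    "integrable M (\<lambda>w. f (Y i w))" "\<bar>\<integral>w. f (Y i w) \<partial>M\<bar> \<le> 1"
proof -
  have [measurable]: "Y i \<in> borel_measurable M" "Y 1 \<in> borel_measurable M" using i Y_measurable by auto
  have sq: "(f y)^2 \<le> y^2" for y using fb[of y] by (simp add: abs_le_square_iff)
  have ii: "integrable M (\<lambda>w. (Y i w)^2)" "(\<integral>w. (Y i w)^2 \<partial>M) = 1"
    using stationary_single[of i "\<lambda>y. y^2"] i square_integrable second_moment by simp_all
  show 1: "integrable M (\<lambda>w. (f (Y i w))^2)"
    by (rule Bochner_Integration.integrable_bound[OF ii(1)]) (auto simp: sq)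
  have "(\<integral>w. (f (Y i w))^2 \<partial>M) \<le> (\<integral>w. (Y i w)^2 \<partial>M)"
    by (rule integral_mono[OF 1 ii(1)]) (rule sq)
  then show 2: "(\<integral>w. (f (Y i w))^2 \<partial>M) \<le> 1" using ii by simp
  show 3: "integrable M (\<lambda>w. f (Y i w))"
    by (rule square_integrable_imp_integrable) (use 1 in auto)
  have "(expectation (\<lambda>w. f (Y i w)))^2 \<le> 1"
    using variance_eq[OF 3 1] variance_positive[of "\<lambda>w. f (Y i w)"] 2 by linarith
  then show "\<bar>\<integral>w. f (Y i w) \<partial>M\<bar> \<le> 1" by (simp add: abs_square_le_1)
qed

lemma product_integrable:
  assumes ij: "1 \<le> i" "1 \<le> j" and f [measurable]: "f \<in> borel_measurable borel"
    and fb: "\<And>y. \<bar>f y\<bar> \<le> \<bar>y\<bar>"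
  shows "integrable M (\<lambda>w. f (Y i w) * f (Y j w))"
proof (rule Bochner_Integration.integrable_bound)
  show "integrable M (\<lambda>w. ((f (Y i w))^2 + (f (Y j w))^2) / 2)"
    using square_integrable_f(1)[OF ij(1) f fb] square_integrable_f(1)[OF ij(2) f fb] by simp
  show "AE w in M. norm (f (Y i w) * f (Y j w)) \<le> norm (((f (Y i w))^2 + (f (Y j w))^2) / 2)"
    using abs_mult_le_sum_squares by (auto simp: abs_of_nonneg)
qed (use ij Y_measurable in measurable)

definition decay :: real where "decay = \<theta> * \<delta> / (2 + \<delta>)"

text \<open>Cut f at a level T. The bounded parts have covariance at most a multiple of
  \<open>T^2 * \<alpha> k\<close>; the parts beyond T cost a multiple of
  \<open>T powr (- \<delta>)\<close> by the moment of order 2 + delta. The constant is the same for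
  all f of the class.\<close>

lemma covariance_decay:
  obtains D where "0 \<le> D"
    "\<And>i k f. 1 \<le> i \<Longrightarrow> 1 \<le> k \<Longrightarrow> f \<in> borel_measurable borel \<Longrightarrow> (\<And>y. \<bar>f y\<bar> \<le> \<bar>y\<bar>) \<Longrightarrow>
      \<bar>(\<integral>w. f (Y i w) * f (Y (i + k) w) \<partial>M) - (\<integral>w. f (Y i w) \<partial>M) * (\<integral>w. f (Y (i + k) w) \<partial>M)\<bar>
        \<le> D * real k powr (- decay)"
proof -
  define m where "m = (\<integral>w. \<bar>Y 1 w\<bar> powr (2 + \<delta>) \<partial>M)"
  have m0: "0 \<le> m" by (simp add: m_def)
  have "\<bar>(\<integral>w. f (Y i w) * f (Y (i + k) w) \<partial>M) - (\<integral>w. f (Y i w) \<partial>M) * (\<integral>w. f (Y (i + k) w) \<partial>M)\<bar>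
        \<le> (4 * C + 4 * m) * real k powr (- decay)"
    if i: "1 \<le> i" and k: "1 \<le> k" and f [measurable]: "f \<in> borel_measurable borel"
      and fb: "\<And>y. \<bar>f y\<bar> \<le> \<bar>y\<bar>" for i k f
  proof -
    define j where "j = i + k"
    have j: "1 \<le> j" using i by (simp add: j_def)
    have [measurable]: "Y i \<in> borel_measurable M" "Y j \<in> borel_measurable M"
      "Y 1 \<in> borel_measurable M" using i j Y_measurable by auto
    \<comment> \<open>This level equalises the two errors: \<open>T powr (- \<delta>)\<close> and
      \<open>T^2 * real k powr (- \<theta>)\<close> both become
      \<open>real k powr (- decay)\<close>.\<close>
    define T where "T = real k powr (\<theta> / (2 + \<delta>))"
    have th: "0 < \<theta>"
    proof (rule ccontr)
      assume "\<not> 0 < \<theta>"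
      then have "\<theta> * \<delta> / (2 + \<delta>) \<le> 0"
        using delta by (intro divide_nonpos_pos mult_nonpos_nonneg) auto
      then show False using rate by simp
    qed
    have T1: "1 \<le> T" unfolding T_def using k th delta by (intro ge_one_powr_ge_zero) auto
    have Td: "T powr (- \<delta>) = real k powr (- decay)"
      by (simp add: T_def powr_powr decay_def)
    have Ta: "T^2 * real k powr (- \<theta>) = real k powr (- decay)"
    proof -
      have "T^2 = real k powr (2 * \<theta> / (2 + \<delta>))"
        using k by (simp add: T_def power2_eq_square powr_add[symmetric])
      then have "T^2 * real k powr (- \<theta>) = real k powr (2 * \<theta> / (2 + \<delta>) - \<theta>)"
        using k by (simp add: powr_add[symmetric])
      also have "2 * \<theta> / (2 + \<delta>) - \<theta> = - decay"
        using delta by (simp add: decay_def field_simps)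
      finally show ?thesis .
    qed
    define h where "h y = f y * indicator {- T..T} y" for y
    \<comment> \<open>A common majorant for the errors of cutting single variables and products,
      with expectation controlled by the moment of order 2 + delta.\<close>
    define t where "t y = (if \<bar>y\<bar> > T then y^2 else 0)" for y :: real
    have [measurable]: "h \<in> borel_measurable borel" "t \<in> borel_measurable borel"
      unfolding h_def t_def by measurable
    have hb: "\<bar>h y\<bar> \<le> T" "\<bar>h y\<bar> \<le> \<bar>y\<bar>" for y
      using fb[of y] T1 by (auto simp: h_def indicator_def abs_mult)
    have t0: "0 \<le> t y" for y by (simp add: t_def)
    have tb: "t y \<le> T powr (- \<delta>) * \<bar>y\<bar> powr (2 + \<delta>)" for y
    proof (cases "\<bar>y\<bar> > T")
      case True
      then have y: "0 < \<bar>y\<bar>" using T1 by linarith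
      have "\<bar>y\<bar> powr (- \<delta>) \<le> T powr (- \<delta>)"
        using True T1 delta by (intro powr_mono2') auto
      then have "\<bar>y\<bar> powr (- \<delta>) * \<bar>y\<bar> powr (2 + \<delta>) \<le> T powr (- \<delta>) * \<bar>y\<bar> powr (2 + \<delta>)"
        by (rule mult_right_mono) simp
      moreover have "\<bar>y\<bar> powr (- \<delta>) * \<bar>y\<bar> powr (2 + \<delta>) = y^2"
        using y by (simp add: powr_add[symmetric])
      ultimately show ?thesis using True by (simp add: t_def)
    qed (simp add: t_def)
    have mi: "integrable M (\<lambda>w. \<bar>Y l w\<bar> powr (2 + \<delta>))" "(\<integral>w. \<bar>Y l w\<bar> powr (2 + \<delta>) \<partial>M) = m"
      if "1 \<le> l" for l
      using stationary_single[OF that, of "\<lambda>y. \<bar>y\<bar> powr (2 + \<delta>)"] moment by (simp_all add: m_def)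
    have ti: "integrable M (\<lambda>w. t (Y l w))"
      and te: "(\<integral>w. t (Y l w) \<partial>M) \<le> T powr (- \<delta>) * m" if l: "1 \<le> l" for l
    proof -
      have [measurable]: "Y l \<in> borel_measurable M" using l by (rule Y_measurable)
      have i2: "integrable M (\<lambda>w. T powr (- \<delta>) * \<bar>Y l w\<bar> powr (2 + \<delta>))" using mi[OF l] by simp
      show 1: "integrable M (\<lambda>w. t (Y l w))"
        by (rule Bochner_Integration.integrable_bound[OF i2]) (auto simp: t0 tb abs_mult)
      have "(\<integral>w. t (Y l w) \<partial>M) \<le> (\<integral>w. T powr (- \<delta>) * \<bar>Y l w\<bar> powr (2 + \<delta>) \<partial>M)"
        by (rule integral_mono[OF 1 i2]) (rule tb)
      then show "(\<integral>w. t (Y l w) \<partial>M) \<le> T powr (- \<delta>) * m" using mi[OF l] by simp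
    qed
    define e where "e = real k powr (- decay)"
    have e0: "0 \<le> e" by (simp add: e_def)
    have te': "(\<integral>w. t (Y l w) \<partial>M) \<le> e * m" if l: "1 \<le> l" for l
      using te[OF that] by (simp add: Td e_def)
    note fi = square_integrable_f[OF i f fb]
      and hj = square_integrable_f[OF j _ hb(2), simplified]
    note prod_i = product_integrable[OF i j]
    define F H where "F = (\<integral>w. f (Y i w) * f (Y j w) \<partial>M)" and "H = (\<integral>w. h (Y i w) * h (Y j w) \<partial>M)"
    define Fi Fj Hi Hj where "Fi = (\<integral>w. f (Y i w) \<partial>M)" and "Fj = (\<integral>w. f (Y j w) \<partial>M)"
      and "Hi = (\<integral>w. h (Y i w) \<partial>M)" and "Hj = (\<integral>w. h (Y j w) \<partial>M)"
    have "\<bar>H - Hi * Hj\<bar> \<le> 4 * T * T * \<alpha> k"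
      unfolding H_def Hi_def Hj_def
    proof (rule covariance_le_alpha[OF i])
      show "(\<lambda>w. h (Y i w)) \<in> borel_measurable (gen {1..i})"
        by (rule measurable_compose[OF Y_measurable_gen]) (use i in auto)
      show "(\<lambda>w. h (Y j w)) \<in> borel_measurable (gen {k + i..})"
        by (rule measurable_compose[OF Y_measurable_gen]) (auto simp: j_def)
    qed (use hb in auto)
    also have "\<dots> \<le> 4 * T * T * (C * real k powr (- \<theta>))"
      using T1 by (intro mult_left_mono mixing_rate k) auto
    also have "\<dots> = 4 * C * e" using Ta by (simp add: e_def power2_eq_square algebra_simps)
    finally have b1: "\<bar>H - Hi * Hj\<bar> \<le> 4 * C * e" .
    \<comment> \<open>If one argument exceeds T in modulus, the truncated product vanishes and the
      other product is at most the square of the larger argument, which exceeds T as well.\<close>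
    have pt: "\<bar>f a * f b - h a * h b\<bar> \<le> t a + t b" for a b
    proof (cases "\<bar>a\<bar> \<le> T \<and> \<bar>b\<bar> \<le> T")
      case True
      then show ?thesis using t0[of a] t0[of b] by (auto simp: h_def abs_le_iff)
    next
      case False
      then have "h a * h b = 0" by (auto simp: h_def indicator_def)
      moreover have "\<bar>f a * f b\<bar> \<le> \<bar>a\<bar> * \<bar>b\<bar>" by (simp add: abs_mult fb mult_mono)
      moreover have "\<bar>a\<bar> * \<bar>b\<bar> \<le> t a + t b"
      proof (cases "\<bar>a\<bar> \<le> \<bar>b\<bar>")
        case True
        then have "\<bar>a\<bar> * \<bar>b\<bar> \<le> \<bar>b\<bar> * \<bar>b\<bar>" by (intro mult_right_mono) auto
        moreover have "t b = \<bar>b\<bar> * \<bar>b\<bar>" using False True by (auto simp: t_def power2_eq_square)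
        ultimately show ?thesis using t0[of a] by linarith
      next
        case F: False
        then have "\<bar>a\<bar> * \<bar>b\<bar> \<le> \<bar>a\<bar> * \<bar>a\<bar>" by (intro mult_left_mono) auto
        moreover have "t a = \<bar>a\<bar> * \<bar>a\<bar>" using False F by (auto simp: t_def power2_eq_square)
        ultimately show ?thesis using t0[of b] by linarith
      qed
      ultimately show ?thesis by linarith
    qed
    have "\<bar>F - H\<bar> = \<bar>\<integral>w. f (Y i w) * f (Y j w) - h (Y i w) * h (Y j w) \<partial>M\<bar>"
      unfolding F_def H_def using prod_i[OF f fb] prod_i[OF _ hb(2)] by simp
    also have "\<dots> \<le> (\<integral>w. \<bar>f (Y i w) * f (Y j w) - h (Y i w) * h (Y j w)\<bar> \<partial>M)" by simp
    also have "\<dots> \<le> (\<integral>w. t (Y i w) + t (Y j w) \<partial>M)"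
      using prod_i[OF f fb] prod_i[OF _ hb(2)] ti i j by (intro integral_mono pt) auto
    also have "\<dots> = (\<integral>w. t (Y i w) \<partial>M) + (\<integral>w. t (Y j w) \<partial>M)" using ti i j by simp
    finally have b2: "\<bar>F - H\<bar> \<le> 2 * (e * m)" using te'[OF i] te'[OF j] by linarith
    have single: "\<bar>(\<integral>w. f (Y l w) \<partial>M) - (\<integral>w. h (Y l w) \<partial>M)\<bar> \<le> e * m" if l: "1 \<le> l" for l
    proof -
      have il: "integrable M (\<lambda>w. f (Y l w))" "integrable M (\<lambda>w. h (Y l w))"
        using square_integrable_f(3)[OF l _ fb] square_integrable_f(3)[OF l _ hb(2)] by auto
      have pt1: "\<bar>f y - h y\<bar> \<le> t y" for y
      proof (cases "\<bar>y\<bar> \<le> T")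
        case True then show ?thesis by (auto simp: h_def t_def abs_le_iff)
      next
        case False
        \<comment> \<open>Because \<open>T \<ge> 1\<close>, the square dominates the first power
          beyond T.\<close>
        then have "\<bar>y\<bar> * 1 \<le> \<bar>y\<bar> * \<bar>y\<bar>" using T1 by (intro mult_left_mono) auto
        then show ?thesis using False fb[of y] by (auto simp: h_def t_def indicator_def power2_eq_square)
      qed
      have "\<bar>(\<integral>w. f (Y l w) \<partial>M) - (\<integral>w. h (Y l w) \<partial>M)\<bar> = \<bar>\<integral>w. f (Y l w) - h (Y l w) \<partial>M\<bar>"
        using il by simp
      also have "\<dots> \<le> (\<integral>w. \<bar>f (Y l w) - h (Y l w)\<bar> \<partial>M)" by simp
      also have "\<dots> \<le> (\<integral>w. t (Y l w) \<partial>M)"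
        using il ti[OF l] by (intro integral_mono pt1) auto
      finally show ?thesis using te'[OF l] by linarith
    qed
    have "\<bar>Fi * Fj - Hi * Hj\<bar> = \<bar>Fi * (Fj - Hj) + (Fi - Hi) * Hj\<bar>" by (simp add: algebra_simps)
    also have "\<dots> \<le> \<bar>Fi\<bar> * \<bar>Fj - Hj\<bar> + \<bar>Fi - Hi\<bar> * \<bar>Hj\<bar>"
      by (metis abs_mult abs_triangle_ineq)
    also have "\<dots> \<le> 1 * (e * m) + (e * m) * 1"
      using fi(4) hj(4) single[OF i] single[OF j] m0 e0
      unfolding Fi_def Fj_def Hi_def Hj_def by (intro add_mono mult_mono) auto
    finally have b3: "\<bar>Fi * Fj - Hi * Hj\<bar> \<le> 2 * (e * m)" by simp
    \<comment> \<open>Mixing of the truncated variables gives \<open>4 * C\<close>; truncating the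
      product and truncating the means give \<open>2 * m\<close> each.\<close>
    have "\<bar>F - Fi * Fj\<bar> \<le> 4 * C * e + 2 * (e * m) + 2 * (e * m)" using b1 b2 b3 by linarith
    also have "\<dots> = (4 * C + 4 * m) * e" by (simp add: algebra_simps)
    finally show ?thesis unfolding F_def Fi_def Fj_def j_def e_def .
  qed
  then show ?thesis using C_nonneg m0 by (intro that[of "4 * C + 4 * m"]) auto
qed

text \<open>Each distance from i is attained at most once on either side of i, whence the 2. The
  conditional expresses the distance, since differences of naturals are cut off at 0.\<close>

lemma sum_dist_le_suminf:
  fixes w :: "nat \<Rightarrow> real"
  assumes "finite I" "summable w" "\<And>k. 0 \<le> w k"
  shows "(\<Sum>j\<in>I. w (if i \<le> j then j - i else i - j)) \<le> 2 * suminf w"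
proof -
  have "(\<Sum>j\<in>I. w (if i \<le> j then j - i else i - j))
      = (\<Sum>j\<in>{j\<in>I. i \<le> j}. w (j - i)) + (\<Sum>j\<in>{j\<in>I. \<not> i \<le> j}. w (i - j))"
    using sum.union_disjoint[of "{j\<in>I. i \<le> j}" "{j\<in>I. \<not> i \<le> j}"
        "\<lambda>j. w (if i \<le> j then j - i else i - j)"] assms(1)
    by (auto simp: Int_def Un_def conj_disj_distribL[symmetric] intro!: arg_cong2[where f = plus] sum.cong)
  also have "(\<Sum>j\<in>{j\<in>I. i \<le> j}. w (j - i)) = sum w ((\<lambda>j. j - i) ` {j\<in>I. i \<le> j})"
    by (subst sum.reindex) (auto simp: inj_on_def)
  also have "(\<Sum>j\<in>{j\<in>I. \<not> i \<le> j}. w (i - j)) = sum w ((\<lambda>j. i - j) ` {j\<in>I. \<not> i \<le> j})"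
    by (subst sum.reindex) (auto simp: inj_on_def)
  also have "sum w ((\<lambda>j. j - i) ` {j\<in>I. i \<le> j}) \<le> suminf w"
    using assms by (intro sum_le_suminf) auto
  also have "sum w ((\<lambda>j. i - j) ` {j\<in>I. \<not> i \<le> j}) \<le> suminf w"
    using assms by (intro sum_le_suminf) auto
  finally show ?thesis by simp
qed

text \<open>One constant serves all finite index sets, all weights and all f of the class. The root
  of the second moment of f makes truncated tails small uniformly in the length of the sum. By
  stationarity the mean at \<open>Y 1\<close> centers every summand.\<close>

definition sum_bound :: "real \<Rightarrow> bool" where
  "sum_bound K \<longleftrightarrow> 0 \<le> K \<and> (\<forall>I a A f. finite I \<longrightarrow> I \<subseteq> {1..} \<longrightarrow> (\<forall>i\<in>I. \<bar>a i\<bar> \<le> A) \<longrightarrow>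
      f \<in> borel_measurable borel \<longrightarrow> (\<forall>y. \<bar>f y\<bar> \<le> \<bar>y\<bar>) \<longrightarrow>
      integrable M (\<lambda>w. (\<Sum>i\<in>I. a i * (f (Y i w) - (\<integral>w. f (Y 1 w) \<partial>M)))^2) \<and>
      (\<integral>w. (\<Sum>i\<in>I. a i * (f (Y i w) - (\<integral>w. f (Y 1 w) \<partial>M)))^2 \<partial>M)
        \<le> K * A^2 * real (card I) * sqrt (\<integral>w. (f (Y 1 w))^2 \<partial>M))"

text \<open>With v the second moment of f, a covariance at distance k is at most v and at most
  \<open>D * real k powr (- decay)\<close>, hence at most the geometric mean of the two. This
  extracts \<open>sqrt v\<close> and leaves weights that are summable because \<open>decay\<close>
  exceeds 2.\<close>

lemma sum_bound_exists: "\<exists>K. sum_bound K"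
proof -
  obtain D where D0: "0 \<le> D" and D: "\<And>i k f. 1 \<le> i \<Longrightarrow> 1 \<le> k \<Longrightarrow> f \<in> borel_measurable borel \<Longrightarrow> (\<And>y. \<bar>f y\<bar> \<le> \<bar>y\<bar>) \<Longrightarrow>
      \<bar>(\<integral>w. f (Y i w) * f (Y (i + k) w) \<partial>M) - (\<integral>w. f (Y i w) \<partial>M) * (\<integral>w. f (Y (i + k) w) \<partial>M)\<bar>
        \<le> D * real k powr (- decay)" by (rule covariance_decay) blast
  \<comment> \<open>Weight 1 on the diagonal is enough: \<open>v \<le> 1\<close> gives
    \<open>v \<le> sqrt v\<close>.\<close>
  define wt where "wt k = (if k = 0 then 1 else sqrt (D * real k powr (- decay)))" for k :: nat
  have w0: "0 \<le> wt k" for k using D0 by (simp add: wt_def)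
  have "summable (\<lambda>k. sqrt D * real k powr (- (decay / 2)))"
  proof (intro summable_mult)
    have "2 < decay" using rate by (simp add: decay_def)
    then have "- (decay / 2) < -1" by simp
    then show "summable (\<lambda>k. real k powr (- (decay / 2)))" by (simp only: summable_real_powr_iff)
  qed
  then have ws: "summable wt"
  proof (rule summable_comparison_test_ev[rotated])
    have "wt k = sqrt D * real k powr (- (decay / 2))" if "1 \<le> k" for k
      using that by (simp add: wt_def real_sqrt_mult powr_half_sqrt[symmetric] powr_powr)
    then show "\<forall>\<^sub>F k in sequentially. norm (wt k) \<le> sqrt D * real k powr (- (decay / 2))"
      using w0 by (auto intro!: eventually_sequentiallyI[of 1] simp: abs_of_nonneg)
  qed
  have W0: "0 \<le> suminf wt" by (rule suminf_nonneg[OF ws w0])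
  show ?thesis
    unfolding sum_bound_def
  proof (intro exI[of _ "2 * suminf wt"] conjI allI impI)
    show "0 \<le> 2 * suminf wt" using W0 by simp
  next
    fix I :: "nat set" and a :: "nat \<Rightarrow> real" and A :: real and f :: "real \<Rightarrow> real"
    assume I: "finite I" "I \<subseteq> {1..}" and a0: "\<forall>i\<in>I. \<bar>a i\<bar> \<le> A"
      and f [measurable]: "f \<in> borel_measurable borel" and fb0: "\<forall>y. \<bar>f y\<bar> \<le> \<bar>y\<bar>"
    have a: "\<And>i. i \<in> I \<Longrightarrow> \<bar>a i\<bar> \<le> A" and fb: "\<And>y. \<bar>f y\<bar> \<le> \<bar>y\<bar>" using a0 fb0 by auto
    define E where "E = (\<integral>w. f (Y 1 w) \<partial>M)"
    define v where "v = (\<integral>w. (f (Y 1 w))^2 \<partial>M)"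
    have v: "0 \<le> v" "v \<le> 1" using square_integrable_f(2)[OF _ f fb, of 1] by (auto simp: v_def)
    define X where "X i w = f (Y i w) - E" for i w
    have Ym: "Y i \<in> borel_measurable M" if "i \<in> I" for i using that I Y_measurable by auto
    have Ei: "(\<integral>w. f (Y i w) \<partial>M) = E" "(\<integral>w. (f (Y i w))^2 \<partial>M) = v" if "i \<in> I" for i
      using that I stationary_single(1)[of i f] stationary_single(1)[of i "\<lambda>y. (f y)^2"] by (auto simp: E_def v_def)
    have fi: "integrable M (\<lambda>w. f (Y i w))" "integrable M (\<lambda>w. (f (Y i w))^2)" if "i \<in> I" for i
      using that I square_integrable_f[of i f] fb by auto
    have prod_i: "integrable M (\<lambda>w. f (Y i w) * f (Y j w))" if "i \<in> I" "j \<in> I" for i j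
      using that I fb by (intro product_integrable) auto
    have Xprod: "integrable M (\<lambda>w. X i w * X j w)"
      and Xint: "(\<integral>w. X i w * X j w \<partial>M) = (\<integral>w. f (Y i w) * f (Y j w) \<partial>M) - E * E" if ij: "i \<in> I" "j \<in> I" for i j
    proof -
      have *: "(\<lambda>w. X i w * X j w) = (\<lambda>w. f (Y i w) * f (Y j w) - E * f (Y i w) - E * f (Y j w) + E * E)"
        by (auto simp: X_def algebra_simps)
      show "integrable M (\<lambda>w. X i w * X j w)" unfolding *
        using prod_i[OF ij] fi ij by auto
      show "(\<integral>w. X i w * X j w \<partial>M) = (\<integral>w. f (Y i w) * f (Y j w) \<partial>M) - E * E" unfolding *
        using prod_i[OF ij] fi ij Ei by (simp add: prob_space)
    qed
    have cs: "\<bar>\<integral>w. X i w * X j w \<partial>M\<bar> \<le> v" if ij: "i \<in> I" "j \<in> I" for i j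
    proof -
      have *: "\<bar>x * y\<bar> \<le> (x * x + y * y) / 2" for x y :: real
        using abs_mult_le_sum_squares[of x y] by (simp add: power2_eq_square)
      have "\<bar>\<integral>w. X i w * X j w \<partial>M\<bar> \<le> (\<integral>w. \<bar>X i w * X j w\<bar> \<partial>M)" by simp
      also have "\<dots> \<le> (\<integral>w. (X i w * X i w + X j w * X j w) / 2 \<partial>M)"
        using Xprod ij by (intro integral_mono * integrable_abs) auto
      also have "\<dots> = v - E * E"
        using Xprod ij Xint Ei by (simp add: power2_eq_square)
      finally show ?thesis by (smt (verit) zero_le_square)
    qed
    have cov: "\<bar>\<integral>w. X i w * X j w \<partial>M\<bar> \<le> sqrt v * wt (if i \<le> j then j - i else i - j)"
      if ij: "i \<in> I" "j \<in> I" for i j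
    proof -
      have dist: "\<bar>\<integral>w. X i w * X j w \<partial>M\<bar> \<le> sqrt v * wt (j - i)" if ij: "i \<in> I" "j \<in> I" and "i < j" for i j
      proof -
        let ?c = "\<bar>\<integral>w. X i w * X j w \<partial>M\<bar>"
        have "?c \<le> D * real (j - i) powr (- decay)"
          using D[of i "j - i" f] ij \<open>i < j\<close> I fb Ei by (auto simp: Xint)
        then have "?c * ?c \<le> v * (D * real (j - i) powr (- decay))"
          using cs[OF ij] v by (intro mult_mono) auto
        then have "?c \<le> sqrt (v * (D * real (j - i) powr (- decay)))"
          by (intro real_le_rsqrt) (simp add: power2_eq_square)
        then show ?thesis using \<open>i < j\<close> by (simp add: wt_def real_sqrt_mult)
      qed
      show ?thesis
      proof (cases i j rule: linorder_cases)
        case less then show ?thesis using dist[OF ij] by simp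
      next
        case greater then show ?thesis using dist[OF ij(2,1)] by (simp add: mult.commute)
      next
        case equal
        have "v \<le> sqrt v" using v by (simp add: real_le_rsqrt power2_eq_square mult_left_le)
        then show ?thesis using cs[OF ij] equal by (simp add: wt_def)
      qed
    qed
    have sq: "(\<Sum>i\<in>I. a i * (f (Y i w) - (\<integral>w. f (Y 1 w) \<partial>M)))^2 = (\<Sum>i\<in>I. \<Sum>j\<in>I. (a i * a j) * (X i w * X j w))" for w
      unfolding X_def E_def power2_eq_square sum_product by (simp add: mult_ac)
    show "integrable M (\<lambda>w. (\<Sum>i\<in>I. a i * (f (Y i w) - (\<integral>w. f (Y 1 w) \<partial>M)))^2)"
      unfolding sq using Xprod by (intro Bochner_Integration.integrable_sum integrable_mult_right) auto
    have "(\<integral>w. (\<Sum>i\<in>I. a i * (f (Y i w) - (\<integral>w. f (Y 1 w) \<partial>M)))^2 \<partial>M)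
        = (\<Sum>i\<in>I. \<Sum>j\<in>I. (a i * a j) * (\<integral>w. X i w * X j w \<partial>M))"
      unfolding sq using Xprod by (simp add: Bochner_Integration.integral_sum)
    also have "\<dots> \<le> (\<Sum>i\<in>I. \<Sum>j\<in>I. (A * A) * (sqrt v * wt (if i \<le> j then j - i else i - j)))"
    proof (intro sum_mono)
      fix i j assume ij: "i \<in> I" "j \<in> I"
      have "(a i * a j) * (\<integral>w. X i w * X j w \<partial>M) \<le> \<bar>a i * a j\<bar> * \<bar>\<integral>w. X i w * X j w \<partial>M\<bar>"
        by (metis abs_ge_self abs_mult)
      also have "\<dots> \<le> (A * A) * (sqrt v * wt (if i \<le> j then j - i else i - j))"
        unfolding abs_mult[of "a i"] using a[OF ij(1)] a[OF ij(2)] cov[OF ij] by (intro mult_mono) auto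
      finally show "(a i * a j) * (\<integral>w. X i w * X j w \<partial>M) \<le> (A * A) * (sqrt v * wt (if i \<le> j then j - i else i - j))" .
    qed
    also have "\<dots> = (A * A) * sqrt v * (\<Sum>i\<in>I. \<Sum>j\<in>I. wt (if i \<le> j then j - i else i - j))"
      by (simp add: sum_distrib_left mult_ac)
    also have "\<dots> \<le> (A * A) * sqrt v * (\<Sum>i\<in>I. 2 * suminf wt)"
      using v by (intro mult_left_mono sum_mono sum_dist_le_suminf I ws w0) auto
    also have "\<dots> = 2 * suminf wt * A^2 * real (card I) * sqrt v"
      by (simp add: power2_eq_square mult_ac)
    finally show "(\<integral>w. (\<Sum>i\<in>I. a i * (f (Y i w) - (\<integral>w. f (Y 1 w) \<partial>M)))^2 \<partial>M)
        \<le> 2 * suminf wt * A^2 * real (card I) * sqrt (\<integral>w. (f (Y 1 w))^2 \<partial>M)"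
      by (simp add: v_def)
  qed
qed

end

section \<open>Variance and truncation\<close>

lemma (in prob_space) expectation_abs_le_sqrt:
  fixes X :: "'a \<Rightarrow> real"
  assumes [measurable]: "X \<in> borel_measurable M" and sq: "integrable M (\<lambda>w. (X w)^2)"
  shows "integrable M X" "(\<integral>w. \<bar>X w\<bar> \<partial>M) \<le> sqrt (\<integral>w. (X w)^2 \<partial>M)"
proof -
  show i: "integrable M X" by (rule square_integrable_imp_integrable) (use sq in auto)
  have "(expectation (\<lambda>w. \<bar>X w\<bar>))^2 \<le> expectation (\<lambda>w. (X w)^2)"
    using variance_eq[of "\<lambda>w. \<bar>X w\<bar>"] variance_positive[of "\<lambda>w. \<bar>X w\<bar>"] i sq by simp
  then show "(\<integral>w. \<bar>X w\<bar> \<partial>M) \<le> sqrt (\<integral>w. (X w)^2 \<partial>M)" by (rule real_le_rsqrt)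
qed

lemma norm_iexp_diff_le: "norm (iexp x - iexp y) \<le> \<bar>x - y\<bar>"
proof -
  have "iexp x - iexp y = iexp y * (iexp (x - y) - 1)"
    by (simp add: algebra_simps exp_add[symmetric])
  then have "norm (iexp x - iexp y) = norm (iexp (x - y) - 1)" by (simp add: norm_mult)
  also have "\<dots> \<le> \<bar>x - y\<bar>" using iexp_approx1[of "x - y" 0] by simp
  finally show ?thesis .
qed

lemma cesaro_mean:
  fixes d :: "nat \<Rightarrow> real"
  assumes "d \<longlonglongrightarrow> L"
  shows "(\<lambda>n. (\<Sum>i<n. d i) / real n) \<longlonglongrightarrow> L"
proof (rule LIMSEQ_I)
  fix e :: real assume e: "0 < e"
  obtain N where N: "\<And>n. N \<le> n \<Longrightarrow> \<bar>d n - L\<bar> < e / 2"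
    using LIMSEQ_D[OF assms, of "e / 2"] e by auto
  define R where "R = (\<Sum>i<N. \<bar>d i - L\<bar>)"
  obtain N' :: nat where N': "2 * R / e < real N'" using reals_Archimedean2 by blast
  show "\<exists>no. \<forall>n\<ge>no. norm ((\<Sum>i<n. d i) / real n - L) < e"
  proof (intro exI allI impI)
    fix n assume n: "max (max N N') 1 \<le> n"
    then have n0: "0 < real n" by simp
    have Rn: "R < e / 2 * real n"
    proof -
      have "2 * R / e < real n" using N' n by linarith
      then show ?thesis using e by (simp add: field_simps)
    qed
    have "(\<Sum>i<n. d i) - real n * L = (\<Sum>i<n. d i - L)" by (simp add: sum_subtractf)
    then have "\<bar>(\<Sum>i<n. d i) - real n * L\<bar> \<le> (\<Sum>i<n. \<bar>d i - L\<bar>)" by (metis sum_abs)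
    also have "\<dots> = R + (\<Sum>i\<in>{N..<n}. \<bar>d i - L\<bar>)"
      unfolding R_def using n by (subst sum.atLeastLessThan_concat[of 0 N n, simplified atLeast0LessThan, symmetric]) auto
    also have "(\<Sum>i\<in>{N..<n}. \<bar>d i - L\<bar>) \<le> (\<Sum>i\<in>{N..<n}. e / 2)"
      using N by (intro sum_mono less_imp_le) auto
    also have "(\<Sum>i\<in>{N..<n}. e / 2) \<le> e / 2 * real n" using e by (auto simp: mult.commute intro!: mult_right_mono)
    finally have "\<bar>(\<Sum>i<n. d i) - real n * L\<bar> < e * real n" using Rn by (simp add: algebra_simps)
    moreover have "(\<Sum>i<n. d i) / real n - L = ((\<Sum>i<n. d i) - real n * L) / real n"
      using n0 by (simp add: field_simps)
    ultimately show "norm ((\<Sum>i<n. d i) / real n - L) < e"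
      using n0 by (simp add: field_simps abs_divide)
  qed
qed

context mixing_process begin

lemma sum_boundD:
  assumes "sum_bound K" "finite I" "I \<subseteq> {1..}" "f \<in> borel_measurable borel" "\<And>y. \<bar>f y\<bar> \<le> \<bar>y\<bar>"
  shows "integrable M (\<lambda>w. (\<Sum>i\<in>I. f (Y i w) - (\<integral>w. f (Y 1 w) \<partial>M))^2)"
    and "(\<integral>w. (\<Sum>i\<in>I. f (Y i w) - (\<integral>w. f (Y 1 w) \<partial>M))^2 \<partial>M)
        \<le> K * real (card I) * sqrt (\<integral>w. (f (Y 1 w))^2 \<partial>M)"
    and "(\<integral>w. (\<Sum>i\<in>I. f (Y i w) - (\<integral>w. f (Y 1 w) \<partial>M))^2 \<partial>M) \<le> K * real (card I)"
proof -
  have *: "integrable M (\<lambda>w. (\<Sum>i\<in>I. 1 * (f (Y i w) - (\<integral>w. f (Y 1 w) \<partial>M)))^2) \<and>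
      (\<integral>w. (\<Sum>i\<in>I. 1 * (f (Y i w) - (\<integral>w. f (Y 1 w) \<partial>M)))^2 \<partial>M)
        \<le> K * 1^2 * real (card I) * sqrt (\<integral>w. (f (Y 1 w))^2 \<partial>M)"
    using assms unfolding sum_bound_def by (elim conjE allE[of _ I] allE[of _ "\<lambda>_. 1"] allE[of _ 1] allE[of _ f]) auto
  then show 1: "integrable M (\<lambda>w. (\<Sum>i\<in>I. f (Y i w) - (\<integral>w. f (Y 1 w) \<partial>M))^2)"
    and 2: "(\<integral>w. (\<Sum>i\<in>I. f (Y i w) - (\<integral>w. f (Y 1 w) \<partial>M))^2 \<partial>M)
        \<le> K * real (card I) * sqrt (\<integral>w. (f (Y 1 w))^2 \<partial>M)" by simp_all
  have "K * real (card I) * sqrt (\<integral>w. (f (Y 1 w))^2 \<partial>M) \<le> K * real (card I) * 1"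
    using assms square_integrable_f(2)[of 1 f] by (intro mult_left_mono) (auto simp: sum_bound_def)
  then show "(\<integral>w. (\<Sum>i\<in>I. f (Y i w) - (\<integral>w. f (Y 1 w) \<partial>M))^2 \<partial>M) \<le> K * real (card I)"
    using 2 by simp
qed

lemma expectation_Y: "1 \<le> i \<Longrightarrow> expectation (Y i) = 0"
  using stationary_single(1)[of i "\<lambda>y. y"] mean_zero by simp

section \<open>Asymptotic variance of partial sums\<close>

definition autocov :: "nat \<Rightarrow> real" where "autocov k = (\<integral>w. Y 1 w * Y (1 + k) w \<partial>M)"

lemma autocov_summable: "summable (\<lambda>k. autocov (Suc k))"
proof -
  obtain D where D0: "0 \<le> D" and D: "\<And>i k f. 1 \<le> i \<Longrightarrow> 1 \<le> k \<Longrightarrow> f \<in> borel_measurable borel \<Longrightarrow> (\<And>y. \<bar>f y\<bar> \<le> \<bar>y\<bar>) \<Longrightarrow>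
      \<bar>(\<integral>w. f (Y i w) * f (Y (i + k) w) \<partial>M) - (\<integral>w. f (Y i w) \<partial>M) * (\<integral>w. f (Y (i + k) w) \<partial>M)\<bar>
        \<le> D * real k powr (- decay)" by (rule covariance_decay) blast
  have "- decay < -1" using rate by (simp add: decay_def)
  then have "summable (\<lambda>k. D * real k powr (- decay))"
    by (intro summable_mult) (simp only: summable_real_powr_iff)
  then have "summable (\<lambda>k. D * real (Suc k) powr (- decay))" by (subst (asm) summable_Suc_iff[symmetric])
  then show ?thesis
    by (rule summable_comparison_test'[where N = 0])
      (use D[of 1 "Suc _" "\<lambda>y. y"] in \<open>auto simp: autocov_def mean_zero[simplified]\<close>)
qed

lemma long_run_variance_autocov: "long_run_variance M Y = 1 + 2 * (\<Sum>k. autocov (Suc k))"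
  using unit_variance mean_zero expectation_Y
  by (simp add: long_run_variance_def cov_def autocov_def)

text \<open>Passing from n to n + 1 summands raises the second moment by \<open>d n\<close>: one
  variance plus twice the covariances with the n earlier variables. The normalised second moment is
  therefore the Cesaro mean of \<open>d\<close>, and \<open>d\<close> tends to the long run
  variance.\<close>

lemma variance_limit:
  "(\<lambda>n. (\<integral>w. (\<Sum>i\<in>{1..n}. Y i w)^2 \<partial>M) / real n) \<longlonglongrightarrow> long_run_variance M Y"
proof -
  define d where "d n = 1 + 2 * (\<Sum>k<n. autocov (Suc k))" for n
  have "d \<longlonglongrightarrow> long_run_variance M Y"
    unfolding d_def long_run_variance_autocov
    by (intro tendsto_intros summable_LIMSEQ autocov_summable)
  moreover have "integrable M (\<lambda>w. (\<Sum>i\<in>{1..n}. Y i w)^2) \<and> (\<integral>w. (\<Sum>i\<in>{1..n}. Y i w)^2 \<partial>M) = (\<Sum>i<n. d i)" for n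
  proof (induction n)
    case (Suc n)
    have eq: "(\<Sum>i\<in>{1..Suc n}. Y i w)^2 = (\<Sum>i\<in>{1..n}. Y i w)^2 + Y (Suc n) w * Y (Suc n) w
        + 2 * (\<Sum>i\<in>{1..n}. Y i w * Y (Suc n) w)" for w
      by (simp add: power2_eq_square algebra_simps sum_distrib_left sum_distrib_right)
    have i: "integrable M (\<lambda>w. \<Sum>i\<in>{1..n}. Y i w * Y (Suc n) w)"
      by (intro Bochner_Integration.integrable_sum product_integrable[where f = "\<lambda>y. y"]) auto
    have i2: "integrable M (\<lambda>w. Y (Suc n) w * Y (Suc n) w)"
      by (intro product_integrable[where f = "\<lambda>y. y"]) auto
    have e2: "(\<integral>w. Y (Suc n) w * Y (Suc n) w \<partial>M) = 1"
      using stationary_single(1)[of "Suc n" "\<lambda>y. y * y"] second_moment by (simp add: power2_eq_square)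
    have "(\<integral>w. (\<Sum>i\<in>{1..n}. Y i w * Y (Suc n) w) \<partial>M) = (\<Sum>i\<in>{1..n}. \<integral>w. Y i w * Y (Suc n) w \<partial>M)"
      by (intro Bochner_Integration.integral_sum product_integrable[where f = "\<lambda>y. y"]) auto
    also have "\<dots> = (\<Sum>i\<in>{1..n}. autocov (Suc n - i))"
    proof (intro sum.cong refl)
      fix i assume "i \<in> {1..n}"
      then show "(\<integral>w. Y i w * Y (Suc n) w \<partial>M) = autocov (Suc n - i)"
        using stationary_pair[of i "\<lambda>x y. x * y" "Suc n - i"] by (simp add: autocov_def)
    qed
    also have "\<dots> = (\<Sum>k<n. autocov (Suc k))"
      by (rule sum.reindex_bij_witness[of _ "\<lambda>k. n - k" "\<lambda>i. n - i"]) (auto simp: Suc_diff_le)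
    finally show ?case unfolding eq using Suc i i2 e2 by (simp add: d_def)
  qed simp
  ultimately show ?thesis using cesaro_mean[of d] by simp
qed

section \<open>Truncation\<close>

definition trunc :: "real \<Rightarrow> real \<Rightarrow> real" where "trunc T y = y * indicator {- T..T} y"

text \<open>The root is the factor that \<open>sum_bound\<close> yields for the removed tail. The
  summand \<open>1 / T\<close> makes the quantity strictly positive, so that its root can serve as a
  divisor.\<close>

definition tail_size :: "real \<Rightarrow> real" where
  "tail_size T = sqrt (\<integral>w. (Y 1 w - trunc T (Y 1 w))^2 \<partial>M) + 1 / T"

lemma trunc_measurable [measurable]: "trunc T \<in> borel_measurable borel"
  unfolding trunc_def by measurable

lemma trunc_bounds: "\<bar>trunc T y\<bar> \<le> \<bar>y\<bar>" "0 \<le> T \<Longrightarrow> \<bar>trunc T y\<bar> \<le> T" "\<bar>y - trunc T y\<bar> \<le> \<bar>y\<bar>"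
  by (auto simp: trunc_def indicator_def)

lemma tail_size_tendsto_0: "(\<lambda>n. tail_size (real n)) \<longlonglongrightarrow> 0"
proof -
  have [measurable]: "Y 1 \<in> borel_measurable M" "Y (Suc 0) \<in> borel_measurable M"
    using Y_measurable by auto
  have "(\<lambda>n. \<integral>w. (Y 1 w - trunc (real n) (Y 1 w))^2 \<partial>M) \<longlonglongrightarrow> (\<integral>w. 0 \<partial>M)"
  proof (rule integral_dominated_convergence[where w = "\<lambda>w. (Y 1 w)^2"])
    show "AE w in M. (\<lambda>n. (Y 1 w - trunc (real n) (Y 1 w))^2) \<longlonglongrightarrow> 0"
    proof (rule AE_I2)
      fix w
      obtain N :: nat where N: "\<bar>Y 1 w\<bar> \<le> real N" using real_arch_simple by blast
      show "(\<lambda>n. (Y 1 w - trunc (real n) (Y 1 w))^2) \<longlonglongrightarrow> 0"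
      proof (rule tendsto_eventually, rule eventually_sequentiallyI[of N])
        fix n assume "N \<le> n"
        then have "\<bar>Y 1 w\<bar> \<le> real n" using N by linarith
        then show "(Y 1 w - trunc (real n) (Y 1 w))^2 = 0" by (auto simp: trunc_def indicator_def)
      qed
    qed
    show "AE w in M. norm ((Y 1 w - trunc (real n) (Y 1 w))^2) \<le> (Y 1 w)^2" for n
      using trunc_bounds(3) by (auto simp: abs_le_square_iff)
  qed (use square_integrable in auto)
  then have "(\<lambda>n. sqrt (\<integral>w. (Y 1 w - trunc (real n) (Y 1 w))^2 \<partial>M) + 1 / real n) \<longlonglongrightarrow> sqrt 0 + 0"
    by (intro tendsto_intros lim_1_over_n) simp
  then show ?thesis by (simp add: tail_size_def)
qed

definition truncY :: "real \<Rightarrow> nat \<Rightarrow> 'a \<Rightarrow> real" where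
  "truncY T i w = trunc T (Y i w) - (\<integral>w. trunc T (Y 1 w) \<partial>M)"

lemma truncY_bound: "0 \<le> T \<Longrightarrow> \<bar>truncY T i w\<bar> \<le> 2 * T"
proof -
  assume T: "0 \<le> T"
  have "\<bar>\<integral>w. trunc T (Y 1 w) \<partial>M\<bar> \<le> T"
    using Y_measurable[of 1] trunc_bounds(2)[OF T] by (intro expectation_bounded) auto
  then show ?thesis using trunc_bounds(2)[OF T, of "Y i w"] by (simp add: truncY_def abs_le_iff)
qed

lemma truncY_measurable: "1 \<le> i \<Longrightarrow> truncY T i \<in> borel_measurable M"
  unfolding truncY_def using Y_measurable[of i] by measurable

lemma truncY_measurable_gen: "i \<in> I \<Longrightarrow> truncY T i \<in> borel_measurable (gen I)"
  unfolding truncY_def using Y_measurable_gen[of i I] by measurable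

text \<open>The removed part is again a centered sum over a function of the class: since Y is
  centered, \<open>y - trunc T y\<close> has the opposite mean of \<open>trunc T y\<close>. Its
  second moment per summand is small for large T, whatever the number of summands.\<close>

lemma tail_sum_bound:
  assumes K: "sum_bound K" and I: "finite I" "I \<subseteq> {1..}" and T: "0 < T"
  shows "integrable M (\<lambda>w. ((\<Sum>i\<in>I. Y i w) - (\<Sum>i\<in>I. truncY T i w))^2)"
    and "(\<integral>w. ((\<Sum>i\<in>I. Y i w) - (\<Sum>i\<in>I. truncY T i w))^2 \<partial>M) \<le> K * real (card I) * tail_size T"
proof -
  let ?g = "\<lambda>y. y - trunc T y"
  have gb: "\<bar>?g y\<bar> \<le> \<bar>y\<bar>" for y by (rule trunc_bounds)
  have i: "integrable M (Y 1)" "integrable M (\<lambda>w. trunc T (Y 1 w))"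
    using square_integrable_f(3)[of 1 "\<lambda>y. y"] square_integrable_f(3)[of 1 "trunc T"] trunc_bounds by auto
  then have Eg: "(\<integral>w. ?g (Y 1 w) \<partial>M) = - (\<integral>w. trunc T (Y 1 w) \<partial>M)" using mean_zero by simp
  have eq: "(\<Sum>i\<in>I. Y i w) - (\<Sum>i\<in>I. truncY T i w) = (\<Sum>i\<in>I. ?g (Y i w) - (\<integral>w. ?g (Y 1 w) \<partial>M))" for w
    unfolding Eg truncY_def sum_subtractf[symmetric] by (simp add: algebra_simps)
  show "integrable M (\<lambda>w. ((\<Sum>i\<in>I. Y i w) - (\<Sum>i\<in>I. truncY T i w))^2)"
    unfolding eq by (rule sum_boundD[OF K I _ gb]) simp
  have "(\<integral>w. ((\<Sum>i\<in>I. Y i w) - (\<Sum>i\<in>I. truncY T i w))^2 \<partial>M)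
      \<le> K * real (card I) * sqrt (\<integral>w. (?g (Y 1 w))^2 \<partial>M)"
    unfolding eq by (rule sum_boundD[OF K I _ gb]) simp
  also have "\<dots> \<le> K * real (card I) * tail_size T"
    using K T by (intro mult_left_mono) (auto simp: tail_size_def sum_bound_def)
  finally show "(\<integral>w. ((\<Sum>i\<in>I. Y i w) - (\<Sum>i\<in>I. truncY T i w))^2 \<partial>M) \<le> K * real (card I) * tail_size T" .
qed

lemma truncY_sum_bound:
  assumes K: "sum_bound K" and I: "finite I" "I \<subseteq> {1..}"
  shows "integrable M (\<lambda>w. (\<Sum>i\<in>I. truncY T i w)^2)"
    and "(\<integral>w. (\<Sum>i\<in>I. truncY T i w)^2 \<partial>M) \<le> K * real (card I)"
  unfolding truncY_def using sum_boundD[OF K I trunc_measurable trunc_bounds(1)] by auto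

lemma Y_sum_bound:
  assumes K: "sum_bound K" and I: "finite I" "I \<subseteq> {1..}"
  shows "integrable M (\<lambda>w. (\<Sum>i\<in>I. Y i w)^2)"
    and "(\<integral>w. (\<Sum>i\<in>I. Y i w)^2 \<partial>M) \<le> K * real (card I)"
  using sum_boundD[OF K I, of "\<lambda>y. y"] mean_zero by auto

lemma tail_size_pos: "0 < T \<Longrightarrow> 0 < tail_size T"
  unfolding tail_size_def by (intro add_nonneg_pos) auto

text \<open>The difference of squares is handled by
  \<open>2 * a * b \<le> a^2 / \<eta> + \<eta> * b^2\<close>, which involves only the second moments
  of the remainder and of the full sum.\<close>

lemma truncated_variance_close:
  assumes K: "sum_bound K" and T: "0 < T" and p: "1 \<le> p"
  shows "\<bar>(\<integral>w. (\<Sum>i\<in>{1..p}. truncY T i w)^2 \<partial>M) / real p - (\<integral>w. (\<Sum>i\<in>{1..p}. Y i w)^2 \<partial>M) / real p\<bar>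
    \<le> K * (tail_size T + 2 * sqrt (tail_size T))"
proof -
  define e where "e = tail_size T"
  have e: "0 < e" using tail_size_pos[OF T] by (simp add: e_def)
  \<comment> \<open>This balances \<open>e / \<eta>\<close> against \<open>\<eta>\<close>; both
    equal \<open>sqrt e\<close>, whence the 2 in the bound.\<close>
  define \<eta> where "\<eta> = sqrt e"
  have \<eta>: "0 < \<eta>" "e / \<eta> = \<eta>" using e by (auto simp: \<eta>_def real_div_sqrt)
  define S where "S w = (\<Sum>i\<in>{1..p}. Y i w)" for w
  define B where "B w = (\<Sum>i\<in>{1..p}. truncY T i w)" for w
  have I: "finite {1..p}" "{1..p} \<subseteq> {1..}" by auto
  note g = tail_sum_bound[OF K I T, folded S_def B_def e_def, simplified]
    and b = truncY_sum_bound[OF K I, of T, folded B_def, simplified]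
    and s = Y_sum_bound[OF K I, folded S_def, simplified]
  have pt: "\<bar>(B w)^2 - (S w)^2\<bar> \<le> (1 + 1 / \<eta>) * (S w - B w)^2 + \<eta> * (S w)^2" for w
  proof -
    have "0 \<le> (\<bar>S w - B w\<bar> - \<eta> * \<bar>S w\<bar>)^2 / \<eta>" using \<eta> by simp
    also have "\<dots> = (S w - B w)^2 / \<eta> - 2 * (\<bar>S w - B w\<bar> * \<bar>S w\<bar>) + \<eta> * (S w)^2"
      using \<eta> by (simp add: power2_diff power_mult_distrib field_simps power2_eq_square)
    finally have "2 * (\<bar>S w - B w\<bar> * \<bar>S w\<bar>) \<le> (S w - B w)^2 / \<eta> + \<eta> * (S w)^2" by simp
    moreover have "(B w)^2 - (S w)^2 = (S w - B w)^2 - 2 * ((S w - B w) * S w)"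
      by (simp add: power2_eq_square algebra_simps)
    moreover have "\<bar>(S w - B w)^2 - 2 * ((S w - B w) * S w)\<bar> \<le> (S w - B w)^2 + 2 * (\<bar>S w - B w\<bar> * \<bar>S w\<bar>)"
      unfolding abs_mult[symmetric] by (smt (verit) zero_le_power2)
    ultimately show ?thesis by (simp add: algebra_simps)
  qed
  have "\<bar>(\<integral>w. (B w)^2 \<partial>M) - (\<integral>w. (S w)^2 \<partial>M)\<bar> = \<bar>\<integral>w. (B w)^2 - (S w)^2 \<partial>M\<bar>"
    using b s by simp
  also have "\<dots> \<le> (\<integral>w. \<bar>(B w)^2 - (S w)^2\<bar> \<partial>M)" by simp
  also have "\<dots> \<le> (\<integral>w. (1 + 1 / \<eta>) * (S w - B w)^2 + \<eta> * (S w)^2 \<partial>M)"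
    using b s g by (intro integral_mono pt) auto
  also have "\<dots> = (1 + 1 / \<eta>) * (\<integral>w. (S w - B w)^2 \<partial>M) + \<eta> * (\<integral>w. (S w)^2 \<partial>M)"
    using g s by simp
  also have "\<dots> \<le> (1 + 1 / \<eta>) * (K * real p * e) + \<eta> * (K * real p)"
    using g s \<eta> by (intro add_mono mult_left_mono) auto
  also have "\<dots> = K * real p * (e + e / \<eta> + \<eta>)" by (simp add: algebra_simps)
  also have "\<dots> = K * (e + 2 * \<eta>) * real p" unfolding \<eta>(2) by (simp add: algebra_simps)
  finally have "\<bar>(\<integral>w. (B w)^2 \<partial>M) - (\<integral>w. (S w)^2 \<partial>M)\<bar> / real p \<le> K * (e + 2 * \<eta>)"
    using p by (simp add: divide_le_eq)
  then show ?thesis using p unfolding B_def[symmetric] S_def[symmetric] e_def[symmetric] \<eta>_def[symmetric]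
    by (simp add: diff_divide_distrib[symmetric] abs_divide)
qed

end

section \<open>Central limit theorem\<close>

lemma exp_minus_second_order: "0 \<le> x \<Longrightarrow> \<bar>exp (- x) - (1 - x)\<bar> \<le> x^2" for x :: real
proof -
  assume x: "0 \<le> x"
  have 1: "1 - x \<le> exp (- x)" using exp_ge_add_one_self[of "- x"] by simp
  have "exp (- x) * (1 + x) \<le> exp (- x) * exp x" by (intro mult_left_mono exp_ge_add_one_self) auto
  then have "exp (- x) * (1 + x) \<le> 1" by (simp add: exp_add[symmetric])
  then have "exp (- x) \<le> 1 / (1 + x)" using x by (simp add: field_simps)
  \<comment> \<open>The product of \<open>1 - x + x^2\<close> and \<open>1 + x\<close> is
    \<open>1 + x^3\<close>.\<close>
  also have "\<dots> \<le> 1 - x + x^2"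
  proof -
    have "1 \<le> (1 - x + x^2) * (1 + x)" using x by (simp add: algebra_simps power2_eq_square)
    then show ?thesis using x by (simp add: divide_le_eq)
  qed
  finally show ?thesis using 1 by (simp add: abs_le_iff)
qed

context mixing_process begin

lemma truncY_block_char:
  "(\<integral>w. iexp (v * (\<Sum>i\<in>{1..p}. truncY T (i + h) w)) \<partial>M) = (\<integral>w. iexp (v * (\<Sum>i\<in>{1..p}. truncY T i w)) \<partial>M)"
  unfolding truncY_def
  by (rule stationary_block_sum[of "\<lambda>y. trunc T y - (\<integral>w. trunc T (Y 1 w) \<partial>M)" "\<lambda>s. iexp (v * s)"]) auto

lemma iexp_expectation_le_1:
  assumes "f \<in> borel_measurable M" shows "norm (\<integral>w. iexp (f w) \<partial>M) \<le> 1"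
proof -
  have "norm (\<integral>w. iexp (f w) \<partial>M) \<le> (\<integral>w. norm (iexp (f w)) \<partial>M)" by (rule integral_norm_bound)
  then show ?thesis by (simp add: prob_space)
qed

lemma iexp_integrable: "f \<in> borel_measurable M \<Longrightarrow> integrable M (\<lambda>w. iexp (f w))"
  by (rule integrable_bounded[of _ 1]) auto

text \<open>Induction on the number of blocks, splitting off the last one. A gap of q indices
  separates it from the past and costs \<open>16 * \<alpha> q\<close>; the error made so far is
  multiplied by a number of modulus at most 1 and does not grow.\<close>

lemma block_char_product:
  assumes p: "1 \<le> p"
  shows "norm ((\<integral>w. iexp (v * (\<Sum>j<k. \<Sum>i\<in>{1..p}. truncY T (i + j * (p + q)) w)) \<partial>M)
      - (\<integral>w. iexp (v * (\<Sum>i\<in>{1..p}. truncY T i w)) \<partial>M) ^ k) \<le> 16 * \<alpha> q * real k"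
proof (induction k)
  case (Suc k)
  define d where "d = p + q"
  define \<phi> where "\<phi> = (\<integral>w. iexp (v * (\<Sum>i\<in>{1..p}. truncY T i w)) \<partial>M)"
  define B where "B j w = (\<Sum>i\<in>{1..p}. truncY T (i + j * d) w)" for j w
  define Z where "Z w = iexp (v * (\<Sum>j<k. B j w))" for w
  define W where "W w = iexp (v * B k w)" for w
  have W\<phi>: "(\<integral>w. W w \<partial>M) = \<phi>" unfolding W_def B_def \<phi>_def by (rule truncY_block_char)
  have \<phi>1: "norm \<phi> \<le> 1" unfolding \<phi>_def
    by (intro iexp_expectation_le_1 borel_measurable_times borel_measurable_sum truncY_measurable) auto
  have IH: "norm ((\<integral>w. Z w \<partial>M) - \<phi> ^ k) \<le> 16 * \<alpha> q * real k"
    using Suc.IH unfolding Z_def B_def \<phi>_def d_def .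
  have ZW: "iexp (v * (\<Sum>j<Suc k. B j w)) = Z w * W w" for w
    by (simp add: Z_def W_def exp_add[symmetric] distrib_left)
  have "norm ((\<integral>w. Z w * W w \<partial>M) - (\<integral>w. Z w \<partial>M) * (\<integral>w. W w \<partial>M)) \<le> 16 * \<alpha> q"
  proof (cases "k = 0")
    case True
    then show ?thesis using alpha_nonneg by (simp add: Z_def prob_space)
  next
    case False
    \<comment> \<open>The last index of the previous block; the new block begins just after
      \<open>q + m\<close>, which is \<open>k * d\<close>. For \<open>k = 0\<close> there is no
      past, hence the separate case.\<close>
    define m where "m = (k - 1) * d + p"
    have m: "1 \<le> m" "q + m = k * d"
      using p False by (auto simp: m_def d_def algebra_simps) (cases k; simp add: algebra_simps)
    show ?thesis
    proof (rule complex_covariance_le_alpha[OF m(1)])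
      have "truncY T (i + j * d) \<in> borel_measurable (gen {1..m})" if "j < k" "i \<in> {1..p}" for i j
      proof (rule truncY_measurable_gen)
        have "j * d \<le> (k - 1) * d" using that by (intro mult_right_mono) auto
        then have "i + j * d \<le> m" using that unfolding m_def by (simp only: atLeastAtMost_iff) linarith
        then show "i + j * d \<in> {1..m}" using that by auto
      qed
      then show "Z \<in> borel_measurable (gen {1..m})" unfolding Z_def B_def by measurable
      have "truncY T (i + k * d) \<in> borel_measurable (gen {q + m..})" if "i \<in> {1..p}" for i
        by (rule truncY_measurable_gen) (use m in auto)
      then show "W \<in> borel_measurable (gen {q + m..})" unfolding W_def B_def by measurable
    qed (auto simp: Z_def W_def)
  qed
  then have 1: "norm ((\<integral>w. Z w * W w \<partial>M) - (\<integral>w. Z w \<partial>M) * \<phi>) \<le> 16 * \<alpha> q"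
    by (simp add: W\<phi>)
  have "norm (((\<integral>w. Z w \<partial>M) - \<phi> ^ k) * \<phi>) \<le> norm ((\<integral>w. Z w \<partial>M) - \<phi> ^ k) * 1"
    unfolding norm_mult using \<phi>1 by (intro mult_left_mono) auto
  then have 2: "norm ((\<integral>w. Z w \<partial>M) * \<phi> - \<phi> ^ Suc k) \<le> 16 * \<alpha> q * real k"
    using IH by (simp add: algebra_simps)
  have "norm ((\<integral>w. Z w * W w \<partial>M) - \<phi> ^ Suc k)
      \<le> 16 * \<alpha> q + 16 * \<alpha> q * real k"
    using norm_triangle_mono[OF 1 2] by simp
  then show ?case
    unfolding \<phi>_def[symmetric] d_def[symmetric] B_def[symmetric] ZW by (simp add: algebra_simps)
qed (simp add: prob_space)

text \<open>Taylor expansion to second order. No third moment is needed: truncation bounds one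
  factor of the cube by \<open>2 * T * real p\<close>, and the remaining square has expectation at
  most \<open>K * real p\<close>. The term with \<open>v ^ 4\<close> is the error of replacing
  \<open>1 - v^2 * V / 2\<close> by an exponential.\<close>

lemma block_char_expansion:
  fixes p :: nat
  assumes K: "sum_bound K" and T: "0 \<le> T"
  defines "V \<equiv> (\<integral>w. (\<Sum>i\<in>{1..p}. truncY T i w)^2 \<partial>M)"
  shows "norm ((\<integral>w. iexp (v * (\<Sum>i\<in>{1..p}. truncY T i w)) \<partial>M) - of_real (exp (- (v^2 * V / 2))))
    \<le> \<bar>v\<bar> ^ 3 * T * K * real p ^ 2 + v ^ 4 * K^2 * real p ^ 2"
proof -
  define B where "B w = (\<Sum>i\<in>{1..p}. truncY T i w)" for w
  have [measurable]: "B \<in> borel_measurable M"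
    unfolding B_def by (intro borel_measurable_sum truncY_measurable) auto
  have b: "integrable M (\<lambda>w. (B w)^2)" and V: "V \<le> K * real p" "0 \<le> V"
    using truncY_sum_bound[OF K, of "{1..p}" T] by (auto simp: V_def B_def)
  have K0: "0 \<le> K" using K by (simp add: sum_bound_def)
  have bi: "integrable M B" using expectation_abs_le_sqrt(1)[OF _ b] by simp
  have EB: "(\<integral>w. B w \<partial>M) = 0"
  proof -
    have "integrable M (truncY T i)" "(\<integral>w. truncY T i w \<partial>M) = 0" if "1 \<le> i" for i
      using square_integrable_f(3)[OF that trunc_measurable trunc_bounds(1)]
        stationary_single(1)[OF that trunc_measurable]
      by (auto simp: truncY_def[abs_def] prob_space)
    then show ?thesis unfolding B_def by (subst Bochner_Integration.integral_sum) auto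
  qed
  have Bb: "\<bar>B w\<bar> \<le> 2 * T * real p" for w
  proof -
    have "\<bar>B w\<bar> \<le> (\<Sum>i\<in>{1..p}. 2 * T)"
      unfolding B_def by (rule sum_abs[THEN order_trans]) (intro sum_mono truncY_bound T)
    then show ?thesis by (simp add: mult.commute)
  qed
  have pt: "norm (iexp (v * B w) - (1 + \<i> * of_real (v * B w) - of_real ((v * B w)^2 / 2)))
      \<le> \<bar>v\<bar> ^ 3 * (2 * T * real p) / 6 * (B w)^2" for w
  proof -
    have s: "(\<Sum>k\<le>2. (\<i> * of_real (v * B w)) ^ k / fact k)
        = 1 + \<i> * of_real (v * B w) - of_real ((v * B w)^2 / 2)"
      by (simp add: numeral_2_eq_2 power2_eq_square algebra_simps)
    have "norm (iexp (v * B w) - (1 + \<i> * of_real (v * B w) - of_real ((v * B w)^2 / 2)))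
        \<le> \<bar>v * B w\<bar> ^ 3 / 6"
      using iexp_approx1[of "v * B w" 2] unfolding s by (simp add: fact_numeral numeral_3_eq_3)
    also have "\<bar>v * B w\<bar> ^ 3 = \<bar>v\<bar> ^ 3 * (\<bar>B w\<bar> * (B w)^2)"
    proof -
      have "\<bar>B w\<bar> ^ 3 = \<bar>B w\<bar> * \<bar>B w\<bar>^2" by (simp add: power3_eq_cube power2_eq_square)
      then show ?thesis unfolding abs_mult power_mult_distrib power2_abs by simp
    qed
    also have "\<bar>v\<bar> ^ 3 * (\<bar>B w\<bar> * (B w)^2) / 6 \<le> \<bar>v\<bar> ^ 3 * ((2 * T * real p) * (B w)^2) / 6"
      using Bb by (intro divide_right_mono mult_right_mono mult_left_mono) auto
    also have "\<dots> = \<bar>v\<bar> ^ 3 * (2 * T * real p) / 6 * (B w)^2" by simp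
    finally show ?thesis .
  qed
  define \<phi> where "\<phi> = (\<integral>w. iexp (v * B w) \<partial>M)"
  define G where "G w = 1 + \<i> * of_real (v * B w) - of_real ((v * B w)^2 / 2)" for w
  have VB: "(\<integral>w. (B w)^2 \<partial>M) = V" by (simp add: V_def B_def)
  have iB: "integrable M (\<lambda>w. complex_of_real (B w))" "integrable M (\<lambda>w. complex_of_real ((B w)^2))"
    by (rule integrable_of_real[OF bi], rule integrable_of_real[OF b])
  have eB: "(\<integral>w. complex_of_real (B w) \<partial>M) = 0" "(\<integral>w. complex_of_real ((B w)^2) \<partial>M) = of_real V"
    using EB VB by (simp_all only: integral_complex_of_real of_real_0)
  have Gi: "integrable M G" unfolding G_def using iB by (simp add: power_mult_distrib)
  have EG: "(\<integral>w. G w \<partial>M) = of_real (1 - v^2 * V / 2)"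
    unfolding G_def using iB eB by (simp add: power_mult_distrib prob_space)
  have iexpB: "integrable M (\<lambda>w. iexp (v * B w))" by (intro iexp_integrable) measurable
  have "\<phi> - of_real (1 - v^2 * V / 2) = (\<integral>w. iexp (v * B w) - G w \<partial>M)"
    unfolding \<phi>_def EG[symmetric] by (rule Bochner_Integration.integral_diff[OF iexpB Gi, symmetric])
  also have "norm \<dots> \<le> (\<integral>w. norm (iexp (v * B w) - G w) \<partial>M)" by (rule integral_norm_bound)
  also have "\<dots> \<le> (\<integral>w. \<bar>v\<bar> ^ 3 * (2 * T * real p) / 6 * (B w)^2 \<partial>M)"
    using b pt by (intro integral_mono integrable_norm Bochner_Integration.integrable_diff iexpB Gi)
      (auto simp only: G_def intro!: integrable_mult_right)
  also have "\<dots> = \<bar>v\<bar> ^ 3 * (2 * T * real p) / 6 * V" using VB by simp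
  also have "\<dots> \<le> \<bar>v\<bar> ^ 3 * (2 * T * real p) / 6 * (K * real p)"
    using T V by (intro mult_left_mono) auto
  also have "\<dots> = (\<bar>v\<bar> ^ 3 * T * K * real p ^ 2) / 3" by (simp add: power2_eq_square)
  also have "\<dots> \<le> \<bar>v\<bar> ^ 3 * T * K * real p ^ 2" using T K0 by simp
  finally have 1: "norm (\<phi> - of_real (1 - v^2 * V / 2)) \<le> \<bar>v\<bar> ^ 3 * T * K * real p ^ 2" .
  have "\<bar>exp (- (v^2 * V / 2)) - (1 - v^2 * V / 2)\<bar> \<le> (v^2 * V / 2)^2"
    using V by (intro exp_minus_second_order) simp
  also have "\<dots> \<le> (v^2 * (K * real p))^2"
  proof (intro power_mono)
    have "v^2 * V \<le> v^2 * (K * real p)" "0 \<le> v^2 * V" using V by (auto intro: mult_left_mono)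
    then show "v^2 * V / 2 \<le> v^2 * (K * real p)" by linarith
  qed (use V in simp)
  also have "\<dots> = v ^ 4 * K^2 * real p ^ 2" by (simp add: power_mult_distrib mult_ac)
  finally have "norm (of_real (1 - v^2 * V / 2) - of_real (exp (- (v^2 * V / 2))) :: complex) \<le> v ^ 4 * K^2 * real p ^ 2"
    unfolding of_real_diff[symmetric] norm_of_real by linarith
  from norm_triangle_mono[OF 1 this] show ?thesis
    by (simp add: \<phi>_def B_def)
qed

text \<open>Only the \<open>k * q\<close> gap indices and an incomplete last block of length below \<open>p + q\<close> lie
  outside the big blocks.\<close>

lemma big_blocks_approx:
  fixes n p q :: nat
  assumes K: "sum_bound K" and T: "0 < T" and p: "1 \<le> p" and q: "1 \<le> q"
  defines "k \<equiv> n div (p + q)"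
  shows "integrable M (\<lambda>w. ((\<Sum>i\<in>{1..n}. Y i w) - (\<Sum>j<k. \<Sum>i\<in>{1..p}. truncY T (i + j * (p + q)) w))^2)"
    and "(\<integral>w. ((\<Sum>i\<in>{1..n}. Y i w) - (\<Sum>j<k. \<Sum>i\<in>{1..p}. truncY T (i + j * (p + q)) w))^2 \<partial>M)
      \<le> 2 * K * (real n * tail_size T + real (k * q + (p + q)))"
proof -
  define d where "d = p + q"
  define \<iota> where "\<iota> = (\<lambda>(j, i). i + j * d)"
  define P where "P = {..<k} \<times> {1..p}"
  \<comment> \<open>As \<open>q \<ge> 1\<close>, offsets up to p stay below \<open>d\<close>, so
    division by \<open>d\<close> recovers the block number.\<close>
  have dm: "x = y" if "i + x * d = i' + y * d" "i \<in> {1..p}" "i' \<in> {1..p}" for i i' x y :: nat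
  proof -
    have "0 < d" "i < d" "i' < d" using that q by (auto simp: d_def)
    then have "x = (i + x * d) div d" "y = (i' + y * d) div d" by auto
    then show ?thesis using that by simp
  qed
  have inj: "inj_on \<iota> P"
  proof (rule inj_onI)
    fix a b assume *: "a \<in> P" "b \<in> P" "\<iota> a = \<iota> b"
    obtain x i y i' where ab: "a = (x, i)" "b = (y, i')" by (cases a, cases b)
    then have "x = y" using * dm[of i x i' y] by (auto simp: \<iota>_def P_def)
    then show "a = b" using * ab by (auto simp: \<iota>_def)
  qed
  have kd: "k * d \<le> n" "n < k * d + d"
    unfolding k_def d_def[symmetric] using dividend_less_div_times[of d n] q
    by (simp_all add: d_def add.commute)
  have sub: "\<iota> ` P \<subseteq> {1..n}"
  proof
    fix x assume "x \<in> \<iota> ` P"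
    then obtain j i where ji: "j < k" "i \<in> {1..p}" "x = i + j * d" by (auto simp: \<iota>_def P_def)
    have "j * d + d \<le> k * d" using ji mult_right_mono[of "Suc j" k d] by simp
    then show "x \<in> {1..n}" using ji kd by (auto simp: d_def)
  qed
  define R where "R = {1..n} - \<iota> ` P"
  have cR: "card R \<le> k * q + (p + q)"
  proof -
    have "card R = n - k * p" unfolding R_def using sub inj
      by (subst card_Diff_subset) (auto simp: card_image P_def intro: finite_subset)
    then show ?thesis using kd by (simp add: d_def algebra_simps)
  qed
  have blocks: "(\<Sum>j<k. \<Sum>i\<in>{1..p}. truncY T (i + j * d) w) = (\<Sum>i\<in>\<iota> ` P. truncY T i w)" for w
    unfolding sum.reindex[OF inj] by (simp add: sum.cartesian_product P_def \<iota>_def case_prod_unfold)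
  define G where "G w = (\<Sum>i\<in>{1..n}. Y i w) - (\<Sum>i\<in>{1..n}. truncY T i w)" for w
  define H where "H w = (\<Sum>i\<in>R. truncY T i w)" for w
  have eq: "(\<Sum>i\<in>{1..n}. Y i w) - (\<Sum>j<k. \<Sum>i\<in>{1..p}. truncY T (i + j * (p + q)) w) = G w + H w" for w
    unfolding d_def[symmetric] blocks G_def H_def R_def using sub by (subst sum_diff) auto
  have g: "integrable M (\<lambda>w. (G w)^2)" "(\<integral>w. (G w)^2 \<partial>M) \<le> K * real n * tail_size T"
    using tail_sum_bound[OF K, of "{1..n}" T] T by (auto simp: G_def)
  have "finite R" "R \<subseteq> {1..}" by (auto simp: R_def)
  from truncY_sum_bound[OF K this, of T]
  have h: "integrable M (\<lambda>w. (H w)^2)" "(\<integral>w. (H w)^2 \<partial>M) \<le> K * real (card R)" by (auto simp: H_def)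
  have [measurable]: "G \<in> borel_measurable M" "H \<in> borel_measurable M"
    unfolding G_def H_def R_def
    by (intro borel_measurable_diff borel_measurable_sum truncY_measurable Y_measurable; auto)+
  have GH: "(G w + H w)^2 \<le> 2 * (G w)^2 + 2 * (H w)^2" for w
    using sum_squares_bound[of "G w" "H w"] by (simp add: power2_sum)
  have i2: "integrable M (\<lambda>w. 2 * (G w)^2 + 2 * (H w)^2)" using g h by simp
  show i1: "integrable M (\<lambda>w. ((\<Sum>i\<in>{1..n}. Y i w) - (\<Sum>j<k. \<Sum>i\<in>{1..p}. truncY T (i + j * (p + q)) w))^2)"
    unfolding eq by (rule Bochner_Integration.integrable_bound[OF i2]) (use GH in \<open>auto simp: abs_of_nonneg\<close>)
  have "(\<integral>w. (G w + H w)^2 \<partial>M) \<le> (\<integral>w. 2 * (G w)^2 + 2 * (H w)^2 \<partial>M)"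
    by (rule integral_mono[OF i1[unfolded eq] i2 GH])
  also have "\<dots> \<le> 2 * (K * real n * tail_size T) + 2 * (K * real (card R))" using g h by simp
  also have "\<dots> \<le> 2 * (K * real n * tail_size T) + 2 * (K * real (k * q + (p + q)))"
    using cR K unfolding sum_bound_def
    by (intro add_mono mult_left_mono) (auto simp only: of_nat_le_iff intro!: mult_nonneg_nonneg)
  finally show "(\<integral>w. ((\<Sum>i\<in>{1..n}. Y i w) - (\<Sum>j<k. \<Sum>i\<in>{1..p}. truncY T (i + j * (p + q)) w))^2 \<partial>M)
      \<le> 2 * K * (real n * tail_size T + real (k * q + (p + q)))" unfolding eq by (simp add: algebra_simps)
qed

text \<open>The error terms are, in order: truncation and gaps, in mean square through the Lipschitz
  property of the complex exponential; decoupling of the big blocks; and the expansion of one block,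
  accumulated over k blocks.\<close>

lemma char_bound:
  fixes n p q :: nat and u :: real
  assumes K: "sum_bound K" and T: "0 < T" and p: "1 \<le> p" and q: "1 \<le> q" and n: "1 \<le> n"
  defines "k \<equiv> n div (p + q)" and "V \<equiv> (\<integral>w. (\<Sum>i\<in>{1..p}. truncY T i w)^2 \<partial>M)"
  shows "norm ((\<integral>w. iexp (u / sqrt (real n) * (\<Sum>i\<in>{1..n}. Y i w)) \<partial>M)
      - of_real (exp (- (u^2 / 2 * (real k * V / real n)))))
    \<le> \<bar>u\<bar> * sqrt (2 * K * (tail_size T + real (k * q + (p + q)) / real n))
      + 16 * \<alpha> q * real k
      + (\<bar>u\<bar> ^ 3 * K * (T * real p / sqrt (real n)) + u ^ 4 * K^2 * (real p / real n))"
proof -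
  define v where "v = u / sqrt (real n)"
  define S where "S w = (\<Sum>i\<in>{1..n}. Y i w)" for w
  define B where "B w = (\<Sum>j<k. \<Sum>i\<in>{1..p}. truncY T (i + j * (p + q)) w)" for w
  define \<phi> where "\<phi> = (\<integral>w. iexp (v * (\<Sum>i\<in>{1..p}. truncY T i w)) \<partial>M)"
  have n0: "0 < real n" using n by simp
  have v2: "v^2 = u^2 / real n" "\<bar>v\<bar> = \<bar>u\<bar> / sqrt (real n)" by (simp_all add: v_def power_divide)
  have [measurable]: "S \<in> borel_measurable M" "B \<in> borel_measurable M"
    unfolding S_def B_def
    by (intro borel_measurable_sum truncY_measurable Y_measurable; auto)+
  have scale: "\<bar>v\<bar> * sqrt (2 * K * (real n * t + R)) = \<bar>u\<bar> * sqrt (2 * K * (t + R / real n))" for t R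
  proof -
    have "2 * K * (t + R / real n) = 2 * K * (real n * t + R) / real n"
      using n0 by (simp add: field_simps)
    then show ?thesis by (simp add: v2 real_sqrt_divide)
  qed
  note ap = big_blocks_approx[OF K T p q, of n, folded k_def, folded S_def B_def]
  have "(\<integral>w. iexp (v * S w) \<partial>M) - (\<integral>w. iexp (v * B w) \<partial>M) = (\<integral>w. iexp (v * S w) - iexp (v * B w) \<partial>M)"
    using Bochner_Integration.integral_diff[OF iexp_integrable[of "\<lambda>w. v * S w"] iexp_integrable[of "\<lambda>w. v * B w"]]
    by simp
  also have "norm \<dots> \<le> (\<integral>w. norm (iexp (v * S w) - iexp (v * B w)) \<partial>M)" by (rule integral_norm_bound)
  also have "\<dots> \<le> (\<integral>w. \<bar>v\<bar> * \<bar>S w - B w\<bar> \<partial>M)"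
  proof (rule integral_mono)
    show "integrable M (\<lambda>w. \<bar>v\<bar> * \<bar>S w - B w\<bar>)"
      using expectation_abs_le_sqrt(1)[OF _ ap(1)] by simp
    show "norm (iexp (v * S w) - iexp (v * B w)) \<le> \<bar>v\<bar> * \<bar>S w - B w\<bar>" for w
      using norm_iexp_diff_le[of "v * S w" "v * B w"] by (simp add: abs_mult[symmetric] algebra_simps)
    show "integrable M (\<lambda>w. norm (iexp (v * S w) - iexp (v * B w)))"
      by (intro integrable_norm Bochner_Integration.integrable_diff iexp_integrable; measurable)
  qed
  also have "\<dots> = \<bar>v\<bar> * (\<integral>w. \<bar>S w - B w\<bar> \<partial>M)" by simp
  also have "\<dots> \<le> \<bar>v\<bar> * sqrt (2 * K * (real n * tail_size T + real (k * q + (p + q))))"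
    using expectation_abs_le_sqrt(2)[OF _ ap(1)] ap(2)
    by (intro mult_left_mono) (auto intro: order_trans real_sqrt_le_mono)
  also have "\<dots> = \<bar>u\<bar> * sqrt (2 * K * (tail_size T + real (k * q + (p + q)) / real n))"
    by (rule scale)
  finally have 1: "norm ((\<integral>w. iexp (v * S w) \<partial>M) - (\<integral>w. iexp (v * B w) \<partial>M))
    \<le> \<bar>u\<bar> * sqrt (2 * K * (tail_size T + real (k * q + (p + q)) / real n))" .
  have 2: "norm ((\<integral>w. iexp (v * B w) \<partial>M) - \<phi> ^ k) \<le> 16 * \<alpha> q * real k"
    unfolding B_def \<phi>_def by (rule block_char_product[OF p])
  have \<phi>1: "norm \<phi> \<le> 1" unfolding \<phi>_def
    by (intro iexp_expectation_le_1 borel_measurable_times borel_measurable_sum truncY_measurable) auto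
  have V0: "0 \<le> V" by (simp add: V_def)
  have K0: "0 \<le> K" using K by (simp add: sum_bound_def)
  have kp: "real k * real p \<le> real n"
  proof -
    have "k * (p + q) \<le> n" by (simp add: k_def div_times_less_eq_dividend)
    then have "k * p \<le> n" by (simp add: algebra_simps)
    then show ?thesis unfolding of_nat_mult[symmetric] of_nat_le_iff .
  qed
  define ex where "ex = exp (- (v^2 * V / 2))"
  \<comment> \<open>Both bases lie in the unit disc, so their k-th powers differ by at most k times
    their distance. Afterwards \<open>real k * real p \<le> real n\<close> absorbs one factor
    p.\<close>
  have "norm (\<phi> ^ k - of_real ex ^ k) \<le> real k * norm (\<phi> - of_real ex)"
    by (rule norm_power_diff) (use \<phi>1 V0 in \<open>auto simp: ex_def\<close>)
  also have "\<dots> \<le> real k * (\<bar>v\<bar> ^ 3 * T * K * real p ^ 2 + v ^ 4 * K^2 * real p ^ 2)"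
    unfolding \<phi>_def ex_def V_def by (intro mult_left_mono block_char_expansion K) (use T in auto)
  also have "\<dots> = (real k * real p) * ((\<bar>v\<bar> ^ 3 * T * K + v ^ 4 * K^2) * real p)"
    by (simp add: power2_eq_square algebra_simps)
  also have "\<dots> \<le> real n * ((\<bar>v\<bar> ^ 3 * T * K + v ^ 4 * K^2) * real p)"
    using kp T K0 by (intro mult_right_mono) auto
  also have "\<dots> = \<bar>u\<bar> ^ 3 * K * (T * real p / sqrt (real n)) + u ^ 4 * K^2 * (real p / real n)"
  proof -
    have a: "\<bar>v\<bar> ^ 3 * real n = \<bar>u\<bar> ^ 3 / sqrt (real n)"
      using n0 by (simp add: v2 power3_eq_cube field_simps)
    have b: "v ^ 4 * real n = u ^ 4 / real n"
    proof -
      have "v ^ 4 = (v^2)^2" by (simp add: power_mult[symmetric])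
      also have "\<dots> = u ^ 4 / (real n)^2" unfolding v2 by (simp add: power_divide power_mult[symmetric])
      finally show ?thesis using n0 by (simp add: power2_eq_square)
    qed
    have "real n * ((\<bar>v\<bar> ^ 3 * T * K + v ^ 4 * K^2) * real p)
      = (\<bar>v\<bar> ^ 3 * real n) * T * K * real p + (v ^ 4 * real n) * K^2 * real p" by (simp add: algebra_simps)
    then show ?thesis unfolding a b by (simp add: mult_ac)
  qed
  finally have 3: "norm (\<phi> ^ k - of_real ex ^ k)
    \<le> \<bar>u\<bar> ^ 3 * K * (T * real p / sqrt (real n)) + u ^ 4 * K^2 * (real p / real n)" .
  have exk: "of_real ex ^ k = (of_real (exp (- (u^2 / 2 * (real k * V / real n)))) :: complex)"
    unfolding ex_def of_real_power[symmetric] exp_of_nat_mult[symmetric] v2 by (simp add: mult_ac)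
  from norm_triangle_mono[OF norm_triangle_mono[OF 1 2] 3] show ?thesis
    unfolding exk by (simp add: S_def v_def)
qed

end

section \<open>Choice of block sizes and passage to the limit\<close>

lemma floor_root_bounds:
  fixes n :: nat
  assumes "1 \<le> n"
  defines "m \<equiv> nat \<lfloor>root 10 (real n)\<rfloor>"
  shows "1 \<le> m" "real m ^ 10 \<le> real n" "real n \<le> 1024 * real m ^ 10"
proof -
  have r1: "1 \<le> root 10 (real n)" using assms(1) by simp
  then show m1: "1 \<le> m" unfolding m_def by linarith
  have m: "real m \<le> root 10 (real n)" "root 10 (real n) < real m + 1"
    unfolding m_def using r1 by linarith+
  have rn: "root 10 (real n) ^ 10 = real n" by simp
  have "real m ^ 10 \<le> root 10 (real n) ^ 10" using m by (intro power_mono) auto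
  then show "real m ^ 10 \<le> real n" unfolding rn .
  \<comment> \<open>The root is below m + 1, which is at most 2 m; 1024 is the tenth power of
    2.\<close>
  have "root 10 (real n) ^ 10 \<le> (2 * real m) ^ 10" using m m1 r1 by (intro power_mono) linarith+
  then show "real n \<le> 1024 * real m ^ 10" unfolding rn by (simp add: power_mult_distrib)
qed

lemma filterlim_floor_root: "filterlim (\<lambda>n. nat \<lfloor>root 10 (real n)\<rfloor>) at_top sequentially"
  unfolding filterlim_at_top
proof (intro allI)
  fix Z :: nat
  show "\<forall>\<^sub>F n in sequentially. Z \<le> nat \<lfloor>root 10 (real n)\<rfloor>"
  proof (rule eventually_sequentiallyI[of "Z ^ 10"])
    fix n assume "Z ^ 10 \<le> n"
    then have "real Z ^ 10 \<le> real n" by (simp flip: of_nat_power)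
    then have "real Z \<le> root 10 (real n)"
      using real_root_le_mono[of 10 "real Z ^ 10" "real n"] by (simp add: real_root_power_cancel)
    then show "Z \<le> nat \<lfloor>root 10 (real n)\<rfloor>" by linarith
  qed
qed

context mixing_process begin

text \<open>\<open>rate\<close> says that \<open>\<theta>\<close> exceeds
  \<open>2 * (2 + \<delta>) / \<delta>\<close>, whose smallest value 6 is attained at
  \<open>\<delta> = 1\<close>. Exponent 6 fits gaps of length m^2: it gives m^-12 against a number
  of blocks of order at most m^10.\<close>

lemma theta_gt_6: "6 < \<theta>"
proof -
  have "2 * (2 + \<delta>) < \<theta> * \<delta>" using rate delta by (simp add: field_simps)
  moreover have "6 * \<delta> \<le> 2 * (2 + \<delta>)" using delta by simp
  ultimately have "6 * \<delta> < \<theta> * \<delta>" by (rule le_less_trans[rotated])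
  then show ?thesis using delta by simp
qed

lemma alpha_le_power: "1 \<le> q \<Longrightarrow> \<alpha> q \<le> C / real q ^ 6"
proof -
  assume q: "1 \<le> q"
  have "\<alpha> q \<le> C * real q powr (- \<theta>)" by (rule mixing_rate[OF q])
  also have "\<dots> \<le> C * real q powr (- 6)"
    using C_nonneg theta_gt_6 q by (intro mult_left_mono powr_mono) auto
  also have "real q powr (- 6) = 1 / real q ^ 6" using q by (simp add: powr_minus_divide)
  finally show ?thesis by simp
qed

text \<open>With \<open>m ~ n\<^sup>1\<^sup>/\<^sup>1\<^sup>0\<close>, big blocks of length \<open>m\<^sup>3\<close> are separated by gaps of length \<open>m^2\<close> and
  the truncation level is \<open>m\<close>; any exponents with \<open>n \<alpha>(q) / p\<close>, \<open>q / p\<close> and \<open>T p / n\<^sup>1\<^sup>/^2\<close> all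
  vanishing would do.\<close>

lemma char_convergence:
  "(\<lambda>n. \<integral>w. iexp (u / sqrt (real n) * (\<Sum>i\<in>{1..n}. Y i w)) \<partial>M)
    \<longlonglongrightarrow> of_real (exp (- (u^2 / 2 * long_run_variance M Y)))"
proof -
  obtain K where K: "sum_bound K" using sum_bound_exists by blast
  then have K0: "0 \<le> K" by (simp add: sum_bound_def)
  define m :: "nat \<Rightarrow> nat" where "m n = nat \<lfloor>root 10 (real n)\<rfloor>" for n
  note mb = floor_root_bounds[folded m_def]
  have mt: "filterlim m at_top sequentially" unfolding m_def[abs_def] by (rule filterlim_floor_root)
  define k where "k n = n div (m n ^ 3 + m n ^ 2)" for n
  define V where "V l = (\<integral>w. (\<Sum>i\<in>{1..l ^ 3}. truncY (real l) i w)^2 \<partial>M)" for l :: nat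
  define r where "r n = real (k n) * V (m n) / real n" for n
  \<comment> \<open>A majorant of the bound in \<open>char_bound\<close> in terms of the block
    parameter alone; 16384 is 16 times 1024.\<close>
  define F where "F l = \<bar>u\<bar> * sqrt (2 * K * (tail_size (real l) + 3 / real l)) + 16384 * C * (1 / real l)
      + (\<bar>u\<bar> ^ 3 * K * (1 / real l) + u ^ 4 * K^2 * (1 / real l))" for l :: nat
  have lim1: "(\<lambda>l. 1 / real l) \<longlonglongrightarrow> 0" by (rule lim_1_over_n)
  have lim3: "(\<lambda>l. 3 / real l) \<longlonglongrightarrow> 0" using tendsto_mult_right_zero[OF lim1, of 3] by simp
  have "F \<longlonglongrightarrow> \<bar>u\<bar> * sqrt (2 * K * (0 + 0)) + 16384 * C * 0 + (\<bar>u\<bar> ^ 3 * K * 0 + u ^ 4 * K^2 * 0)"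
    unfolding F_def by (intro tendsto_intros tail_size_tendsto_0 lim1 lim3)
  then have F0: "(\<lambda>n. F (m n)) \<longlonglongrightarrow> 0"
    using filterlim_compose[OF _ mt, of F "nhds 0"] by simp
  have facts: "real (k n * m n ^ 2 + (m n ^ 3 + m n ^ 2)) / real n \<le> 3 / real (m n)"
      "real (m n) ^ 3 / real n \<le> 1 / real (m n)"
      "real (m n) * real (m n ^ 3) / sqrt (real n) \<le> 1 / real (m n)"
      "16 * \<alpha> (m n ^ 2) * real (k n) \<le> 16384 * C * (1 / real (m n))"
      "1 - 3 / real (m n) \<le> real (k n) * real (m n) ^ 3 / real n"
      "real (k n) * real (m n) ^ 3 / real n \<le> 1"
    if n: "1 \<le> n" for n
  proof -
    define x where "x = real (m n)"
    define y where "y = real n"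
    define \<kappa> where "\<kappa> = real (k n)"
    have x1: "1 \<le> x" and xy: "x ^ 10 \<le> y" and yx: "y \<le> 1024 * x ^ 10" and y1: "1 \<le> y"
      using mb[OF n] n by (auto simp: x_def y_def)
    have \<kappa>0: "0 \<le> \<kappa>" by (simp add: \<kappa>_def)
    have pq: "0 < m n ^ 3 + m n ^ 2" using mb(1)[OF n] by simp
    have "k n * (m n ^ 3 + m n ^ 2) \<le> n" "n < m n ^ 3 + m n ^ 2 + k n * (m n ^ 3 + m n ^ 2)"
      unfolding k_def using dividend_less_div_times[OF pq, of n] by (simp_all add: add.commute)
    then have kn: "\<kappa> * (x ^ 3 + x ^ 2) \<le> y" "y \<le> x ^ 3 + x ^ 2 + \<kappa> * (x ^ 3 + x ^ 2)"
      unfolding x_def y_def \<kappa>_def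
      by (simp_all only: of_nat_mult[symmetric] of_nat_add[symmetric] of_nat_power[symmetric] of_nat_le_iff)
    have x23: "0 \<le> x ^ 2" "0 \<le> x ^ 3" using x1 by simp_all
    have \<kappa>p: "\<kappa> * x ^ 3 \<le> y" using kn(1) mult_nonneg_nonneg[OF \<kappa>0 x23(1)] unfolding distrib_left by linarith
    have x4: "x ^ 4 \<le> y" using power_increasing[of 4 10 x] x1 xy by simp
    have x3: "x ^ 3 * x \<le> y" using x4 by (simp add: power_numeral_even power3_eq_cube power4_eq_xxxx mult_ac)
    have x2: "x ^ 2 * x \<le> x ^ 3 * x" using power_increasing[of 3 4 x] x1 by (simp add: power3_eq_cube power4_eq_xxxx power2_eq_square mult_ac)
    have g: "\<kappa> * x ^ 2 * x \<le> y" using \<kappa>p by (simp add: power2_eq_square power3_eq_cube mult_ac)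
    have gap: "(\<kappa> * x ^ 2 + (x ^ 3 + x ^ 2)) * x \<le> 3 * y"
      using g x3 x2 by (simp only: distrib_right)
    then have gap': "(\<kappa> * x ^ 2 + (x ^ 3 + x ^ 2)) / y \<le> 3 / x" using x1 y1 by (simp add: field_simps)
    then show "real (k n * m n ^ 2 + (m n ^ 3 + m n ^ 2)) / real n \<le> 3 / real (m n)"
      by (simp add: x_def y_def \<kappa>_def)
    show "real (m n) ^ 3 / real n \<le> 1 / real (m n)"
      using x3 x1 y1 unfolding x_def[symmetric] y_def[symmetric] by (simp add: field_simps)
    show "real (m n) * real (m n ^ 3) / sqrt (real n) \<le> 1 / real (m n)"
    proof -
      have "x ^ 5 \<le> sqrt y" using xy by (intro real_le_rsqrt) (simp add: power_mult[symmetric])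
      moreover have "x * x ^ 3 * x = x ^ 5" by (simp add: eval_nat_numeral)
      ultimately have "(x * x ^ 3) * x \<le> sqrt y" by simp
      then show ?thesis using x1 y1 unfolding of_nat_power x_def[symmetric] y_def[symmetric]
        by (simp add: field_simps)
    qed
    \<comment> \<open>The gap m^2 makes the mixing coefficient at most C / m^12, and the number of
      blocks is at most n, hence at most 1024 m^10; the product is of order m^-2.\<close>
    show "16 * \<alpha> (m n ^ 2) * real (k n) \<le> 16384 * C * (1 / real (m n))"
    proof -
      have "1 * \<kappa> \<le> x ^ 3 * \<kappa>" using x1 \<kappa>0 by (intro mult_right_mono) auto
      then have \<kappa>y: "\<kappa> \<le> 1024 * x ^ 10" using \<kappa>p yx by (simp add: mult.commute)
      have "\<alpha> (m n ^ 2) \<le> C / real (m n ^ 2) ^ 6"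
        using mb(1)[OF n] by (intro alpha_le_power) simp
      also have "real (m n ^ 2) ^ 6 = x ^ 12" by (simp add: x_def power_mult[symmetric])
      finally have "\<alpha> (m n ^ 2) * \<kappa> \<le> (C / x ^ 12) * (1024 * x ^ 10)"
        using \<kappa>y \<kappa>0 C_nonneg x1 by (intro mult_mono) auto
      also have "\<dots> = 1024 * C * (1 / x ^ 2)" using x1 by (simp add: field_simps power_add[symmetric])
      also have "\<dots> \<le> 1024 * C * (1 / x)"
        using C_nonneg x1 by (intro mult_left_mono divide_left_mono) (auto simp: power2_eq_square)
      finally show ?thesis by (simp add: x_def \<kappa>_def)
    qed
    have "y - \<kappa> * x ^ 3 \<le> \<kappa> * x ^ 2 + (x ^ 3 + x ^ 2)" using kn(2) by (simp add: algebra_simps)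
    then have "(y - \<kappa> * x ^ 3) / y \<le> 3 / x" using gap' y1 by (meson divide_right_mono order_trans zero_le_one)
    then show "1 - 3 / real (m n) \<le> real (k n) * real (m n) ^ 3 / real n"
      using y1 unfolding x_def[symmetric] y_def[symmetric] \<kappa>_def[symmetric] by (simp add: diff_divide_distrib)
    show "real (k n) * real (m n) ^ 3 / real n \<le> 1"
      using \<kappa>p y1 unfolding x_def[symmetric] y_def[symmetric] \<kappa>_def[symmetric] by simp
  qed
  have bound: "norm ((\<integral>w. iexp (u / sqrt (real n) * (\<Sum>i\<in>{1..n}. Y i w)) \<partial>M)
      - of_real (exp (- (u^2 / 2 * r n)))) \<le> F (m n)" if n: "1 \<le> n" for n
  proof -
    have m1: "1 \<le> m n ^ 3" "1 \<le> m n ^ 2" "0 < real (m n)" using mb(1)[OF n] by auto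
    have "norm ((\<integral>w. iexp (u / sqrt (real n) * (\<Sum>i\<in>{1..n}. Y i w)) \<partial>M)
      - of_real (exp (- (u^2 / 2 * r n))))
      \<le> \<bar>u\<bar> * sqrt (2 * K * (tail_size (real (m n)) + real (k n * m n ^ 2 + (m n ^ 3 + m n ^ 2)) / real n))
        + 16 * \<alpha> (m n ^ 2) * real (k n)
        + (\<bar>u\<bar> ^ 3 * K * (real (m n) * real (m n ^ 3) / sqrt (real n)) + u ^ 4 * K^2 * (real (m n ^ 3) / real n))"
      unfolding r_def k_def V_def by (rule char_bound[OF K m1(3,1,2) n])
    also have "\<dots> \<le> F (m n)"
      unfolding F_def
    proof (intro add_mono)
      show "\<bar>u\<bar> * sqrt (2 * K * (tail_size (real (m n)) + real (k n * m n ^ 2 + (m n ^ 3 + m n ^ 2)) / real n))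
        \<le> \<bar>u\<bar> * sqrt (2 * K * (tail_size (real (m n)) + 3 / real (m n)))"
        using facts(1)[OF n] K0 by (intro mult_left_mono real_sqrt_le_mono add_left_mono) auto
      show "\<bar>u\<bar> ^ 3 * K * (real (m n) * real (m n ^ 3) / sqrt (real n)) \<le> \<bar>u\<bar> ^ 3 * K * (1 / real (m n))"
        by (rule mult_left_mono[OF facts(3)[OF n]]) (use K0 in simp)
      show "u ^ 4 * K^2 * (real (m n ^ 3) / real n) \<le> u ^ 4 * K^2 * (1 / real (m n))"
        unfolding of_nat_power by (rule mult_left_mono[OF facts(2)[OF n]]) simp
    qed (rule facts(4)[OF n])
    finally show ?thesis .
  qed
  \<comment> \<open>The big blocks cover a proportion of the indices tending to 1, so
    \<open>r n\<close> behaves like the normalised second moment of a single big block.\<close>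
  have ratio: "(\<lambda>n. real (k n) * real (m n) ^ 3 / real n) \<longlonglongrightarrow> 1"
  proof (rule tendsto_sandwich)
    show "\<forall>\<^sub>F n in sequentially. 1 - 3 / real (m n) \<le> real (k n) * real (m n) ^ 3 / real n"
      "\<forall>\<^sub>F n in sequentially. real (k n) * real (m n) ^ 3 / real n \<le> 1"
      using facts(5,6) by (auto intro: eventually_sequentiallyI[of 1])
    have "(\<lambda>n. 1 - 3 / real (m n)) \<longlonglongrightarrow> 1 - 0"
      using filterlim_compose[OF lim3 mt] by (intro tendsto_intros)
    then show "(\<lambda>n. 1 - 3 / real (m n)) \<longlonglongrightarrow> 1" by simp
  qed simp
  have cube: "filterlim (\<lambda>l::nat. l ^ 3) at_top sequentially"
    by (rule filterlim_at_top_mono[OF filterlim_ident]) (auto intro!: eventually_sequentiallyI[of 1] self_le_power)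
  \<comment> \<open>Truncation does not alter the asymptotic variance, because its level grows
    together with the block.\<close>
  have "(\<lambda>l. V l / real (l ^ 3)) \<longlonglongrightarrow> long_run_variance M Y"
  proof (rule Lim_transform2[OF filterlim_compose[OF variance_limit cube]])
    have "(\<lambda>l. K * (tail_size (real l) + 2 * sqrt (tail_size (real l)))) \<longlonglongrightarrow> K * (0 + 2 * sqrt 0)"
      by (intro tendsto_intros tail_size_tendsto_0)
    then have 0: "(\<lambda>l. K * (tail_size (real l) + 2 * sqrt (tail_size (real l)))) \<longlonglongrightarrow> 0" by simp
    show "(\<lambda>l. (\<integral>w. (\<Sum>i\<in>{1..l ^ 3}. Y i w)^2 \<partial>M) / real (l ^ 3) - V l / real (l ^ 3)) \<longlonglongrightarrow> 0"
    proof (rule Lim_null_comparison[OF _ 0], rule eventually_sequentiallyI[of 1])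
      fix l :: nat assume "1 \<le> l"
      then show "norm ((\<integral>w. (\<Sum>i\<in>{1..l ^ 3}. Y i w)^2 \<partial>M) / real (l ^ 3) - V l / real (l ^ 3))
        \<le> K * (tail_size (real l) + 2 * sqrt (tail_size (real l)))"
        using truncated_variance_close[OF K, of "real l" "l ^ 3"]
        unfolding V_def real_norm_def by (subst abs_minus_commute) auto
    qed
  qed
  then have "(\<lambda>n. V (m n) / real (m n ^ 3)) \<longlonglongrightarrow> long_run_variance M Y"
    using filterlim_compose[OF _ mt] by blast
  from tendsto_mult[OF ratio this]
  have "(\<lambda>n. real (k n) * real (m n) ^ 3 / real n * (V (m n) / real (m n ^ 3))) \<longlonglongrightarrow> long_run_variance M Y"
    by simp
  moreover have "\<forall>\<^sub>F n in sequentially. real (k n) * real (m n) ^ 3 / real n * (V (m n) / real (m n ^ 3)) = r n"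
    using mb(1) by (intro eventually_sequentiallyI[of 1]) (fastforce simp: r_def)
  ultimately have r: "r \<longlonglongrightarrow> long_run_variance M Y" using Lim_transform_eventually by blast
  have "(\<lambda>n. of_real (exp (- (u^2 / 2 * r n))) :: complex) \<longlonglongrightarrow> of_real (exp (- (u^2 / 2 * long_run_variance M Y)))"
    by (intro tendsto_intros r)
  then show ?thesis
  proof (rule Lim_transform)
    show "(\<lambda>n. (\<integral>w. iexp (u / sqrt (real n) * (\<Sum>i\<in>{1..n}. Y i w)) \<partial>M)
      - of_real (exp (- (u^2 / 2 * r n)))) \<longlonglongrightarrow> 0"
      by (rule Lim_null_comparison[OF _ F0], rule eventually_sequentiallyI[of 1]) (rule bound)
  qed
qed

end

section \<open>Block sums\<close>

text \<open>Expand the variance of the mean. For each j at most three k belong to the same or an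
  adjacent block; each contributes at most 2, hence \<open>6 / real b\<close>. Any other pair is
  separated by a whole block of length l, hence \<open>4 * \<alpha> l\<close>. Boundedness of
  \<open>X\<close> makes up for the missing gap between neighbours.\<close>

lemma (in mixing_process) block_mean_deviation:
  fixes X :: "nat \<Rightarrow> 'a \<Rightarrow> real"
  assumes l: "1 \<le> l" and b: "1 \<le> b"
    and X: "\<And>j. j \<in> {1..b} \<Longrightarrow> X j \<in> borel_measurable (gen {(j - 1) * l + 1..j * l})"
    and Xb: "\<And>j w. \<bar>X j w\<bar> \<le> 1"
  shows "(\<integral>w. \<bar>(\<Sum>j\<in>{1..b}. X j w) / real b - (\<Sum>j\<in>{1..b}. (\<integral>w. X j w \<partial>M)) / real b\<bar> \<partial>M)
    \<le> sqrt (6 / real b + 4 * \<alpha> l)"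
proof -
  let ?a = "\<alpha> l"
  have sub: "subalgebra M (gen {(j - 1) * l + 1..j * l})" for j by (rule subalgebra_gen) auto
  have XM [measurable]: "X j \<in> borel_measurable M" if "j \<in> {1..b}" for j
    by (rule measurable_from_subalg[OF sub X[OF that]])
  have Xi: "integrable M (X j)" if "j \<in> {1..b}" for j
    using XM[OF that] Xb by (intro integrable_bounded[of _ 1]) auto
  have XXi: "integrable M (\<lambda>w. X j w * X k w)" if "j \<in> {1..b}" "k \<in> {1..b}" for j k
    using XM[OF that(1)] XM[OF that(2)] Xb
    by (intro integrable_bounded[of _ 1]) (auto simp: abs_mult intro!: mult_le_one)
  define E where "E j = (\<integral>w. X j w \<partial>M)" for j
  define c where "c j k = (\<integral>w. X j w * X k w \<partial>M) - E j * E k" for j k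
  have E1: "\<bar>E j\<bar> \<le> 1" if "j \<in> {1..b}" for j
    unfolding E_def using XM[OF that] Xb by (intro expectation_bounded) auto
  have c2: "\<bar>c j k\<bar> \<le> 2" if "j \<in> {1..b}" "k \<in> {1..b}" for j k
  proof -
    have "\<bar>\<integral>w. X j w * X k w \<partial>M\<bar> \<le> 1"
      using XM[OF that(1)] XM[OF that(2)] Xb
      by (intro expectation_bounded) (auto simp: abs_mult intro!: mult_le_one)
    moreover have "\<bar>E j * E k\<bar> \<le> 1" unfolding abs_mult using E1[OF that(1)] E1[OF that(2)] by (intro mult_le_one) auto
    ultimately show ?thesis unfolding c_def by linarith
  qed
  have far: "\<bar>c j k\<bar> \<le> 4 * ?a" if jk: "j \<in> {1..b}" "k \<in> {1..b}" "j + 2 \<le> k" for j k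
  proof -
    have "\<bar>c j k\<bar> \<le> 4 * 1 * 1 * ?a"
      unfolding c_def E_def
    proof (rule covariance_le_alpha[where m = "j * l"])
      show "1 \<le> j * l" using l jk by simp
      have mono: "gen_meas \<in> borel_measurable (gen J)"
        if "gen_meas \<in> borel_measurable (gen I)" "I \<subseteq> J" for gen_meas :: "'a \<Rightarrow> real" and I J
        using that(1)
      proof (rule measurable_from_subalg[rotated])
        show "subalgebra (gen J) (gen I)"
          unfolding subalgebra_def sets_gen generated_events_def
          using that(2) by (auto intro!: sigma_sets_mono')
      qed
      show "X j \<in> borel_measurable (gen {1..j * l})" by (rule mono[OF X[OF jk(1)]]) auto
      \<comment> \<open>Block k starts just after \<open>(k - 1) * l\<close>, at least l beyond the
        end of block j.\<close>
      have "l + j * l \<le> (k - 1) * l" using mult_right_mono[of "Suc j" "k - 1" l] jk by simp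
      then show "X k \<in> borel_measurable (gen {l + j * l..})"
        by (intro mono[OF X[OF jk(2)]]) auto
    qed (use Xb in auto)
    then show ?thesis by simp
  qed
  have sym: "c j k = c k j" for j k by (simp add: c_def mult.commute)
  have a0: "0 \<le> ?a" by (rule alpha_nonneg)
  have cb: "\<bar>c j k\<bar> \<le> 4 * ?a + (if k \<in> {j - 1..j + 1} then 2 else 0)"
    if jk: "j \<in> {1..b}" "k \<in> {1..b}" for j k
  proof (cases "k \<in> {j - 1..j + 1}")
    case True then show ?thesis using c2[OF jk] a0 by simp
  next
    case False
    then have "j + 2 \<le> k \<or> k + 2 \<le> j" by auto
    then show ?thesis using far[OF jk] far[OF jk(2,1)] sym[of j k] False by auto
  qed
  define D where "D w = (\<Sum>j\<in>{1..b}. X j w - E j)" for w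
  have Dsq: "(D w)^2 = (\<Sum>j\<in>{1..b}. \<Sum>k\<in>{1..b}. (X j w - E j) * (X k w - E k))" for w
    by (simp add: D_def power2_eq_square sum_product)
  have pr: "(X j w - E j) * (X k w - E k) = X j w * X k w - E k * X j w - E j * X k w + E j * E k" for j k w
    by (simp add: algebra_simps)
  have pi: "integrable M (\<lambda>w. (X j w - E j) * (X k w - E k))"
    and pe: "(\<integral>w. (X j w - E j) * (X k w - E k) \<partial>M) = c j k" if "j \<in> {1..b}" "k \<in> {1..b}" for j k
    unfolding pr using Xi[OF that(1)] Xi[OF that(2)] XXi[OF that]
    by (auto simp: c_def prob_space E_def[symmetric])
  have Di: "integrable M (\<lambda>w. (D w)^2)" unfolding Dsq using pi by (intro Bochner_Integration.integrable_sum) auto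
  have "(\<integral>w. (D w)^2 \<partial>M)
      = (\<Sum>j\<in>{1..b}. \<integral>w. (\<Sum>k\<in>{1..b}. (X j w - E j) * (X k w - E k)) \<partial>M)"
    unfolding Dsq by (intro Bochner_Integration.integral_sum Bochner_Integration.integrable_sum pi)
  also have "\<dots> = (\<Sum>j\<in>{1..b}. \<Sum>k\<in>{1..b}. \<integral>w. (X j w - E j) * (X k w - E k) \<partial>M)"
    by (intro sum.cong refl Bochner_Integration.integral_sum pi)
  also have "\<dots> = (\<Sum>j\<in>{1..b}. \<Sum>k\<in>{1..b}. c j k)"
    by (intro sum.cong refl pe)
  also have "\<dots> \<le> (\<Sum>j\<in>{1..b}. \<Sum>k\<in>{1..b}. 4 * ?a + (if k \<in> {j - 1..j + 1} then 2 else 0))"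
    using cb by (intro sum_mono) (meson abs_le_D1)
  also have "\<dots> = (\<Sum>j\<in>{1..b}. 4 * ?a * real b + (\<Sum>k\<in>{1..b}. if k \<in> {j - 1..j + 1} then 2 else 0))"
    by (simp add: sum.distrib mult.commute)
  also have "\<dots> \<le> (\<Sum>j\<in>{1..b}. 4 * ?a * real b + 6)"
  proof (intro sum_mono add_left_mono)
    fix j
    have "(\<Sum>k\<in>{1..b}. if k \<in> {j - 1..j + 1} then 2 else 0) = (\<Sum>k\<in>{1..b} \<inter> {j - 1..j + 1}. 2::real)"
      by (rule sum.inter_restrict[symmetric]) simp
    also have "\<dots> = 2 * real (card ({1..b} \<inter> {j - 1..j + 1}))" by (simp only: sum_constant mult.commute)
    also have "\<dots> \<le> 6"
    proof -
      have "card ({1..b} \<inter> {j - 1..j + 1}) \<le> card {j - 1..j + 1}" by (intro card_mono) auto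
      also have "\<dots> \<le> 3" by simp
      finally show ?thesis by linarith
    qed
    finally show "(\<Sum>k\<in>{1..b}. if k \<in> {j - 1..j + 1} then 2 else 0) \<le> (6::real)" .
  qed
  also have "\<dots> = (6 / real b + 4 * ?a) * (real b)^2"
    using b by (simp add: power2_eq_square field_simps)
  finally have ED: "(\<integral>w. (D w)^2 \<partial>M) \<le> (6 / real b + 4 * ?a) * (real b)^2" .
  have eq: "\<bar>(\<Sum>j\<in>{1..b}. X j w) / real b - (\<Sum>j\<in>{1..b}. (\<integral>w. X j w \<partial>M)) / real b\<bar> = \<bar>D w\<bar> / real b" for w
    by (simp add: D_def E_def sum_subtractf diff_divide_distrib[symmetric] abs_divide)
  have Dm: "D \<in> borel_measurable M" unfolding D_def by measurable
  have "(\<integral>w. \<bar>D w\<bar> \<partial>M) \<le> sqrt ((6 / real b + 4 * ?a) * (real b)^2)"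
    using expectation_abs_le_sqrt(2)[OF Dm Di] ED by (meson order_trans real_sqrt_le_mono)
  also have "\<dots> = sqrt (6 / real b + 4 * ?a) * real b" by (simp add: real_sqrt_mult)
  finally show ?thesis unfolding eq using b by (simp add: divide_le_eq)
qed

lemma (in mixing_process) weighted_Y_sum_bound:
  assumes K: "sum_bound K" and I: "finite I" "I \<subseteq> {1..}" and a: "\<And>i. i \<in> I \<Longrightarrow> \<bar>a i\<bar> \<le> A"
  shows "integrable M (\<lambda>w. (\<Sum>i\<in>I. a i * Y i w)^2)"
    and "(\<integral>w. (\<Sum>i\<in>I. a i * Y i w)^2 \<partial>M) \<le> K * A^2 * real (card I)"
proof -
  have "integrable M (\<lambda>w. (\<Sum>i\<in>I. a i * (Y i w - (\<integral>w. Y 1 w \<partial>M)))^2) \<and>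
      (\<integral>w. (\<Sum>i\<in>I. a i * (Y i w - (\<integral>w. Y 1 w \<partial>M)))^2 \<partial>M)
        \<le> K * A^2 * real (card I) * sqrt (\<integral>w. (Y 1 w)^2 \<partial>M)"
    by (rule K[unfolded sum_bound_def, THEN conjunct2, rule_format, of I a A "\<lambda>y. y"]) (use I a in auto)
  then show "integrable M (\<lambda>w. (\<Sum>i\<in>I. a i * Y i w)^2)"
    and "(\<integral>w. (\<Sum>i\<in>I. a i * Y i w)^2 \<partial>M) \<le> K * A^2 * real (card I)"
    unfolding mean_zero second_moment by simp_all
qed

text \<open>Continuity off \<open>D\<close> provides the local limit of the weights, the bound
  \<open>S\<close> the domination.\<close>

locale weighted_process = mixing_process +
  fixes \<sigma> :: "real \<Rightarrow> real" and D :: "real set" and S :: real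
  assumes finite_jumps: "finite D"
    and weight_bounded: "\<And>x. x \<in> {0..1} \<Longrightarrow> \<bar>\<sigma> x\<bar> \<le> S"
    and weight_continuous: "\<And>x. x \<in> {0<..<1} - D \<Longrightarrow> isCont \<sigma> x"
    and long_run_variance_pos: "0 < long_run_variance M Y"
begin

text \<open>The sample size is written \<open>l * b\<close>, so that block length and number of
  blocks can run through two unrelated sequences.\<close>

definition Z :: "nat \<Rightarrow> nat \<Rightarrow> nat \<Rightarrow> 'a \<Rightarrow> real" where
  "Z l b j w = (\<Sum>i = (j - 1) * l + 1..j * l. \<sigma> (real i / real (l * b)) * Y i w) / sqrt (real l)"

abbreviation \<kappa> :: real where "\<kappa> \<equiv> long_run_variance M Y"

lemma weight_measurable: "\<sigma> \<in> borel_measurable unit_lborel"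
  using finite_jumps weight_continuous by (rule measurable_unit_lborel_isCont)

lemmas mixture = mixture_char_measurable[OF weight_measurable less_imp_le[OF long_run_variance_pos] weight_bounded]
  mixture_char_bounds[OF weight_measurable less_imp_le[OF long_run_variance_pos] weight_bounded]
  mixture_kernel_integral[OF weight_measurable less_imp_le[OF long_run_variance_pos] weight_bounded]

lemma Z_measurable_gen: "Z l b j \<in> borel_measurable (gen {(j - 1) * l + 1..j * l})"
  unfolding Z_def[abs_def]
  by (intro borel_measurable_divide borel_measurable_sum borel_measurable_times Y_measurable_gen) auto

lemma Z_measurable [measurable]: "Z l b j \<in> borel_measurable M"
  by (rule measurable_from_subalg[OF subalgebra_gen Z_measurable_gen]) auto

lemma block_card: "1 \<le> j \<Longrightarrow> card {(j - 1) * l + 1..j * l} = l"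
  by (cases j) auto

lemma block_points:
  assumes "1 \<le> l" "j \<in> {1..b}" "i \<in> {(j - 1) * l + 1..j * l}"
  shows "real i / real (l * b) \<in> {0..1}" "(real j - 1) / real b \<le> real i / real (l * b)"
    "real i / real (l * b) \<le> real j / real b"
proof -
  have b: "0 < real b" "0 < real l" using assms by auto
  have "(j - 1) * l \<le> i" "i \<le> j * l" using assms by auto
  then have "real ((j - 1) * l) \<le> real i" "real i \<le> real (j * l)" by (simp_all only: of_nat_le_iff)
  then have *: "(real j - 1) * real l \<le> real i" "real i \<le> real j * real l"
    using assms by (simp_all add: of_nat_diff)
  show "(real j - 1) / real b \<le> real i / real (l * b)" "real i / real (l * b) \<le> real j / real b"
  proof -
    have eqs: "(real j - 1) / real b = ((real j - 1) * real l) / real (l * b)"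
      "real j / real b = (real j * real l) / real (l * b)" using b by simp_all
    show "(real j - 1) / real b \<le> real i / real (l * b)" "real i / real (l * b) \<le> real j / real b"
      unfolding eqs using * by (intro divide_right_mono; simp)+
  qed
  note le = this(2)
  have "real j / real b \<le> 1" using assms by simp
  with le have "real i / real (l * b) \<le> 1" by (rule order_trans)
  moreover have "0 \<le> real i / real (l * b)" by (intro divide_nonneg_nonneg) auto
  ultimately show "real i / real (l * b) \<in> {0..1}" by (simp only: atLeastAtMost_iff)
qed

lemma Z_second_moment:
  assumes K: "sum_bound K" and l: "1 \<le> l" and j: "j \<in> {1..b}"
  shows "integrable M (\<lambda>w. (Z l b j w)^2)" "(\<integral>w. (Z l b j w)^2 \<partial>M) \<le> K * S^2"
proof -
  let ?I = "{(j - 1) * l + 1..j * l}"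
  have bd: "\<forall>i\<in>?I. \<bar>\<sigma> (real i / real (l * b))\<bar> \<le> S"
    using block_points(1)[OF l j] weight_bounded by blast
  have I: "finite ?I" "?I \<subseteq> {1..}" by auto
  note * = weighted_Y_sum_bound[OF K I, of "\<lambda>i. \<sigma> (real i / real (l * b))" S, OF bd[rule_format]]
  have cI: "card ?I = l" using j by (intro block_card) simp
  have eq: "(Z l b j w)^2 = (\<Sum>i\<in>?I. \<sigma> (real i / real (l * b)) * Y i w)^2 / real l" for w
    unfolding Z_def by (simp add: power_divide)
  show "integrable M (\<lambda>w. (Z l b j w)^2)" unfolding eq using *(1) by simp
  show "(\<integral>w. (Z l b j w)^2 \<partial>M) \<le> K * S^2" unfolding eq using *(2) l unfolding cI by (simp add: divide_le_eq)
qed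

text \<open>Freezing the weights at v leaves a weighted sum with weights at most e. Its second
  moment is at most \<open>K * e^2 * real l\<close>, so dividing by the root of l removes the
  dependence on l. Stationarity moves the block to the start.\<close>

lemma Z_char_close:
  assumes K: "sum_bound K" and l: "1 \<le> l" and j: "j \<in> {1..b}"
    and e: "\<And>i. i \<in> {(j - 1) * l + 1..j * l} \<Longrightarrow> \<bar>\<sigma> (real i / real (l * b)) - v\<bar> \<le> e"
  shows "norm ((\<integral>w. iexp (t * Z l b j w) \<partial>M)
      - (\<integral>w. iexp ((t * v) / sqrt (real l) * (\<Sum>i\<in>{1..l}. Y i w)) \<partial>M)) \<le> \<bar>t\<bar> * (sqrt K * e)"
proof -
  let ?I = "{(j - 1) * l + 1..j * l}"
  have "(j - 1) * l + 1 \<in> ?I" using l j by (cases j) auto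
  then have e0: "0 \<le> e" using e by (meson abs_ge_zero order_trans)
  define R where "R w = (\<Sum>i\<in>?I. (\<sigma> (real i / real (l * b)) - v) * Y i w)" for w
  define W where "W w = (\<Sum>i\<in>?I. Y i w)" for w
  have Ym [measurable]: "Y i \<in> borel_measurable M" if "i \<in> ?I" for i using that Y_measurable[of i] by auto
  have [measurable]: "R \<in> borel_measurable M" "W \<in> borel_measurable M"
    unfolding R_def W_def by (intro borel_measurable_sum borel_measurable_times Ym; simp)+
  have I: "finite ?I" "?I \<subseteq> {1..}" by auto
  have cI: "card ?I = l" using j by (intro block_card) simp
  note R2 = weighted_Y_sum_bound[OF K I, of "\<lambda>i. \<sigma> (real i / real (l * b)) - v" e, OF e, folded R_def, unfolded cI]
  have "(\<integral>w. \<bar>R w\<bar> \<partial>M) \<le> sqrt (K * e^2 * real l)"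
    using expectation_abs_le_sqrt(2)[OF _ R2(1)] R2(2) by (meson \<open>R \<in> borel_measurable M\<close> order_trans real_sqrt_le_mono)
  also have "\<dots> = sqrt K * e * sqrt (real l)" using e0 by (simp add: real_sqrt_mult)
  finally have R1: "(\<integral>w. \<bar>R w\<bar> \<partial>M) \<le> sqrt K * e * sqrt (real l)" .
  have Ri: "integrable M R" using expectation_abs_le_sqrt(1)[OF _ R2(1)] by simp
  have shift: "?I = {1 + (j - 1) * l..l + (j - 1) * l}" using j by (cases j) auto
  have "(\<integral>w. iexp ((t * v) / sqrt (real l) * (\<Sum>i\<in>{1..l}. Y i w)) \<partial>M)
      = (\<integral>w. iexp ((t * v) / sqrt (real l) * (\<Sum>i\<in>{1..l}. Y (i + (j - 1) * l) w)) \<partial>M)"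
    by (rule stationary_block_sum[of "\<lambda>y. y" "\<lambda>s. iexp ((t * v) / sqrt (real l) * s)", symmetric]) auto
  also have "\<dots> = (\<integral>w. iexp ((t * v) / sqrt (real l) * W w) \<partial>M)"
    unfolding W_def shift sum.shift_bounds_cl_nat_ivl ..
  finally have stat: "(\<integral>w. iexp ((t * v) / sqrt (real l) * (\<Sum>i\<in>{1..l}. Y i w)) \<partial>M)
    = (\<integral>w. iexp ((t * v) / sqrt (real l) * W w) \<partial>M)" .
  have i1: "integrable M (\<lambda>w. iexp (t * Z l b j w))" by (intro iexp_integrable) measurable
  have i2: "integrable M (\<lambda>w. iexp ((t * v) / sqrt (real l) * W w))" by (intro iexp_integrable) measurable
  have diff: "t * Z l b j w - (t * v) / sqrt (real l) * W w = (t / sqrt (real l)) * R w" for w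
  proof -
    have "R w = (\<Sum>i\<in>?I. \<sigma> (real i / real (l * b)) * Y i w) - v * W w"
      by (simp add: R_def W_def left_diff_distrib sum_subtractf sum_distrib_left)
    then show ?thesis unfolding Z_def by (simp add: right_diff_distrib diff_divide_distrib)
  qed
  have "(\<integral>w. iexp (t * Z l b j w) \<partial>M) - (\<integral>w. iexp ((t * v) / sqrt (real l) * W w) \<partial>M)
      = (\<integral>w. iexp (t * Z l b j w) - iexp ((t * v) / sqrt (real l) * W w) \<partial>M)"
    by (rule Bochner_Integration.integral_diff[OF i1 i2, symmetric])
  also have "norm \<dots> \<le> (\<integral>w. norm (iexp (t * Z l b j w) - iexp ((t * v) / sqrt (real l) * W w)) \<partial>M)"
    by (rule integral_norm_bound)
  also have "\<dots> \<le> (\<integral>w. \<bar>t / sqrt (real l)\<bar> * \<bar>R w\<bar> \<partial>M)"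
  proof (rule integral_mono)
    show "integrable M (\<lambda>w. norm (iexp (t * Z l b j w) - iexp ((t * v) / sqrt (real l) * W w)))"
      by (intro integrable_norm Bochner_Integration.integrable_diff i1 i2)
    show "integrable M (\<lambda>w. \<bar>t / sqrt (real l)\<bar> * \<bar>R w\<bar>)" using Ri by simp
    show "norm (iexp (t * Z l b j w) - iexp ((t * v) / sqrt (real l) * W w)) \<le> \<bar>t / sqrt (real l)\<bar> * \<bar>R w\<bar>" for w
      using norm_iexp_diff_le[of "t * Z l b j w" "(t * v) / sqrt (real l) * W w"]
      unfolding diff abs_mult .
  qed
  also have "\<dots> = \<bar>t / sqrt (real l)\<bar> * (\<integral>w. \<bar>R w\<bar> \<partial>M)" by simp
  also have "\<dots> \<le> \<bar>t / sqrt (real l)\<bar> * (sqrt K * e * sqrt (real l))" using R1 by (rule mult_left_mono) simp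
  also have "\<dots> = \<bar>t\<bar> * (sqrt K * e)" using l by (simp add: abs_divide)
  finally show ?thesis unfolding stat .
qed

text \<open>Block \<open>nat \<lceil>real (b n) * x\<rceil>\<close> has all its design points within
  1 / b of x. At a continuity point the weights of the block become constant, and
  \<open>char_convergence\<close> applies with argument \<open>t * \<sigma> x\<close>.\<close>

lemma Z_char_limit:
  fixes l b :: "nat \<Rightarrow> nat"
  assumes l: "filterlim l at_top sequentially" and b: "filterlim b at_top sequentially"
    and x: "x \<in> {0<..<1} - D"
  shows "(\<lambda>n. \<integral>w. iexp (t * Z (l n) (b n) (nat \<lceil>real (b n) * x\<rceil>) w) \<partial>M)
    \<longlonglongrightarrow> of_real (exp (- (t^2 / 2 * (\<kappa> * (\<sigma> x)^2))))"
proof -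
  obtain K where K: "sum_bound K" using sum_bound_exists by blast
  then have K0: "0 \<le> K" by (simp add: sum_bound_def)
  define \<psi> where "\<psi> n = (\<integral>w. iexp ((t * \<sigma> x) / sqrt (real (l n)) * (\<Sum>i\<in>{1..l n}. Y i w)) \<partial>M)" for n
  define \<zeta> where "\<zeta> n = (\<integral>w. iexp (t * Z (l n) (b n) (nat \<lceil>real (b n) * x\<rceil>) w) \<partial>M)" for n
  have "\<psi> \<longlonglongrightarrow> of_real (exp (- ((t * \<sigma> x)^2 / 2 * \<kappa>)))"
    unfolding \<psi>_def[abs_def] by (rule filterlim_compose[OF char_convergence l])
  also have "(t * \<sigma> x)^2 / 2 * \<kappa> = t^2 / 2 * (\<kappa> * (\<sigma> x)^2)" by (simp add: power_mult_distrib)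
  finally have \<psi>: "\<psi> \<longlonglongrightarrow> of_real (exp (- (t^2 / 2 * (\<kappa> * (\<sigma> x)^2))))" .
  have "(\<lambda>n. \<zeta> n - \<psi> n) \<longlonglongrightarrow> 0"
  proof (rule tendstoI)
    fix r :: real assume r: "0 < r"
    \<comment> \<open>The added 1 avoids a zero denominator when t or K vanishes.\<close>
    define e where "e = r / (2 * (\<bar>t\<bar> * sqrt K + 1))"
    have q: "0 < \<bar>t\<bar> * sqrt K + 1" using K0 by (simp add: add_nonneg_pos)
    have e: "0 < e" using r q by (simp add: e_def)
    have er: "\<bar>t\<bar> * (sqrt K * e) < r"
    proof -
      have "\<bar>t\<bar> * (sqrt K * e) \<le> (\<bar>t\<bar> * sqrt K + 1) * e" using e by (simp add: algebra_simps)
      also have "\<dots> = r / 2"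
      proof -
        have "A * (r / (2 * A)) = r / 2" if "0 < A" for A :: real using that by simp
        then show ?thesis unfolding e_def using q .
      qed
      finally show ?thesis using r by simp
    qed
    have "isCont \<sigma> x" by (rule weight_continuous[OF x])
    then obtain d where d: "0 < d" "\<And>y. dist y x < d \<Longrightarrow> dist (\<sigma> y) (\<sigma> x) < e"
      using e unfolding continuous_at_eps_delta by (metis dist_real_def real_norm_def)
    obtain N :: nat where N: "1 / d < real N" using reals_Archimedean2 by blast
    have "\<forall>\<^sub>F n in sequentially. 1 \<le> l n" using l by (auto simp: filterlim_at_top)
    moreover have "\<forall>\<^sub>F n in sequentially. max 1 N \<le> b n" using b unfolding filterlim_at_top by blast
    ultimately show "\<forall>\<^sub>F n in sequentially. dist (\<zeta> n - \<psi> n) 0 < r"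
    proof eventually_elim
      case (elim n)
      define j where "j = nat \<lceil>real (b n) * x\<rceil>"
      have b0: "0 < real (b n)" "1 / d < real (b n)" using elim N by auto
      have bx: "0 < real (b n) * x" "real (b n) * x \<le> real (b n)" using b0 x by (auto simp: mult_left_le)
      have jx: "real j - 1 < real (b n) * x" "real (b n) * x \<le> real j"
        unfolding j_def using bx(1) by linarith+
      have "\<lceil>real (b n) * x\<rceil> \<le> int (b n)" using bx(2) by (simp add: ceiling_le_iff)
      then have jb: "j \<in> {1..b n}" using jx bx unfolding j_def by auto linarith
      have db: "1 / real (b n) < d" using b0 d(1) by (simp add: field_simps)
      have "\<bar>\<sigma> (real i / real (l n * b n)) - \<sigma> x\<bar> \<le> e" if i: "i \<in> {(j - 1) * l n + 1..j * l n}" for i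
      proof -
        note bp = block_points[OF elim(1) jb i]
        have xb: "(real j - 1) / real (b n) \<le> x" "x \<le> real j / real (b n)"
          using jx b0 by (auto simp: field_simps)
        have "(real j - 1) / real (b n) = real j / real (b n) - 1 / real (b n)" by (simp add: diff_divide_distrib)
        then have "\<bar>real i / real (l n * b n) - x\<bar> \<le> 1 / real (b n)" using bp(2,3) xb by linarith
        then have "dist (real i / real (l n * b n)) x < d" using db by (simp add: dist_real_def)
        from d(2)[OF this] show ?thesis by (simp add: dist_real_def)
      qed
      from Z_char_close[OF K elim(1) jb this, of t]
      have "norm (\<zeta> n - \<psi> n) \<le> \<bar>t\<bar> * (sqrt K * e)" by (simp add: \<zeta>_def \<psi>_def j_def)
      then show ?case using er by simp
    qed
  qed
  from tendsto_add[OF this \<psi>] show ?thesis by (simp add: \<zeta>_def)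
qed

text \<open>The mean over blocks is the integral of a step function. Its pointwise limits hold off
  the jumps and the two endpoints, a null set, and characteristic functions are bounded by
  1.\<close>

lemma mean_char_limit:
  fixes l b :: "nat \<Rightarrow> nat"
  assumes l: "filterlim l at_top sequentially" and b: "filterlim b at_top sequentially"
  shows "(\<lambda>n. (1 / real (b n)) *\<^sub>R (\<Sum>j\<in>{1..b n}. \<integral>w. iexp (t * Z (l n) (b n) j w) \<partial>M))
    \<longlonglongrightarrow> of_real (mixture_char \<sigma> \<kappa> t)"
proof -
  interpret U: prob_space unit_lborel by (rule prob_space_unit_lborel)
  define g where "g n j = (\<integral>w. iexp (t * Z (l n) (b n) j w) \<partial>M)" for n j
  have g1: "norm (g n j) \<le> 1" for n j unfolding g_def by (intro iexp_expectation_le_1) measurable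
  \<comment> \<open>Ensures at least one block for every n, as \<open>step_integral\<close>
    requires; eventually nothing changes.\<close>
  define b' where "b' n = max 1 (b n)" for n
  have ev: "\<forall>\<^sub>F n in sequentially. b' n = b n"
    using b unfolding filterlim_at_top b'_def by (metis (mono_tags, lifting) eventually_mono max.absorb2)
  have b'1: "1 \<le> b' n" for n by (simp add: b'_def)
  have "(\<lambda>n. \<integral>x. g n (nat \<lceil>real (b' n) * x\<rceil>) \<partial>unit_lborel)
      \<longlonglongrightarrow> (\<integral>x. complex_of_real (exp (- (t^2 / 2 * (\<kappa> * (\<sigma> x)^2)))) \<partial>unit_lborel)"
  proof (rule integral_dominated_convergence[where w = "\<lambda>_. 1"])
    show "(\<lambda>x. complex_of_real (exp (- (t^2 / 2 * (\<kappa> * (\<sigma> x)^2))))) \<in> borel_measurable unit_lborel"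
      using weight_measurable by measurable
    show "(\<lambda>x. g n (nat \<lceil>real (b' n) * x\<rceil>)) \<in> borel_measurable unit_lborel" for n
      by (intro measurable_unit_lborel step_integral(1) b'1)
    have "finite (D \<union> {0, 1})" using finite_jumps by simp
    from AE_unit_lborel_finite[OF this] AE_space[of unit_lborel]
    show "AE x in unit_lborel. (\<lambda>n. g n (nat \<lceil>real (b' n) * x\<rceil>))
        \<longlonglongrightarrow> of_real (exp (- (t^2 / 2 * (\<kappa> * (\<sigma> x)^2))))"
    proof eventually_elim
      case (elim x)
      then have "x \<in> {0<..<1} - D" by auto
      from Z_char_limit[OF l b this, of t] show ?case unfolding g_def
      proof (rule Lim_transform_eventually)
        show "\<forall>\<^sub>F n in sequentially. (\<integral>w. iexp (t * Z (l n) (b n) (nat \<lceil>real (b n) * x\<rceil>) w) \<partial>M)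
          = (\<integral>w. iexp (t * Z (l n) (b n) (nat \<lceil>real (b' n) * x\<rceil>) w) \<partial>M)"
          using ev by eventually_elim simp
      qed
    qed
  qed (use g1 in auto)
  also have "(\<integral>x. complex_of_real (exp (- (t^2 / 2 * (\<kappa> * (\<sigma> x)^2)))) \<partial>unit_lborel) = of_real (mixture_char \<sigma> \<kappa> t)"
    unfolding mixture_char_def by (rule integral_complex_of_real)
  also have "(\<lambda>n. \<integral>x. g n (nat \<lceil>real (b' n) * x\<rceil>) \<partial>unit_lborel)
      = (\<lambda>n. (1 / real (b' n)) *\<^sub>R (\<Sum>j\<in>{1..b' n}. g n j))"
    by (intro ext step_integral(2) b'1)
  finally show ?thesis
    by (rule Lim_transform_eventually) (use ev in eventually_elim, simp add: g_def)
qed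

end

section \<open>The kernel representation\<close>

context weighted_process begin

definition mean_cos :: "nat \<Rightarrow> nat \<Rightarrow> real \<Rightarrow> 'a \<Rightarrow> real" where
  "mean_cos l b t w = (\<Sum>j\<in>{1..b}. cos (t * Z l b j w)) / real b"

definition mean_sin :: "nat \<Rightarrow> nat \<Rightarrow> real \<Rightarrow> 'a \<Rightarrow> real" where
  "mean_sin l b t w = (\<Sum>j\<in>{1..b}. sin (t * Z l b j w)) / real b"

text \<open>One minus the squared modulus of the empirical characteristic function of the blocks.
  Real and imaginary parts are kept apart so that \<open>block_mean_deviation\<close> applies to
  each.\<close>

definition char_defect :: "nat \<Rightarrow> nat \<Rightarrow> real \<Rightarrow> 'a \<Rightarrow> real" where
  "char_defect l b t w = 1 - ((mean_cos l b t w)^2 + (mean_sin l b t w)^2)"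

definition limit_defect :: "real \<Rightarrow> real" where
  "limit_defect t = 1 - (mixture_char \<sigma> \<kappa> t)^2"

abbreviation expected_defect :: "nat \<Rightarrow> nat \<Rightarrow> real \<Rightarrow> real" where
  "expected_defect l b t \<equiv> (\<integral>w. \<bar>char_defect l b t w - limit_defect t\<bar> \<partial>M)"

lemma mean_measurable [measurable]:
  "mean_cos l b t \<in> borel_measurable M" "mean_sin l b t \<in> borel_measurable M"
  unfolding mean_cos_def[abs_def] mean_sin_def[abs_def] by measurable

lemma mean_bounds: "\<bar>mean_cos l b t w\<bar> \<le> 1" "\<bar>mean_sin l b t w\<bar> \<le> 1"
proof -
  have *: "\<bar>(\<Sum>j\<in>{1..b}. f j) / real b\<bar> \<le> 1" if "\<And>j. \<bar>f j\<bar> \<le> 1" for f :: "nat \<Rightarrow> real"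
  proof -
    have "\<bar>\<Sum>j\<in>{1..b}. f j\<bar> \<le> (\<Sum>j\<in>{1..b}. 1)" by (rule sum_abs[THEN order_trans]) (intro sum_mono that)
    then show ?thesis by (cases "b = 0") (auto simp: abs_divide divide_le_eq)
  qed
  show "\<bar>mean_cos l b t w\<bar> \<le> 1" "\<bar>mean_sin l b t w\<bar> \<le> 1"
    unfolding mean_cos_def mean_sin_def by (rule *; simp)+
qed

lemma char_defect_eq:
  assumes "1 \<le> b"
  shows "char_defect l b t w
    = (\<Sum>j\<in>{1..b}. \<Sum>k\<in>{1..b}. 1 - cos (t * (Z l b j w - Z l b k w))) / (real b)^2"
proof -
  let ?C = "\<lambda>j. cos (t * Z l b j w)" and ?S = "\<lambda>j. sin (t * Z l b j w)"
  have "(\<Sum>j\<in>{1..b}. \<Sum>k\<in>{1..b}. cos (t * (Z l b j w - Z l b k w)))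
      = (\<Sum>j\<in>{1..b}. \<Sum>k\<in>{1..b}. ?C j * ?C k) + (\<Sum>j\<in>{1..b}. \<Sum>k\<in>{1..b}. ?S j * ?S k)"
    by (simp only: right_diff_distrib cos_diff sum.distrib)
  also have "\<dots> = (\<Sum>j\<in>{1..b}. ?C j)^2 + (\<Sum>j\<in>{1..b}. ?S j)^2"
    by (simp only: power2_eq_square sum_product)
  finally have "(\<Sum>j\<in>{1..b}. \<Sum>k\<in>{1..b}. 1 - cos (t * (Z l b j w - Z l b k w)))
      = (real b)^2 - ((\<Sum>j\<in>{1..b}. ?C j)^2 + (\<Sum>j\<in>{1..b}. ?S j)^2)"
    by (simp add: sum_subtractf power2_eq_square)
  then show ?thesis
    using assms by (simp add: char_defect_def mean_cos_def mean_sin_def power_divide diff_divide_distrib add_divide_distrib)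
qed

lemma char_defect_bounds:
  assumes "1 \<le> b" shows "0 \<le> char_defect l b t w" "char_defect l b t w \<le> 1"
    "char_defect l b t w \<le> t^2 * ((\<Sum>j\<in>{1..b}. \<Sum>k\<in>{1..b}. (Z l b j w)^2 + (Z l b k w)^2) / (real b)^2)"
proof -
  show "0 \<le> char_defect l b t w" unfolding char_defect_eq[OF assms]
    by (intro divide_nonneg_nonneg sum_nonneg) auto
  show "char_defect l b t w \<le> 1" by (simp add: char_defect_def)
  have "1 - cos (t * (x - y)) \<le> t^2 * (x^2 + y^2)" for x y :: real
  proof -
    have "1 - cos (t * (x - y)) \<le> t^2 * (x - y)^2 / 2"
      using one_minus_cos_le[of "t * (x - y)"] by (simp add: power_mult_distrib)
    also have "\<dots> \<le> t^2 * (2 * (x^2 + y^2)) / 2"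
    proof (intro divide_right_mono mult_left_mono)
      show "(x - y)^2 \<le> 2 * (x^2 + y^2)"
        using sum_squares_bound[of x "- y"] by (simp add: power2_diff)
    qed auto
    also have "\<dots> = t^2 * (x^2 + y^2)" by simp
    finally show ?thesis .
  qed
  then have "(\<Sum>j\<in>{1..b}. \<Sum>k\<in>{1..b}. 1 - cos (t * (Z l b j w - Z l b k w))) / (real b)^2
      \<le> (\<Sum>j\<in>{1..b}. \<Sum>k\<in>{1..b}. t^2 * ((Z l b j w)^2 + (Z l b k w)^2)) / (real b)^2"
    by (intro divide_right_mono sum_mono) auto
  then show "char_defect l b t w \<le> t^2 * ((\<Sum>j\<in>{1..b}. \<Sum>k\<in>{1..b}. (Z l b j w)^2 + (Z l b k w)^2) / (real b)^2)"
    unfolding char_defect_eq[OF assms] by (simp only: sum_distrib_left times_divide_eq_right)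
qed

lemma char_defect_integral:
  assumes "1 \<le> b"
  shows "integrable lborel (\<lambda>t. char_defect l b t w / t^2)"
    and "(\<integral>t. char_defect l b t w / t^2 \<partial>lborel)
      = cos_const * ((\<Sum>j\<in>{1..b}. \<Sum>k\<in>{1..b}. \<bar>Z l b j w - Z l b k w\<bar>) / (real b)^2)"
proof -
  have eq: "char_defect l b t w / t^2
      = (\<Sum>j\<in>{1..b}. \<Sum>k\<in>{1..b}. cos_kernel (Z l b j w - Z l b k w) t) / (real b)^2" for t
    unfolding char_defect_eq[OF assms] cos_kernel_def by (simp add: sum_divide_distrib mult.commute)
  have i: "integrable lborel (\<lambda>t. \<Sum>k\<in>{1..b}. cos_kernel (Z l b j w - Z l b k w) t)" for j
    by (intro Bochner_Integration.integrable_sum cos_kernel_integrable)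
  have "(\<integral>t. (\<Sum>j\<in>{1..b}. \<Sum>k\<in>{1..b}. cos_kernel (Z l b j w - Z l b k w) t) \<partial>lborel)
      = (\<Sum>j\<in>{1..b}. \<integral>t. (\<Sum>k\<in>{1..b}. cos_kernel (Z l b j w - Z l b k w) t) \<partial>lborel)"
    by (intro Bochner_Integration.integral_sum i)
  also have "\<dots> = (\<Sum>j\<in>{1..b}. \<Sum>k\<in>{1..b}. \<integral>t. cos_kernel (Z l b j w - Z l b k w) t \<partial>lborel)"
    by (intro sum.cong refl Bochner_Integration.integral_sum cos_kernel_integrable)
  also have "\<dots> = cos_const * (\<Sum>j\<in>{1..b}. \<Sum>k\<in>{1..b}. \<bar>Z l b j w - Z l b k w\<bar>)"
    by (simp only: integral_cos_kernel sum_distrib_left mult.commute)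
  finally show "(\<integral>t. char_defect l b t w / t^2 \<partial>lborel)
      = cos_const * ((\<Sum>j\<in>{1..b}. \<Sum>k\<in>{1..b}. \<bar>Z l b j w - Z l b k w\<bar>) / (real b)^2)"
    unfolding eq by simp
  show "integrable lborel (\<lambda>t. char_defect l b t w / t^2)"
    unfolding eq by (intro integrable_divide Bochner_Integration.integrable_sum i)
qed

lemma limit_defect_bounds: "0 \<le> limit_defect t" "limit_defect t \<le> 1" "limit_defect t \<le> \<kappa> * S^2 * t^2"
  using mixture(2-4)[of t] unfolding limit_defect_def by (auto simp: power_le_one)

lemma char_defect_measurable [measurable]:
  "(\<lambda>p. char_defect l b (f p) (g p)) \<in> borel_measurable N"
  if [measurable]: "f \<in> borel_measurable N" "g \<in> measurable N M"
  unfolding char_defect_def mean_cos_def mean_sin_def by measurable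

lemma limit_defect_measurable [measurable]: "limit_defect \<in> borel_measurable borel"
  unfolding limit_defect_def[abs_def] using mixture(1) by measurable

text \<open>The majorant is free of l and b. Near 0 it rests on \<open>2 * K * S^2\<close>, the
  second moments of a pair of blocks, and on \<open>\<kappa> * S^2\<close> for the limit; the 2
  bounds two defects with values in [0, 1].\<close>

lemma expected_defect_dominated:
  assumes K: "sum_bound K" and l: "1 \<le> l" and b: "1 \<le> b"
  shows "expected_defect l b t / t^2 \<le> (2 * K * S^2 + \<kappa> * S^2 + 2) / (1 + t^2)"
    and "integrable M (\<lambda>w. \<bar>char_defect l b t w - limit_defect t\<bar>)"
proof -
  have K0: "0 \<le> K" using K by (simp add: sum_bound_def)
  have ci: "integrable M (char_defect l b t)"
    using char_defect_bounds(1,2)[OF b] by (intro integrable_bounded[of _ 1]) (auto simp: abs_le_iff)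
  show di: "integrable M (\<lambda>w. \<bar>char_defect l b t w - limit_defect t\<bar>)" using ci by simp
  have d1: "\<bar>char_defect l b t w - limit_defect t\<bar> \<le> char_defect l b t w + limit_defect t" for w
    using char_defect_bounds(1)[OF b, of l t w] limit_defect_bounds(1)[of t] by linarith
  have "expected_defect l b t \<le> (\<integral>w. char_defect l b t w + limit_defect t \<partial>M)"
    using ci by (intro integral_mono di d1) auto
  also have "\<dots> = (\<integral>w. char_defect l b t w \<partial>M) + limit_defect t"
    using ci by (simp add: prob_space)
  finally have e: "expected_defect l b t \<le> (\<integral>w. char_defect l b t w \<partial>M) + limit_defect t" .
  have "(\<integral>w. char_defect l b t w \<partial>M) \<le> (\<integral>w. 1 \<partial>M)"
    using ci char_defect_bounds(2)[OF b] by (intro integral_mono) auto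
  then have c1: "(\<integral>w. char_defect l b t w \<partial>M) \<le> 1" by (simp add: prob_space)
  note z = Z_second_moment[OF K l]
  have zi: "integrable M (\<lambda>w. \<Sum>j\<in>{1..b}. \<Sum>k\<in>{1..b}. (Z l b j w)^2 + (Z l b k w)^2)"
    by (intro Bochner_Integration.integrable_sum Bochner_Integration.integrable_add z)
  have "(\<integral>w. char_defect l b t w \<partial>M)
      \<le> (\<integral>w. t^2 * ((\<Sum>j\<in>{1..b}. \<Sum>k\<in>{1..b}. (Z l b j w)^2 + (Z l b k w)^2) / (real b)^2) \<partial>M)"
    using ci zi char_defect_bounds(3)[OF b] by (intro integral_mono integrable_mult_right integrable_divide)
  also have "\<dots> = t^2 * ((\<integral>w. (\<Sum>j\<in>{1..b}. \<Sum>k\<in>{1..b}. (Z l b j w)^2 + (Z l b k w)^2) \<partial>M) / (real b)^2)" by simp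
  also have "(\<integral>w. (\<Sum>j\<in>{1..b}. \<Sum>k\<in>{1..b}. (Z l b j w)^2 + (Z l b k w)^2) \<partial>M)
      = (\<Sum>j\<in>{1..b}. \<integral>w. (\<Sum>k\<in>{1..b}. (Z l b j w)^2 + (Z l b k w)^2) \<partial>M)"
    by (intro Bochner_Integration.integral_sum Bochner_Integration.integrable_sum Bochner_Integration.integrable_add z)
  also have "\<dots> = (\<Sum>j\<in>{1..b}. \<Sum>k\<in>{1..b}. \<integral>w. (Z l b j w)^2 + (Z l b k w)^2 \<partial>M)"
    by (intro sum.cong refl Bochner_Integration.integral_sum Bochner_Integration.integrable_add z)
  also have "\<dots> \<le> (\<Sum>j\<in>{1..b}. \<Sum>k\<in>{1..b}. 2 * (K * S^2))"
  proof (intro sum_mono)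
    fix j k assume jk: "j \<in> {1..b}" "k \<in> {1..b}"
    have "(\<integral>w. (Z l b j w)^2 + (Z l b k w)^2 \<partial>M) = (\<integral>w. (Z l b j w)^2 \<partial>M) + (\<integral>w. (Z l b k w)^2 \<partial>M)"
      by (intro Bochner_Integration.integral_add z jk)
    then show "(\<integral>w. (Z l b j w)^2 + (Z l b k w)^2 \<partial>M) \<le> 2 * (K * S^2)"
      using z(2)[OF jk(1)] z(2)[OF jk(2)] by linarith
  qed
  also have "(\<Sum>j\<in>{1..b}. \<Sum>k\<in>{1..b}. 2 * (K * S^2)) = (2 * K * S^2) * (real b)^2"
    by (simp add: power2_eq_square)
  finally have "(\<integral>w. char_defect l b t w \<partial>M) \<le> t^2 * ((2 * K * S^2) * (real b)^2 / (real b)^2)"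
    by (simp add: mult_left_mono divide_right_mono)
  then have c2: "(\<integral>w. char_defect l b t w \<partial>M) \<le> 2 * K * S^2 * t^2" using b by (simp add: mult_ac)
  show "expected_defect l b t / t^2 \<le> (2 * K * S^2 + \<kappa> * S^2 + 2) / (1 + t^2)"
  proof (rule kernel_dominated)
    show "expected_defect l b t \<le> 2"
      using e c1 limit_defect_bounds(2)[of t] by linarith
    show "expected_defect l b t \<le> (2 * K * S^2 + \<kappa> * S^2) * t^2"
      using e c2 limit_defect_bounds(3)[of t] by (simp only: distrib_right)
    show "0 \<le> 2 * K * S^2 + \<kappa> * S^2" using K0 long_run_variance_pos by simp
  qed simp
qed

text \<open>The random means concentrate around their expectations by
  \<open>block_mean_deviation\<close>, and the expectations converge by
  \<open>mean_char_limit\<close>. The limit is real, so the sine means vanish.\<close>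

lemma expected_defect_limit:
  fixes l b :: "nat \<Rightarrow> nat"
  assumes l: "filterlim l at_top sequentially" and b: "filterlim b at_top sequentially"
  shows "(\<lambda>n. expected_defect (l n) (b n) t) \<longlonglongrightarrow> 0"
proof -
  define \<phi> where "\<phi> = mixture_char \<sigma> \<kappa> t"
  have \<phi>: "0 \<le> \<phi>" "\<phi> \<le> 1" using mixture(2,3)[of t] by (auto simp: \<phi>_def)
  define EC where "EC n = (\<Sum>j\<in>{1..b n}. \<integral>w. cos (t * Z (l n) (b n) j w) \<partial>M) / real (b n)" for n
  define ES where "ES n = (\<Sum>j\<in>{1..b n}. \<integral>w. sin (t * Z (l n) (b n) j w) \<partial>M) / real (b n)" for n
  define G where "G n = (1 / real (b n)) *\<^sub>R (\<Sum>j\<in>{1..b n}. \<integral>w. iexp (t * Z (l n) (b n) j w) \<partial>M)" for n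
  have G: "G \<longlonglongrightarrow> of_real \<phi>" unfolding G_def \<phi>_def by (rule mean_char_limit[OF l b])
  have i: "integrable M (\<lambda>w. iexp (t * Z l b j w))" for l b j by (intro iexp_integrable) measurable
  have "Re (\<integral>w. iexp (t * Z l b j w) \<partial>M) = (\<integral>w. cos (t * Z l b j w) \<partial>M)"
    "Im (\<integral>w. iexp (t * Z l b j w) \<partial>M) = (\<integral>w. sin (t * Z l b j w) \<partial>M)" for l b j
    unfolding integral_Re[OF i, symmetric] integral_Im[OF i, symmetric] by (simp_all add: Re_exp Im_exp)
  then have GR: "Re (G n) = EC n" "Im (G n) = ES n" for n
    by (simp_all add: G_def EC_def ES_def Re_sum Im_sum)
  have EC: "EC \<longlonglongrightarrow> \<phi>" using tendsto_Re[OF G] unfolding GR by simp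
  have ES: "ES \<longlonglongrightarrow> 0" using tendsto_Im[OF G] unfolding GR by simp
  define r where "r n = sqrt (6 / real (b n) + 4 * \<alpha> (l n))" for n
  have \<alpha>: "\<alpha> \<longlonglongrightarrow> 0"
  proof (rule tendsto_sandwich[OF _ _ tendsto_const])
    show "\<forall>\<^sub>F k in sequentially. 0 \<le> \<alpha> k" by (simp add: alpha_nonneg)
    show "\<forall>\<^sub>F k in sequentially. \<alpha> k \<le> C * (1 / real k)"
    proof (rule eventually_sequentiallyI[of 1])
      fix k :: nat assume k: "1 \<le> k"
      have "\<alpha> k \<le> C / real k ^ 6" by (rule alpha_le_power[OF k])
      also have "\<dots> \<le> C / real k"
        using C_nonneg k self_le_power[of "real k" 6] by (intro divide_left_mono) auto
      finally show "\<alpha> k \<le> C * (1 / real k)" by simp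
    qed
    show "(\<lambda>k. C * (1 / real k)) \<longlonglongrightarrow> 0" using tendsto_mult_right_zero[OF lim_1_over_n] by simp
  qed
  have "(\<lambda>n. 1 / real (b n)) \<longlonglongrightarrow> 0" by (rule filterlim_compose[OF lim_1_over_n b])
  then have "(\<lambda>n. sqrt (6 * (1 / real (b n)) + 4 * \<alpha> (l n))) \<longlonglongrightarrow> sqrt (6 * 0 + 4 * 0)"
    by (intro tendsto_intros filterlim_compose[OF \<alpha> l])
  then have r: "r \<longlonglongrightarrow> 0" by (simp add: r_def[abs_def])
  have bound: "expected_defect (l n) (b n) t
      \<le> 2 * (r n + \<bar>EC n - \<phi>\<bar>) + (r n + \<bar>ES n\<bar>)" if ln: "1 \<le> l n" and bn: "1 \<le> b n" for n
  proof -
    let ?c = "mean_cos (l n) (b n) t" and ?s = "mean_sin (l n) (b n) t"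
    have mc: "integrable M ?c" "integrable M ?s"
      using mean_bounds by (auto intro!: integrable_bounded[of _ 1])
    have dev: "(\<integral>w. \<bar>?c w - EC n\<bar> \<partial>M) \<le> r n" "(\<integral>w. \<bar>?s w - ES n\<bar> \<partial>M) \<le> r n"
      unfolding mean_cos_def mean_sin_def EC_def ES_def r_def
      by (rule block_mean_deviation[OF ln bn]; use Z_measurable_gen in measurable)+
    have pt: "\<bar>char_defect (l n) (b n) t w - limit_defect t\<bar>
        \<le> 2 * (\<bar>?c w - EC n\<bar> + \<bar>EC n - \<phi>\<bar>) + (\<bar>?s w - ES n\<bar> + \<bar>ES n\<bar>)" for w
    proof -
      have b1: "\<bar>?c w\<bar> \<le> 1" "\<bar>?s w\<bar> \<le> 1" by (rule mean_bounds)+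
      \<comment> \<open>Factoring the difference of squares makes the error linear in the
        deviations: the second factor is at most 2 in modulus, and the squared sine mean is at most
        its modulus.\<close>
      have "char_defect (l n) (b n) t w - limit_defect t = (\<phi> - ?c w) * (\<phi> + ?c w) - ?s w * ?s w"
        by (simp add: char_defect_def limit_defect_def \<phi>_def power2_eq_square algebra_simps)
      also have "\<bar>\<dots>\<bar> \<le> \<bar>\<phi> - ?c w\<bar> * \<bar>\<phi> + ?c w\<bar> + \<bar>?s w\<bar> * \<bar>?s w\<bar>"
        unfolding abs_mult[symmetric] by (rule abs_triangle_ineq4)
      also have "\<dots> \<le> \<bar>\<phi> - ?c w\<bar> * 2 + \<bar>?s w\<bar> * 1"
        using b1 \<phi> by (intro add_mono mult_left_mono) auto
      also have "\<dots> \<le> 2 * (\<bar>?c w - EC n\<bar> + \<bar>EC n - \<phi>\<bar>) + (\<bar>?s w - ES n\<bar> + \<bar>ES n\<bar>)"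
      proof -
        have "\<bar>\<phi> - c\<bar> * 2 \<le> 2 * (\<bar>c - e\<bar> + \<bar>e - \<phi>\<bar>)" for c e :: real
          using abs_triangle_ineq[of "\<phi> - e" "e - c"] by (simp add: abs_minus_commute)
        moreover have "\<bar>u\<bar> * 1 \<le> \<bar>u - e\<bar> + \<bar>e\<bar>" for u e :: real
          using abs_triangle_ineq[of "u - e" e] by simp
        ultimately show ?thesis by (intro add_mono)
      qed
      finally show ?thesis .
    qed
    have "expected_defect (l n) (b n) t
        \<le> (\<integral>w. 2 * (\<bar>?c w - EC n\<bar> + \<bar>EC n - \<phi>\<bar>) + (\<bar>?s w - ES n\<bar> + \<bar>ES n\<bar>) \<partial>M)"
    proof (rule integral_mono[OF _ _ pt])
      obtain K where "sum_bound K" using sum_bound_exists by blast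
      then show "integrable M (\<lambda>w. \<bar>char_defect (l n) (b n) t w - limit_defect t\<bar>)"
        by (rule expected_defect_dominated(2)[OF _ ln bn])
    qed (use mc in auto)
    also have "\<dots> = 2 * ((\<integral>w. \<bar>?c w - EC n\<bar> \<partial>M) + \<bar>EC n - \<phi>\<bar>) + ((\<integral>w. \<bar>?s w - ES n\<bar> \<partial>M) + \<bar>ES n\<bar>)"
      using mc by (simp add: prob_space)
    also have "\<dots> \<le> 2 * (r n + \<bar>EC n - \<phi>\<bar>) + (r n + \<bar>ES n\<bar>)"
      using dev by (intro add_mono mult_left_mono order_refl) auto
    finally show ?thesis .
  qed
  have "(\<lambda>n. 2 * (r n + \<bar>EC n - \<phi>\<bar>) + (r n + \<bar>ES n\<bar>)) \<longlonglongrightarrow> 2 * (0 + \<bar>\<phi> - \<phi>\<bar>) + (0 + \<bar>0\<bar>)"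
    by (intro tendsto_intros r EC ES)
  then have lim: "(\<lambda>n. 2 * (r n + \<bar>EC n - \<phi>\<bar>) + (r n + \<bar>ES n\<bar>)) \<longlonglongrightarrow> 0" by simp
  have evl: "\<forall>\<^sub>F n in sequentially. 1 \<le> l n" "\<forall>\<^sub>F n in sequentially. 1 \<le> b n"
    using l b by (auto simp: filterlim_at_top)
  show ?thesis
  proof (rule Lim_null_comparison[OF _ lim])
    from evl show "\<forall>\<^sub>F n in sequentially. norm (expected_defect (l n) (b n) t)
      \<le> 2 * (r n + \<bar>EC n - \<phi>\<bar>) + (r n + \<bar>ES n\<bar>)"
      by eventually_elim (use bound in simp)
  qed
qed

definition sigma_integral :: real where
  "sigma_integral = (LBINT y:{0..1}. (LBINT x:{0..1}. sqrt ((\<sigma> x)^2 + (\<sigma> y)^2)))"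

text \<open>Gini's mean difference including the diagonal, which is zero; normalising by
  \<open>b * (b - 1)\<close> instead of b^2 changes it by the factor b / (b - 1).\<close>

definition gini_difference :: "nat \<Rightarrow> nat \<Rightarrow> 'a \<Rightarrow> real" where
  "gini_difference l b w = (\<Sum>j\<in>{1..b}. \<Sum>k\<in>{1..b}. \<bar>Z l b j w - Z l b k w\<bar>) / (real b)^2"

lemma gini_difference_integrable:
  assumes "1 \<le> l" shows "integrable M (gini_difference l b)"
proof -
  obtain K where K: "sum_bound K" using sum_bound_exists by blast
  have "integrable M (Z l b j)" if "j \<in> {1..b}" for j
    using expectation_abs_le_sqrt(1)[OF Z_measurable Z_second_moment(1)[OF K assms that]] .
  then show ?thesis unfolding gini_difference_def[abs_def]
    by (intro integrable_divide Bochner_Integration.integrable_sum integrable_abs Bochner_Integration.integrable_diff)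
qed

text \<open>For each outcome both quantities are kernel integrals, so their distance is at most the
  integral of the distance of the integrands; Fubini then brings the expectation under the integral
  in t. The measurability claim prepares dominated convergence.\<close>

lemma gini_difference_L1_bound:
  assumes l: "1 \<le> l" and b: "1 \<le> b"
  shows "(\<integral>w. \<bar>gini_difference l b w - sqrt (2 / pi) * sqrt \<kappa> * sigma_integral\<bar> \<partial>M)
    \<le> (\<integral>t. expected_defect l b t / t^2 \<partial>lborel) / cos_const"
    and "(\<lambda>t. expected_defect l b t / t^2) \<in> borel_measurable lborel"
proof -
  obtain K where K: "sum_bound K" using sum_bound_exists by blast
  note dom = expected_defect_dominated[OF K l b]
  interpret LM: pair_sigma_finite "lborel :: real measure" M ..
  define F where "F t w = \<bar>char_defect l b t w - limit_defect t\<bar> / t^2" for t w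
  have Fm [measurable]: "(\<lambda>(t, w). F t w) \<in> borel_measurable (lborel \<Otimes>\<^sub>M M)"
    unfolding F_def by measurable
  have F0: "0 \<le> F t w" for t w by (simp add: F_def)
  have EF: "(\<integral>w. F t w \<partial>M) = expected_defect l b t / t^2" for t
    unfolding F_def by simp
  have "(\<lambda>t. \<integral>w. F t w \<partial>M) \<in> borel_measurable lborel"
    by (rule borel_measurable_lebesgue_integral[OF Fm])
  then show m: "(\<lambda>t. expected_defect l b t / t^2) \<in> borel_measurable lborel"
    unfolding EF .
  have fub: "integrable (lborel \<Otimes>\<^sub>M M) (\<lambda>(t, w). F t w)"
  proof (rule LM.Fubini_integrable[OF Fm])
    have "integrable lborel (\<lambda>t. expected_defect l b t / t^2)"
    proof (rule Bochner_Integration.integrable_bound[OF integrable_inverse_one_plus_square m])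
      show "AE t in lborel. norm (expected_defect l b t / t^2)
        \<le> norm ((2 * K * S^2 + \<kappa> * S^2 + 2) / (1 + t^2))"
        using dom(1) by (intro AE_I2) (smt (verit) abs_ge_self abs_of_nonneg divide_nonneg_nonneg
            integral_nonneg_AE AE_I2 abs_ge_zero real_norm_def zero_le_power2)
    qed
    then show "integrable lborel (\<lambda>t. \<integral>w. norm (case (t, w) of (t, w) \<Rightarrow> F t w) \<partial>M)"
      using F0 by (simp add: EF abs_of_nonneg)
    show "AE t in lborel. integrable M (\<lambda>w. case (t, w) of (t, w) \<Rightarrow> F t w)"
      unfolding F_def using dom(2) by auto
  qed
  have ld: "integrable lborel (\<lambda>t. limit_defect t / t^2)"
    "(\<integral>t. limit_defect t / t^2 \<partial>lborel) = cos_const * (sqrt (2 / pi) * sqrt \<kappa> * sigma_integral)"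
    using mixture(5,6) by (auto simp: limit_defect_def sigma_integral_def mult.assoc)
  have pt: "cos_const * \<bar>gini_difference l b w - sqrt (2 / pi) * sqrt \<kappa> * sigma_integral\<bar> \<le> (\<integral>t. F t w \<partial>lborel)" for w
  proof -
    note cd = char_defect_integral[OF b, of l w, folded gini_difference_def]
    have "cos_const * \<bar>gini_difference l b w - sqrt (2 / pi) * sqrt \<kappa> * sigma_integral\<bar>
        = \<bar>cos_const * gini_difference l b w - cos_const * (sqrt (2 / pi) * sqrt \<kappa> * sigma_integral)\<bar>"
      using cos_const_pos by (simp add: abs_mult right_diff_distrib[symmetric])
    also have "\<dots> = \<bar>\<integral>t. char_defect l b t w / t^2 - limit_defect t / t^2 \<partial>lborel\<bar>"
      using cd ld by simp
    also have "\<dots> \<le> (\<integral>t. \<bar>char_defect l b t w / t^2 - limit_defect t / t^2\<bar> \<partial>lborel)" by simp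
    also have "\<dots> = (\<integral>t. F t w \<partial>lborel)"
      by (simp add: F_def diff_divide_distrib[symmetric] abs_divide)
    finally show ?thesis .
  qed
  have "cos_const * (\<integral>w. \<bar>gini_difference l b w - sqrt (2 / pi) * sqrt \<kappa> * sigma_integral\<bar> \<partial>M)
      = (\<integral>w. cos_const * \<bar>gini_difference l b w - sqrt (2 / pi) * sqrt \<kappa> * sigma_integral\<bar> \<partial>M)" by simp
  also have "\<dots> \<le> (\<integral>w. (\<integral>t. F t w \<partial>lborel) \<partial>M)"
    using gini_difference_integrable[OF l] LM.integrable_snd[OF fub] pt by (intro integral_mono) auto
  also have "\<dots> = (\<integral>t. (\<integral>w. F t w \<partial>M) \<partial>lborel)" by (rule LM.Fubini_integral[OF fub])
  finally show "(\<integral>w. \<bar>gini_difference l b w - sqrt (2 / pi) * sqrt \<kappa> * sigma_integral\<bar> \<partial>M)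
    \<le> (\<integral>t. expected_defect l b t / t^2 \<partial>lborel) / cos_const"
    unfolding EF using cos_const_pos by (simp add: le_divide_eq mult.commute)
qed

theorem gini_difference_L1_limit:
  fixes l b :: "nat \<Rightarrow> nat"
  assumes l: "filterlim l at_top sequentially" and b: "filterlim b at_top sequentially"
  shows "(\<lambda>n. \<integral>w. \<bar>gini_difference (l n) (b n) w - sqrt (2 / pi) * sqrt \<kappa> * sigma_integral\<bar> \<partial>M) \<longlonglongrightarrow> 0"
proof -
  obtain K where K: "sum_bound K" using sum_bound_exists by blast
  \<comment> \<open>The majorant holds for positive sizes; the maxima make it available for every n
    without affecting the limit.\<close>
  define l' b' where "l' n = max 1 (l n)" and "b' n = max 1 (b n)" for n
  have ev: "\<forall>\<^sub>F n in sequentially. l' n = l n" "\<forall>\<^sub>F n in sequentially. b' n = b n"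
    using l b unfolding filterlim_at_top l'_def b'_def
    by (metis (mono_tags, lifting) eventually_mono max.absorb2)+
  have l': "filterlim l' at_top sequentially" "filterlim b' at_top sequentially"
    using filterlim_cong[OF refl refl ev(1)] filterlim_cong[OF refl refl ev(2)] l b by auto
  have 1: "1 \<le> l' n" "1 \<le> b' n" for n by (auto simp: l'_def b'_def)
  have "(\<lambda>n. \<integral>t. expected_defect (l' n) (b' n) t / t^2 \<partial>lborel) \<longlonglongrightarrow> (\<integral>t. 0 \<partial>(lborel :: real measure))"
  proof (rule integral_dominated_convergence[where w = "\<lambda>t. (2 * K * S^2 + \<kappa> * S^2 + 2) / (1 + t^2)"])
    show "integrable lborel (\<lambda>t. (2 * K * S^2 + \<kappa> * S^2 + 2) / (1 + t^2))"
      by (rule integrable_inverse_one_plus_square)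
    show "AE t in lborel. (\<lambda>n. expected_defect (l' n) (b' n) t / t^2) \<longlonglongrightarrow> 0"
    proof (rule AE_I2)
      fix t :: real
      show "(\<lambda>n. expected_defect (l' n) (b' n) t / t^2) \<longlonglongrightarrow> 0"
        using tendsto_divide_zero[OF expected_defect_limit[OF l', of t]] .
    qed
    show "AE t in lborel. norm (expected_defect (l' n) (b' n) t / t^2)
        \<le> (2 * K * S^2 + \<kappa> * S^2 + 2) / (1 + t^2)" for n
      using expected_defect_dominated(1)[OF K 1] by (intro AE_I2) simp
    show "(\<lambda>t. expected_defect (l' n) (b' n) t / t^2) \<in> borel_measurable lborel" for n
      by (rule gini_difference_L1_bound(2)[OF 1])
  qed simp
  then have lim: "(\<lambda>n. (\<integral>t. expected_defect (l' n) (b' n) t / t^2 \<partial>lborel) / cos_const) \<longlonglongrightarrow> 0"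
    by (intro tendsto_divide_zero) simp
  have "(\<lambda>n. \<integral>w. \<bar>gini_difference (l' n) (b' n) w - sqrt (2 / pi) * sqrt \<kappa> * sigma_integral\<bar> \<partial>M) \<longlonglongrightarrow> 0"
    by (rule Lim_null_comparison[OF _ lim]) (use gini_difference_L1_bound(1)[OF 1] in simp)
  moreover have "\<forall>\<^sub>F n in sequentially. (\<integral>w. \<bar>gini_difference (l' n) (b' n) w - sqrt (2 / pi) * sqrt \<kappa> * sigma_integral\<bar> \<partial>M)
      = (\<integral>w. \<bar>gini_difference (l n) (b n) w - sqrt (2 / pi) * sqrt \<kappa> * sigma_integral\<bar> \<partial>M)"
    using ev by eventually_elim simp
  ultimately show ?thesis by (rule Lim_transform_eventually)
qed

end

section \<open>The U-statistic\<close>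

context weighted_process begin

definition block_mean :: "(real \<Rightarrow> real) \<Rightarrow> nat \<Rightarrow> nat \<Rightarrow> nat \<Rightarrow> 'a \<Rightarrow> real" where
  "block_mean \<mu> l b j w = (\<Sum>i = (j - 1) * l + 1..j * l. obs \<mu> \<sigma> Y (l * b) i w) / real l"

text \<open>\<open>U_stat\<close> with both block sizes as free parameters and sample size
  \<open>l * b\<close>; the two agree at admissible \<open>n \<ge> 1\<close>.\<close>

definition U_block :: "(real \<Rightarrow> real) \<Rightarrow> nat \<Rightarrow> nat \<Rightarrow> 'a \<Rightarrow> real" where
  "U_block \<mu> l b w =
     (\<Sum>j\<in>{1..b}. \<Sum>k\<in>{1..b} - {j}. \<bar>block_mean \<mu> l b j w - block_mean \<mu> l b k w\<bar>)
       / (real b * (real b - 1))"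

text \<open>A cadlag function that is almost everywhere constant may still take another value at the
  right endpoint; only the last observation is affected.\<close>

lemma block_mean_Z:
  assumes \<mu>: "\<And>x. x \<in> {0..<1} \<Longrightarrow> \<mu> x = c" and l: "1 \<le> l" and j: "j \<in> {1..b}"
  shows "\<bar>sqrt (real l) * block_mean \<mu> l b j w - (sqrt (real l) * c + Z l b j w)\<bar> \<le> \<bar>\<mu> 1 - c\<bar> / sqrt (real l)"
proof -
  let ?I = "{(j - 1) * l + 1..j * l}"
  have l0: "0 < real l" using l by simp
  have sl: "sqrt (real l) * (x / real l) = x / sqrt (real l)" for x
    using l0 by (simp add: field_simps real_sqrt_mult[symmetric])
  define r where "r i = \<mu> (real i / real (l * b)) - c" for i :: nat
  have r0: "r i = 0" if "i \<in> ?I" "i \<noteq> l * b" for i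
  proof -
    note bp = block_points(1)[OF l j that(1)]
    have "real i \<noteq> real (l * b)" using that(2) by (simp only: of_nat_eq_iff not_False_eq_True)
    then have "real i / real (l * b) \<noteq> 1" using l j by simp
    with bp have "real i / real (l * b) \<in> {0..<1}"
      by (simp only: atLeastAtMost_iff atLeastLessThan_iff less_le[of _ "1::real"] simp_thms)
    then show ?thesis unfolding r_def using \<mu> by simp
  qed
  have rlast: "r (l * b) = \<mu> 1 - c" using l j by (simp add: r_def)
  have "(\<Sum>i\<in>?I. r i) = (\<Sum>i\<in>?I \<inter> {l * b}. r i)"
    using r0 by (intro sum.mono_neutral_right) auto
  also have "\<bar>\<dots>\<bar> \<le> \<bar>\<mu> 1 - c\<bar>"
    using rlast by (cases "l * b \<in> ?I") auto
  finally have rs: "\<bar>\<Sum>i\<in>?I. r i\<bar> \<le> \<bar>\<mu> 1 - c\<bar>" .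
  have "(\<Sum>i\<in>?I. obs \<mu> \<sigma> Y (l * b) i w)
      = real (card ?I) * c + (\<Sum>i\<in>?I. r i) + (\<Sum>i\<in>?I. \<sigma> (real i / real (l * b)) * Y i w)"
    unfolding obs_def r_def sum.distrib sum_subtractf by simp
  also have "card ?I = l" using j by (intro block_card) simp
  finally have obs: "(\<Sum>i\<in>?I. obs \<mu> \<sigma> Y (l * b) i w)
      = real l * c + (\<Sum>i\<in>?I. r i) + (\<Sum>i\<in>?I. \<sigma> (real i / real (l * b)) * Y i w)" .
  have cl: "real l * c / sqrt (real l) = sqrt (real l) * c"
    using l0 by (simp add: field_simps)
  have "sqrt (real l) * block_mean \<mu> l b j w = sqrt (real l) * c + (\<Sum>i\<in>?I. r i) / sqrt (real l) + Z l b j w"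
  proof -
    have "sqrt (real l) * block_mean \<mu> l b j w
        = (real l * c + (\<Sum>i\<in>?I. r i) + (\<Sum>i\<in>?I. \<sigma> (real i / real (l * b)) * Y i w)) / sqrt (real l)"
      unfolding block_mean_def obs sl ..
    also have "\<dots> = sqrt (real l) * c + (\<Sum>i\<in>?I. r i) / sqrt (real l) + Z l b j w"
      unfolding add_divide_distrib cl Z_def ..
    finally show ?thesis .
  qed
  then have "sqrt (real l) * block_mean \<mu> l b j w - (sqrt (real l) * c + Z l b j w) = (\<Sum>i\<in>?I. r i) / sqrt (real l)"
    by simp
  then show ?thesis using rs by (simp add: abs_divide divide_right_mono)
qed

text \<open>The constant trend cancels in differences. Each scaled block mean is off by at most
  \<open>e\<close>, so each of the \<open>b * (b - 1)\<close> terms is off by at most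
  \<open>2 * e\<close>, and averaging preserves this.\<close>

lemma U_block_gini:
  assumes \<mu>: "\<And>x. x \<in> {0..<1} \<Longrightarrow> \<mu> x = c" and l: "1 \<le> l" and b: "2 \<le> b"
  shows "\<bar>sqrt (real l) * U_block \<mu> l b w - real b / (real b - 1) * gini_difference l b w\<bar> \<le> 2 * \<bar>\<mu> 1 - c\<bar> / sqrt (real l)"
proof -
  define e where "e = \<bar>\<mu> 1 - c\<bar> / sqrt (real l)"
  define B where "B = real b * (real b - 1)"
  have B: "0 < B" using b by (simp add: B_def)
  define m where "m j = block_mean \<mu> l b j w" for j
  define z where "z j = Z l b j w" for j
  have cl: "\<bar>\<bar>sqrt (real l) * m j - sqrt (real l) * m k\<bar> - \<bar>z j - z k\<bar>\<bar> \<le> 2 * e"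
    if "j \<in> {1..b}" "k \<in> {1..b}" for j k
    using block_mean_Z[where \<mu> = \<mu> and w = w, OF \<mu> l that(1)]
      block_mean_Z[where \<mu> = \<mu> and w = w, OF \<mu> l that(2)]
    unfolding m_def[symmetric] z_def[symmetric] e_def[symmetric] by linarith
  have sU: "sqrt (real l) * U_block \<mu> l b w
      = (\<Sum>j\<in>{1..b}. \<Sum>k\<in>{1..b} - {j}. \<bar>sqrt (real l) * m j - sqrt (real l) * m k\<bar>) / B"
    unfolding U_block_def B_def m_def right_diff_distrib[symmetric] abs_mult
    by (simp add: sum_distrib_left[symmetric])
  have sG: "real b / (real b - 1) * gini_difference l b w = (\<Sum>j\<in>{1..b}. \<Sum>k\<in>{1..b} - {j}. \<bar>z j - z k\<bar>) / B"
  proof -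
    have "(\<Sum>k\<in>{1..b}. \<bar>z j - z k\<bar>) = (\<Sum>k\<in>{1..b} - {j}. \<bar>z j - z k\<bar>)" for j
      by (intro sum.mono_neutral_right) auto
    then have "gini_difference l b w = (\<Sum>j\<in>{1..b}. \<Sum>k\<in>{1..b} - {j}. \<bar>z j - z k\<bar>) / (real b)^2"
      by (simp add: gini_difference_def z_def)
    moreover have "real b / (real b - 1) * (x / (real b)^2) = x / B" for x
      using b by (simp add: B_def power2_eq_square)
    ultimately show ?thesis by simp
  qed
  have "\<bar>(\<Sum>j\<in>{1..b}. \<Sum>k\<in>{1..b} - {j}. \<bar>sqrt (real l) * m j - sqrt (real l) * m k\<bar>)
      - (\<Sum>j\<in>{1..b}. \<Sum>k\<in>{1..b} - {j}. \<bar>z j - z k\<bar>)\<bar>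
      = \<bar>\<Sum>j\<in>{1..b}. \<Sum>k\<in>{1..b} - {j}. \<bar>sqrt (real l) * m j - sqrt (real l) * m k\<bar> - \<bar>z j - z k\<bar>\<bar>"
    by (simp only: sum_subtractf)
  also have "\<dots> \<le> (\<Sum>j\<in>{1..b}. \<bar>\<Sum>k\<in>{1..b} - {j}. \<bar>sqrt (real l) * m j - sqrt (real l) * m k\<bar> - \<bar>z j - z k\<bar>\<bar>)"
    by (rule sum_abs)
  also have "\<dots> \<le> (\<Sum>j\<in>{1..b}. \<Sum>k\<in>{1..b} - {j}. 2 * e)"
    by (intro sum_mono sum_abs[THEN order_trans] cl) auto
  also have "\<dots> = (\<Sum>j\<in>{1..b}. (real b - 1) * (2 * e))"
    using b by (intro sum.cong refl) (simp add: of_nat_diff)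
  also have "\<dots> = 2 * e * B" by (simp add: B_def)
  finally show ?thesis
    unfolding sU sG diff_divide_distrib[symmetric] abs_divide
    using B by (simp add: divide_le_eq e_def)
qed

lemma U_block_measurable: "U_block \<mu> l b \<in> borel_measurable M"
proof -
  have "block_mean \<mu> l b j \<in> borel_measurable M" for j
    unfolding block_mean_def[abs_def] obs_def
    by (intro borel_measurable_divide borel_measurable_sum borel_measurable_add borel_measurable_times
        borel_measurable_const Y_measurable) auto
  then show ?thesis unfolding U_block_def[abs_def] by measurable
qed

lemma U_block_limit:
  fixes l b :: "nat \<Rightarrow> nat"
  assumes \<mu>: "\<And>x. x \<in> {0..<1} \<Longrightarrow> \<mu> x = c"
    and l: "filterlim l at_top sequentially" and b: "filterlim b at_top sequentially"
  shows "\<forall>\<^sub>F n in sequentially. integrable M (U_block \<mu> (l n) (b n))"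
    and "(\<lambda>n. \<integral>w. \<bar>sqrt (real (l n)) / sqrt \<kappa> * U_block \<mu> (l n) (b n) w - sigma_integral * sqrt (2 / pi)\<bar> \<partial>M) \<longlonglongrightarrow> 0"
proof -
  define L where "L = sqrt (2 / pi) * sqrt \<kappa> * sigma_integral"
  define a where "a n = real (b n) / (real (b n) - 1)" for n
  define d where "d n = 2 * \<bar>\<mu> 1 - c\<bar> / sqrt (real (l n))" for n
  have ev: "\<forall>\<^sub>F n in sequentially. 1 \<le> l n" "\<forall>\<^sub>F n in sequentially. 2 \<le> b n"
    using l b by (auto simp: filterlim_at_top)
  have main: "integrable M (U_block \<mu> (l n) (b n)) \<and>
      (\<integral>w. \<bar>sqrt (real (l n)) / sqrt \<kappa> * U_block \<mu> (l n) (b n) w - sigma_integral * sqrt (2 / pi)\<bar> \<partial>M)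
      \<le> (d n + a n * (\<integral>w. \<bar>gini_difference (l n) (b n) w - L\<bar> \<partial>M) + \<bar>a n - 1\<bar> * \<bar>L\<bar>) / sqrt \<kappa>"
    if ln: "1 \<le> l n" and bn: "2 \<le> b n" for n
  proof
    have a0: "0 \<le> a n" using bn by (simp add: a_def)
    have gi: "integrable M (gini_difference (l n) (b n))" by (rule gini_difference_integrable[OF ln])
    have near: "\<bar>sqrt (real (l n)) * U_block \<mu> (l n) (b n) w - a n * gini_difference (l n) (b n) w\<bar> \<le> d n" for w
      unfolding a_def d_def by (rule U_block_gini[OF \<mu> ln bn])
    have s0: "0 < sqrt (real (l n))" using ln by simp
    have "integrable M (\<lambda>w. sqrt (real (l n)) * U_block \<mu> (l n) (b n) w)"
    proof (rule Bochner_Integration.integrable_bound)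
      show "integrable M (\<lambda>w. d n + a n * \<bar>gini_difference (l n) (b n) w\<bar>)" using gi by simp
      have "\<bar>sqrt (real (l n)) * U_block \<mu> (l n) (b n) w\<bar> \<le> d n + a n * \<bar>gini_difference (l n) (b n) w\<bar>" for w
        using near[of w] abs_mult[of "a n" "gini_difference (l n) (b n) w"] a0 by linarith
      then show "AE w in M. norm (sqrt (real (l n)) * U_block \<mu> (l n) (b n) w)
        \<le> norm (d n + a n * \<bar>gini_difference (l n) (b n) w\<bar>)"
        by (auto intro!: AE_I2 intro: order_trans[OF _ abs_ge_self])
      show "(\<lambda>w. sqrt (real (l n)) * U_block \<mu> (l n) (b n) w) \<in> borel_measurable M"
        using U_block_measurable[of \<mu> "l n" "b n"] by measurable
    qed
    then have "integrable M (\<lambda>w. (1 / sqrt (real (l n))) * (sqrt (real (l n)) * U_block \<mu> (l n) (b n) w))"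
      by (rule integrable_mult_right)
    then show Ui: "integrable M (U_block \<mu> (l n) (b n))" using s0 by simp
    have k0: "0 < sqrt \<kappa>" using long_run_variance_pos by simp
    have pt: "\<bar>sqrt (real (l n)) / sqrt \<kappa> * U_block \<mu> (l n) (b n) w - sigma_integral * sqrt (2 / pi)\<bar>
      \<le> (d n + a n * \<bar>gini_difference (l n) (b n) w - L\<bar> + \<bar>a n - 1\<bar> * \<bar>L\<bar>) / sqrt \<kappa>" for w
    proof -
      define u where "u = sqrt (real (l n)) * U_block \<mu> (l n) (b n) w"
      define g where "g = gini_difference (l n) (b n) w"
      have "sqrt (real (l n)) / sqrt \<kappa> * U_block \<mu> (l n) (b n) w - sigma_integral * sqrt (2 / pi) = (u - L) / sqrt \<kappa>"
        using k0 unfolding u_def L_def by (simp add: diff_divide_distrib)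
      then have "\<bar>sqrt (real (l n)) / sqrt \<kappa> * U_block \<mu> (l n) (b n) w - sigma_integral * sqrt (2 / pi)\<bar> = \<bar>u - L\<bar> / sqrt \<kappa>"
        using k0 by (simp add: abs_divide)
      also have "\<dots> \<le> (d n + a n * \<bar>g - L\<bar> + \<bar>a n - 1\<bar> * \<bar>L\<bar>) / sqrt \<kappa>"
      proof (rule divide_right_mono)
        \<comment> \<open>Three errors: the trend at the right endpoint, the fluctuation of the mean
          difference, and the normalising factor \<open>a n\<close> against 1.\<close>
        have "u - L = (u - a n * g) + a n * (g - L) + (a n - 1) * L" by (simp add: algebra_simps)
        then have "\<bar>u - L\<bar> \<le> \<bar>u - a n * g\<bar> + \<bar>a n * (g - L)\<bar> + \<bar>(a n - 1) * L\<bar>" by linarith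
        then show "\<bar>u - L\<bar> \<le> d n + a n * \<bar>g - L\<bar> + \<bar>a n - 1\<bar> * \<bar>L\<bar>"
          using near[of w] a0 unfolding u_def g_def by (simp add: abs_mult)
      qed (use k0 in simp)
      finally show ?thesis by (simp add: g_def)
    qed
    have "(\<integral>w. \<bar>sqrt (real (l n)) / sqrt \<kappa> * U_block \<mu> (l n) (b n) w - sigma_integral * sqrt (2 / pi)\<bar> \<partial>M)
      \<le> (\<integral>w. (d n + a n * \<bar>gini_difference (l n) (b n) w - L\<bar> + \<bar>a n - 1\<bar> * \<bar>L\<bar>) / sqrt \<kappa> \<partial>M)"
      using Ui gi by (intro integral_mono pt) auto
    also have "\<dots> = (d n + a n * (\<integral>w. \<bar>gini_difference (l n) (b n) w - L\<bar> \<partial>M) + \<bar>a n - 1\<bar> * \<bar>L\<bar>) / sqrt \<kappa>"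
      using gi by (simp add: prob_space)
    finally show "(\<integral>w. \<bar>sqrt (real (l n)) / sqrt \<kappa> * U_block \<mu> (l n) (b n) w - sigma_integral * sqrt (2 / pi)\<bar> \<partial>M)
      \<le> (d n + a n * (\<integral>w. \<bar>gini_difference (l n) (b n) w - L\<bar> \<partial>M) + \<bar>a n - 1\<bar> * \<bar>L\<bar>) / sqrt \<kappa>" .
  qed
  show "\<forall>\<^sub>F n in sequentially. integrable M (U_block \<mu> (l n) (b n))"
    using ev by eventually_elim (use main in auto)
  have a: "a \<longlonglongrightarrow> 1"
  proof -
    have "(\<lambda>k::nat. real k / (real k - 1)) \<longlonglongrightarrow> 1" by real_asymp
    from filterlim_compose[OF this b] show ?thesis by (simp add: a_def[abs_def])
  qed
  have d: "d \<longlonglongrightarrow> 0"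
  proof -
    have "(\<lambda>k::nat. 2 * \<bar>\<mu> 1 - c\<bar> / sqrt (real k)) \<longlonglongrightarrow> 0" by real_asymp
    from filterlim_compose[OF this l] show ?thesis by (simp add: d_def[abs_def])
  qed
  have g: "(\<lambda>n. \<integral>w. \<bar>gini_difference (l n) (b n) w - L\<bar> \<partial>M) \<longlonglongrightarrow> 0"
    unfolding L_def by (rule gini_difference_L1_limit[OF l b])
  have "(\<lambda>n. (d n + a n * (\<integral>w. \<bar>gini_difference (l n) (b n) w - L\<bar> \<partial>M) + \<bar>a n - 1\<bar> * \<bar>L\<bar>) / sqrt \<kappa>)
    \<longlonglongrightarrow> (0 + 1 * 0 + \<bar>1 - 1\<bar> * \<bar>L\<bar>) / sqrt \<kappa>"
    using long_run_variance_pos by (intro tendsto_intros a d g) simp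
  then have lim: "(\<lambda>n. (d n + a n * (\<integral>w. \<bar>gini_difference (l n) (b n) w - L\<bar> \<partial>M) + \<bar>a n - 1\<bar> * \<bar>L\<bar>) / sqrt \<kappa>) \<longlonglongrightarrow> 0"
    by simp
  show "(\<lambda>n. \<integral>w. \<bar>sqrt (real (l n)) / sqrt \<kappa> * U_block \<mu> (l n) (b n) w - sigma_integral * sqrt (2 / pi)\<bar> \<partial>M) \<longlonglongrightarrow> 0"
    by (rule Lim_null_comparison[OF _ lim], use ev in eventually_elim) (use main in simp)
qed

end

lemma eventually_admissible_at_top:
  "eventually P (admissible_at_top s) \<longleftrightarrow> (\<forall>\<^sub>F n in sequentially. n \<in> admissible s \<longrightarrow> P n)"
  by (simp add: admissible_at_top_def eventually_inf_principal)

lemma filterlim_floor_powr: "0 < r \<Longrightarrow> filterlim (\<lambda>n::nat. nat \<lfloor>real n powr r\<rfloor>) at_top sequentially"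
  by real_asymp

theorem theorem2p4:
  fixes M :: "'a measure" and Y :: "nat \<Rightarrow> 'a \<Rightarrow> real"
    and \<mu> \<sigma> :: "real \<Rightarrow> real"
    and \<sigma>0 s \<rho> \<delta> C :: real
  assumes "prob_space M"
    and "strictly_stationary M Y"
    and "prob_space.expectation M (Y 1) = 0"
    and "prob_space.variance M (Y 1) = 1"
    and "alpha_mixing M Y"
    and "long_run_variance M Y > 0"
    and "cadlag01 \<mu>"
    and "cadlag01 \<sigma>" and "piecewise_lipschitz01 \<sigma>"
    and "\<sigma>0 > 0" and "\<And>x. x \<in> {0..1} \<Longrightarrow> \<sigma> x \<ge> \<sigma>0"
    and "1 / 2 < s" and "s < 1"
    and "\<rho> > 1" and "0 < \<delta>" and "\<delta> \<le> 1"
    and "integrable M (\<lambda>\<omega>. \<bar>Y 1 \<omega>\<bar> powr (2 + \<delta>))"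
    and "\<And>k. k \<ge> 1 \<Longrightarrow>
           alpha_mixing_coeff M Y k \<le> C * real k powr (- \<rho> * (2 + \<delta>) * (1 + \<delta>) / \<delta>\<^sup>2)"
    and "s > (1 + \<delta>\<^sup>2 / (\<rho> * (2 + \<delta>) * (1 + \<delta>))) / (2 + \<delta>\<^sup>2 / (\<rho> * (2 + \<delta>) * (1 + \<delta>)))"
    and "\<exists>\<mu>H. AE x in lborel. x \<in> {0..1} \<longrightarrow> \<mu> x = \<mu>H"
  shows "tendsto_L1 M
           (\<lambda>n \<omega>. sqrt (real (block_length s n)) / sqrt (long_run_variance M Y) * U_stat \<mu> \<sigma> Y s n \<omega>)
           (\<lambda>\<omega>. (LBINT y:{0..1}. (LBINT x:{0..1}. sqrt ((\<sigma> x)\<^sup>2 + (\<sigma> y)\<^sup>2))) * sqrt (2 / pi))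
           (admissible_at_top s)"
proof -
  define \<theta> where "\<theta> = \<rho> * (2 + \<delta>) * (1 + \<delta>) / \<delta>^2"
  have rate: "2 < \<theta> * \<delta> / (2 + \<delta>)"
  proof -
    have "\<theta> * \<delta> / (2 + \<delta>) = \<rho> * ((1 + \<delta>) / \<delta>)"
      using assms(15) by (simp add: \<theta>_def power2_eq_square)
    moreover have "2 \<le> (1 + \<delta>) / \<delta>" using assms(15,16) by (simp add: le_divide_eq)
    then have "1 * 2 < \<rho> * ((1 + \<delta>) / \<delta>)" using assms(14) by (intro mult_less_le_imp_less) auto
    ultimately show ?thesis by simp
  qed
  obtain D S where D: "finite D" and S: "\<And>x. x \<in> {0..1} \<Longrightarrow> \<bar>\<sigma> x\<bar> \<le> S"
    and cont: "\<And>x. x \<in> {0<..<1} - D \<Longrightarrow> isCont \<sigma> x"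
    using piecewise_lipschitz01_regular[OF assms(9)] by blast
  obtain c where ae: "AE x in lborel. x \<in> {0..1} \<longrightarrow> \<mu> x = c" using assms(20) by blast
  have \<mu>: "\<mu> x = c" if "x \<in> {0..<1}" for x by (rule cadlag01_AE_const[OF assms(7) ae that])
  interpret prob_space M by fact
  interpret weighted_process M Y \<theta> \<delta> C \<sigma> D S
  proof unfold_locales
    fix k :: nat assume "1 \<le> k"
    from assms(18)[OF this] show "alpha_mixing_coeff M Y k \<le> C * real k powr (- \<theta>)"
      by (simp add: \<theta>_def)
  qed (use assms rate D S cont in auto)
  \<comment> \<open>Off the admissible \<open>n\<close> both sizes are set to \<open>n\<close>, which turns the limit along the filter into
    a limit of sequences.\<close>
  define l where "l n = (if n \<in> admissible s then block_length s n else n)" for n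
  define b where "b n = (if n \<in> admissible s then block_count s n else n)" for n
  have filt: "filterlim (\<lambda>n. if n \<in> admissible s then f n else n) at_top sequentially"
    if "filterlim f at_top sequentially" for f :: "nat \<Rightarrow> nat"
    unfolding filterlim_at_top
  proof
    fix N :: nat
    have "\<forall>\<^sub>F n in sequentially. N \<le> f n" using that by (simp add: filterlim_at_top)
    with eventually_ge_at_top[of N]
    show "\<forall>\<^sub>F n in sequentially. N \<le> (if n \<in> admissible s then f n else n)" by eventually_elim simp
  qed
  have l: "filterlim l at_top sequentially"
    unfolding l_def[abs_def] block_length_def using assms(12) by (intro filt filterlim_floor_powr) simp
  have b: "filterlim b at_top sequentially"
    unfolding b_def[abs_def] block_count_def using assms(13) by (intro filt filterlim_floor_powr) simp
  have lim: "\<forall>\<^sub>F n in sequentially. integrable M (U_block \<mu> (l n) (b n))"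
    "(\<lambda>n. \<integral>w. \<bar>sqrt (real (l n)) / sqrt (long_run_variance M Y) * U_block \<mu> (l n) (b n) w
        - sigma_integral * sqrt (2 / pi)\<bar> \<partial>M) \<longlonglongrightarrow> 0"
    by (rule U_block_limit[OF _ l b], rule \<mu>, assumption)+
  \<comment> \<open>At admissible n no rounding occurs, so the two sizes multiply to exactly n and
    the design points coincide.\<close>
  have eq: "U_stat \<mu> \<sigma> Y s n = U_block \<mu> (l n) (b n) \<and> block_length s n = l n"
    if "n \<in> admissible s" "1 \<le> n" for n
  proof -
    have "real (l n * b n) = real n powr s * real n powr (1 - s)"
      using that admissible_block_sizes[of n s] by (simp add: l_def b_def)
    also have "\<dots> = real n" using that(2) by (simp add: powr_add[symmetric])
    finally have n: "l n * b n = n" by (simp only: of_nat_eq_iff)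
    show ?thesis
      using that(1) n
      by (auto simp: U_stat_def U_block_def local_mean_def block_mean_def l_def b_def fun_eq_iff)
  qed
  show ?thesis
    unfolding tendsto_L1_def
  proof (intro conjI)
    show "\<forall>\<^sub>F n in admissible_at_top s. integrable M
      (\<lambda>w. sqrt (real (block_length s n)) / sqrt (long_run_variance M Y) * U_stat \<mu> \<sigma> Y s n w)"
      unfolding eventually_admissible_at_top
      using lim(1) eventually_ge_at_top[of 1]
      by eventually_elim (use eq in \<open>auto intro!: integrable_mult_right\<close>)
    have "\<forall>\<^sub>F n in admissible_at_top s.
      (\<integral>w. \<bar>sqrt (real (l n)) / sqrt (long_run_variance M Y) * U_block \<mu> (l n) (b n) w - sigma_integral * sqrt (2 / pi)\<bar> \<partial>M) =
      (\<integral>w. \<bar>sqrt (real (block_length s n)) / sqrt (long_run_variance M Y) * U_stat \<mu> \<sigma> Y s n w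
        - sigma_integral * sqrt (2 / pi)\<bar> \<partial>M)"
      unfolding eventually_admissible_at_top
      using eventually_ge_at_top[of 1] by eventually_elim (use eq in auto)
    \<comment> \<open>The filter of admissible n is finer than \<open>sequentially\<close>, so it
      inherits the limit.\<close>
    moreover have "((\<lambda>n. \<integral>w. \<bar>sqrt (real (l n)) / sqrt (long_run_variance M Y) * U_block \<mu> (l n) (b n) w
        - sigma_integral * sqrt (2 / pi)\<bar> \<partial>M) \<longlongrightarrow> 0) (admissible_at_top s)"
      using lim(2) by (rule tendsto_mono[rotated]) (unfold admissible_at_top_def, rule inf_le1)
    ultimately show "((\<lambda>n. \<integral>w. \<bar>sqrt (real (block_length s n)) / sqrt (long_run_variance M Y) * U_stat \<mu> \<sigma> Y s n w
        - (LBINT y:{0..1}. (LBINT x:{0..1}. sqrt ((\<sigma> x)^2 + (\<sigma> y)^2))) * sqrt (2 / pi)\<bar> \<partial>M) \<longlongrightarrow> 0)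
        (admissible_at_top s)"
      unfolding sigma_integral_def by (rule Lim_transform_eventually[rotated])
  qed simp
qed

end
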